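(* Let $\mathcal{M}$ be the triangular lattice with $L^2$ sites and periodic boundary conditions, and consider the Hubbard model described in the context on it. Suppose that the electron number $N_e$ satisfies $|\mathcal{M}|\ge N_e\ge|\mathcal{M}|-\tfrac12|\mathcal{M}|^{1/2}$. Then, in the limits $U\uparrow\infty$ and $s\uparrow\infty$, every ground state of the model has total spin $S_{\mathrm{tot}}=S_{\max}=N_e/2$.
   Context: Lattice: $\mathcal{M}$ is the triangular lattice with $L\times L$ sites and periodic boundary conditions in both directions. Its sites are $x=(n_1,n_2)\in(\mathbb{Z}/L\mathbb{Z})^2$, and each site is joined to its six neighbours $x\pm(1,0)$, $x\pm(0,1)$, $x\pm(1,-1)$. The bond set $\mathcal{B}$ contains each nearest-neighbour pair exactly once with an arbitrary orientation, and $\mathcal{E}=\mathcal{B}\cup\{(y,x):(x,y)\in\mathcal{B}\}$; thus the coordination number is $\zeta=6$. For each $(x,y)\in\mathcal{B}$ introduce two additional sites $u(x,y),\bar u(x,y)$; let $\mathcal{O}$ and $\bar{\mathcal{O}}$ be the sets of all $u(x,y)$ and all $\bar u(x,y)$ respectively, and let $\Lambda=\mathcal{M}\cup\mathcal{O}\cup\bar{\mathcal{O}}$. Operators: $c_{z,\sigma}$ ($z\in\Lambda$, $\sigma\in\{\uparrow,\downarrow\}$) are the fermion annihilation operators, $n_{z,\sigma}=c^\dagger_{z,\sigma}c_{z,\sigma}$. Fix $\mu>0$. For $x\in\mathcal{M}$, $a_{x,\sigma}=(1+2\zeta\mu^2)^{-1/2}\{c_{x,\sigma}+\mu\sum_{y:(x,y)\in\mathcal{B}}(c_{u(x,y),\sigma}-c_{\bar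 u(x,y),\sigma})+\mu\sum_{y:(y,x)\in\mathcal{B}}(c_{u(y,x),\sigma}+c_{\bar u(y,x),\sigma})\}$. For $u=u(x,y)$, $b_{u,\sigma}=c_{u,\sigma}-\mu(c_{x,\sigma}+c_{y,\sigma})$; for $\bar u=\bar u(x,y)$, $b_{\bar u,\sigma}=c_{\bar u,\sigma}+\mu(c_{x,\sigma}-c_{y,\sigma})$. Hamiltonian, with $s,t,U>0$: $H=t\sum_{(x,y)\in\mathcal{E},\sigma}a^\dagger_{x,\sigma}a_{y,\sigma}+s\sum_{v\in\mathcal{O}\cup\bar{\mathcal{O}},\sigma}b^\dagger_{v,\sigma}b_{v,\sigma}+U\sum_{z\in\Lambda}n_{z,\uparrow}n_{z,\downarrow}$. It acts on the $N_e$-electron space with $N_e\le|\mathcal{M}|$. Spin: $S^+_z=c^\dagger_{z,\uparrow}c_{z,\downarrow}$, $S^-_z=c^\dagger_{z,\downarrow}c_{z,\uparrow}$, $S^{(3)}_z=\tfrac12(n_{z,\uparrow}-n_{z,\downarrow})$, $S^{(1)}_z=(S^+_z+S^-_z)/2$, $S^{(2)}_z=(S^+_z-S^-_z)/(2i)$. The total spin is $\mathbf{S}_{\mathrm{tot}}=\sum_{z\in\Lambda}\mathbf{S}_z$, with eigenvalues of $(\mathbf{S}_{\mathrm{tot}})^2$ written $S_{\mathrm{tot}}(S_{\mathrm{tot}}+1)$. Ground states in the limits: a fixed state $|\Phi\rangle$ is a finite-energy state if $\lim_{s\uparrow\infty}\lim_{U\uparrow\infty}\langle\Phi|H|\Phi\rangle<\infty$.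 The ground states in the limits $U\uparrow\infty$, $s\uparrow\infty$ are the normalized $N_e$-electron states minimizing this limiting energy. *)

theory Defs
  imports "HOL-Analysis.Analysis"
begin

text \<open>Hubbard model on the decorated triangular lattice (Tasaki-type model).
  Sites of the L x L lattice are pairs (n1,n2) with n1,n2 < L.
  A site of Lambda is encoded as a triple (kind, p, q):
  (0, x, (0,0)) is the lattice site x, (1, x, y) is u(x,y) and (2, x, y) is ubar(x,y).
  A fermion mode is a pair (site, spin) with spin True = up, False = down.
  The fermionic Fock space is represented on the basis of finite sets of occupied
  modes; a state is a coefficient function on sets of modes.  The sign convention
  of the creation/annihilation operators uses the lexicographic order on modes.\<close>

type_synonym pt = "nat \<times> nat"
type_synonym site = "nat \<times> pt \<times> pt"
type_synonym mode = "site \<times> bool"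
type_synonym state = "mode set \<Rightarrow> complex"

definition Msites :: "nat \<Rightarrow> pt set" where
  "Msites L = {..<L} \<times> {..<L}"

definition shift :: "nat \<Rightarrow> pt \<Rightarrow> int \<times> int \<Rightarrow> pt" where
  "shift L x d = (nat ((int (fst x) + fst d) mod int L), nat ((int (snd x) + snd d) mod int L))"

definition nn :: "nat \<Rightarrow> pt \<Rightarrow> pt \<Rightarrow> bool" where
  "nn L x y \<longleftrightarrow> x \<in> Msites L \<and>
     y \<in> shift L x ` {(1,0), (-1,0), (0,1), (0,-1), (1,-1), (-1,1)}"

definition valid_bonds :: "nat \<Rightarrow> (pt \<times> pt) set \<Rightarrow> bool" where
  "valid_bonds L B \<longleftrightarrow> B \<subseteq> {(x,y). nn L x y} \<and>
     (\<forall>x y. nn L x y \<longrightarrow> ((x,y) \<in> B \<longleftrightarrow> (y,x) \<notin> B))"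

definition msite :: "pt \<Rightarrow> site" where "msite x = (0, x, (0,0))"
definition usite :: "pt \<Rightarrow> pt \<Rightarrow> site" where "usite x y = (1, x, y)"
definition ubsite :: "pt \<Rightarrow> pt \<Rightarrow> site" where "ubsite x y = (2, x, y)"

definition Lambda :: "nat \<Rightarrow> (pt \<times> pt) set \<Rightarrow> site set" where
  "Lambda L B = msite ` Msites L \<union> (\<lambda>(x,y). usite x y) ` B \<union> (\<lambda>(x,y). ubsite x y) ` B"

definition mode_key :: "mode \<Rightarrow> nat list" where
  "mode_key m = (case m of ((k, (p1, p2), (q1, q2)), \<sigma>) \<Rightarrow> [k, p1, p2, q1, q2, if \<sigma> then 1 else 0])"

definition mode_less :: "mode \<Rightarrow> mode \<Rightarrow> bool" where
  "mode_less i j \<longleftrightarrow> (mode_key i, mode_key j) \<in> lexord {(a, b). a < b}"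

definition fsign :: "mode \<Rightarrow> mode set \<Rightarrow> complex" where
  "fsign j A = (-1) ^ card {i \<in> A. mode_less i j}"

definition ann :: "mode \<Rightarrow> state \<Rightarrow> state" where
  "ann j \<Phi> = (\<lambda>A. if j \<notin> A then fsign j A * \<Phi> (insert j A) else 0)"

definition cre :: "mode \<Rightarrow> state \<Rightarrow> state" where
  "cre j \<Phi> = (\<lambda>A. if j \<in> A then fsign j A * \<Phi> (A - {j}) else 0)"

definition numop :: "mode \<Rightarrow> state \<Rightarrow> state" where
  "numop j \<Phi> = cre j (ann j \<Phi>)"

text \<open>zeta = 6, so the normalisation is (1 + 12 mu^2)^(-1/2).\<close>
definition a_op :: "(pt \<times> pt) set \<Rightarrow> real \<Rightarrow> pt \<Rightarrow> bool \<Rightarrow> state \<Rightarrow> state" where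
  "a_op B \<mu> x \<sigma> \<Phi> = (\<lambda>A. complex_of_real (1 / sqrt (1 + 2 * 6 * \<mu>\<^sup>2)) *
     (ann (msite x, \<sigma>) \<Phi> A
      + complex_of_real \<mu> * (\<Sum>y\<in>{y. (x,y) \<in> B}. ann (usite x y, \<sigma>) \<Phi> A - ann (ubsite x y, \<sigma>) \<Phi> A)
      + complex_of_real \<mu> * (\<Sum>y\<in>{y. (y,x) \<in> B}. ann (usite y x, \<sigma>) \<Phi> A + ann (ubsite y x, \<sigma>) \<Phi> A)))"

definition a_dag :: "(pt \<times> pt) set \<Rightarrow> real \<Rightarrow> pt \<Rightarrow> bool \<Rightarrow> state \<Rightarrow> state" where
  "a_dag B \<mu> x \<sigma> \<Phi> = (\<lambda>A. complex_of_real (1 / sqrt (1 + 2 * 6 * \<mu>\<^sup>2)) *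
     (cre (msite x, \<sigma>) \<Phi> A
      + complex_of_real \<mu> * (\<Sum>y\<in>{y. (x,y) \<in> B}. cre (usite x y, \<sigma>) \<Phi> A - cre (ubsite x y, \<sigma>) \<Phi> A)
      + complex_of_real \<mu> * (\<Sum>y\<in>{y. (y,x) \<in> B}. cre (usite y x, \<sigma>) \<Phi> A + cre (ubsite y x, \<sigma>) \<Phi> A)))"

definition b_u :: "real \<Rightarrow> pt \<Rightarrow> pt \<Rightarrow> bool \<Rightarrow> state \<Rightarrow> state" where
  "b_u \<mu> x y \<sigma> \<Phi> = (\<lambda>A. ann (usite x y, \<sigma>) \<Phi> A
      - complex_of_real \<mu> * (ann (msite x, \<sigma>) \<Phi> A + ann (msite y, \<sigma>) \<Phi> A))"

definition b_u_dag :: "real \<Rightarrow> pt \<Rightarrow> pt \<Rightarrow> bool \<Rightarrow> state \<Rightarrow> state" where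
  "b_u_dag \<mu> x y \<sigma> \<Phi> = (\<lambda>A. cre (usite x y, \<sigma>) \<Phi> A
      - complex_of_real \<mu> * (cre (msite x, \<sigma>) \<Phi> A + cre (msite y, \<sigma>) \<Phi> A))"

definition b_ub :: "real \<Rightarrow> pt \<Rightarrow> pt \<Rightarrow> bool \<Rightarrow> state \<Rightarrow> state" where
  "b_ub \<mu> x y \<sigma> \<Phi> = (\<lambda>A. ann (ubsite x y, \<sigma>) \<Phi> A
      + complex_of_real \<mu> * (ann (msite x, \<sigma>) \<Phi> A - ann (msite y, \<sigma>) \<Phi> A))"

definition b_ub_dag :: "real \<Rightarrow> pt \<Rightarrow> pt \<Rightarrow> bool \<Rightarrow> state \<Rightarrow> state" where
  "b_ub_dag \<mu> x y \<sigma> \<Phi> = (\<lambda>A. cre (ubsite x y, \<sigma>) \<Phi> A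
      + complex_of_real \<mu> * (cre (msite x, \<sigma>) \<Phi> A - cre (msite y, \<sigma>) \<Phi> A))"

text \<open>The Hamiltonian. The sum over O \<union> Obar is written as a sum over bonds of the
  u and ubar terms (u, ubar are injective with disjoint images).\<close>
definition ham :: "nat \<Rightarrow> (pt \<times> pt) set \<Rightarrow> real \<Rightarrow> real \<Rightarrow> real \<Rightarrow> real \<Rightarrow> state \<Rightarrow> state" where
  "ham L B t \<mu> s U \<Phi> = (\<lambda>A.
      complex_of_real t * (\<Sum>(x,y)\<in>B \<union> converse B. \<Sum>\<sigma>\<in>UNIV. a_dag B \<mu> x \<sigma> (a_op B \<mu> y \<sigma> \<Phi>) A)
    + complex_of_real s * (\<Sum>(x,y)\<in>B. \<Sum>\<sigma>\<in>UNIV.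
          b_u_dag \<mu> x y \<sigma> (b_u \<mu> x y \<sigma> \<Phi>) A + b_ub_dag \<mu> x y \<sigma> (b_ub \<mu> x y \<sigma> \<Phi>) A)
    + complex_of_real U * (\<Sum>z\<in>Lambda L B. numop (z, True) (numop (z, False) \<Phi>) A))"

definition inner_st :: "nat \<Rightarrow> (pt \<times> pt) set \<Rightarrow> state \<Rightarrow> state \<Rightarrow> complex" where
  "inner_st L B \<Phi> \<Psi> = (\<Sum>A\<in>Pow (Lambda L B \<times> (UNIV :: bool set)). cnj (\<Phi> A) * \<Psi> A)"

definition nstate :: "nat \<Rightarrow> (pt \<times> pt) set \<Rightarrow> nat \<Rightarrow> state \<Rightarrow> bool" where
  "nstate L B N \<Phi> \<longleftrightarrow> (\<forall>A. \<Phi> A \<noteq> 0 \<longrightarrow> A \<subseteq> Lambda L B \<times> UNIV \<and> card A = N)"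

definition energy :: "nat \<Rightarrow> (pt \<times> pt) set \<Rightarrow> real \<Rightarrow> real \<Rightarrow> real \<Rightarrow> real \<Rightarrow> state \<Rightarrow> real" where
  "energy L B t \<mu> s U \<Phi> = Re (inner_st L B \<Phi> (ham L B t \<mu> s U \<Phi>))"

definition lim_energy :: "nat \<Rightarrow> (pt \<times> pt) set \<Rightarrow> real \<Rightarrow> real \<Rightarrow> state \<Rightarrow> ereal" where
  "lim_energy L B t \<mu> \<Phi> =
     Lim at_top (\<lambda>s. Lim at_top (\<lambda>U. ereal (energy L B t \<mu> s U \<Phi>)))"

definition ground_state :: "nat \<Rightarrow> (pt \<times> pt) set \<Rightarrow> real \<Rightarrow> real \<Rightarrow> nat \<Rightarrow> state \<Rightarrow> bool" where
  "ground_state L B t \<mu> N \<Phi> \<longleftrightarrow>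
     nstate L B N \<Phi> \<and> inner_st L B \<Phi> \<Phi> = 1 \<and>
     (\<forall>\<Psi>. nstate L B N \<Psi> \<and> inner_st L B \<Psi> \<Psi> = 1 \<longrightarrow> lim_energy L B t \<mu> \<Phi> \<le> lim_energy L B t \<mu> \<Psi>)"

definition Splus :: "site \<Rightarrow> state \<Rightarrow> state" where
  "Splus z \<Phi> = cre (z, True) (ann (z, False) \<Phi>)"
definition Sminus :: "site \<Rightarrow> state \<Rightarrow> state" where
  "Sminus z \<Phi> = cre (z, False) (ann (z, True) \<Phi>)"

definition Stot1 :: "nat \<Rightarrow> (pt \<times> pt) set \<Rightarrow> state \<Rightarrow> state" where
  "Stot1 L B \<Phi> = (\<lambda>A. \<Sum>z\<in>Lambda L B. (Splus z \<Phi> A + Sminus z \<Phi> A) / 2)"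
definition Stot2 :: "nat \<Rightarrow> (pt \<times> pt) set \<Rightarrow> state \<Rightarrow> state" where
  "Stot2 L B \<Phi> = (\<lambda>A. \<Sum>z\<in>Lambda L B. (Splus z \<Phi> A - Sminus z \<Phi> A) / (2 * \<i>))"
definition Stot3 :: "nat \<Rightarrow> (pt \<times> pt) set \<Rightarrow> state \<Rightarrow> state" where
  "Stot3 L B \<Phi> = (\<lambda>A. \<Sum>z\<in>Lambda L B. (numop (z, True) \<Phi> A - numop (z, False) \<Phi> A) / 2)"

definition Stot_sq :: "nat \<Rightarrow> (pt \<times> pt) set \<Rightarrow> state \<Rightarrow> state" where
  "Stot_sq L B \<Phi> = (\<lambda>A. Stot1 L B (Stot1 L B \<Phi>) A + Stot2 L B (Stot2 L B \<Phi>) A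
                        + Stot3 L B (Stot3 L B \<Phi>) A)"

end

(*
A state has finite energy iff it is annihilated by all b-operators and has no doubly occupied
site.  On such states a_x acts as a multiple of c_x, and number counting shows that the inner product
is a fixed multiple of the one restricted to configurations inside M; so the model becomes the
hopping of h = L^2 - Ne holes on the triangular lattice.  The absence of double occupancy on the
sites u(x,y) forces the coefficients to be invariant under exchanging the spins of neighbouring
electrons.  Hence, on every configuration whose occupied sites are connected, the state has maximal
spin.

The hopping energy of a configuration is at least minus its number of occupied-empty neighbour
pairs, which is at most 6h in general but at most 6h - 12 if the holes disconnect the electrons.
A fully polarized Slater determinant that leaves the h lowest momenta empty has energy below
-(6h - 12), because h is at most L/2.  If Phi is a ground state and C is the Casimir operator minus
its maximal eigenvalue, then C Phi is again of minimal energy but is supported on disconnected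
configurations, so C Phi = 0.
*)
theory Submission
  imports Defs
begin

section \<open>Fermion operators\<close>

text \<open>The hopping term can create double occupancy, so it does not act on the space of
  finite-energy states. The limit problem is therefore treated as a variational problem for a
  quadratic form on that space, without spectral theory. For a ground state \<open>\<Phi>\<close> of
  energy e the form E = hopping - e * (inner product) is nonnegative and vanishes at
  \<open>\<Phi>\<close>, so its first variation vanishes. The operator C is symmetric for E, and the
  variation in the direction C C \<open>\<Phi>\<close> gives E(C \<open>\<Phi>\<close>, C
  \<open>\<Phi>\<close>) = 0.

  The constants: holes that disconnect the electrons contain two adjacent pairs in each of the six
  directions, which costs 12 moves. On the other side, 6 - \<open>dispersion\<close> is at most (2
  pi / L)^2 times a quadratic form whose average over a box of side 2 r + 1 is (4/3) r (r + 1). With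
  pi <= 10/3, 100 r (r + 1) < 81 h and 2 h <= L, a suitable choice of h empty momenta costs less
  than 48 h^2 / L^2 <= 12. The estimate may start at h = 3 because fewer holes never
  disconnect.\<close>

lemma mode_key_eq_iff: "mode_key i = mode_key j \<longleftrightarrow> i = j"
  by (cases i; cases j) (auto simp: mode_key_def split: prod.splits if_splits)

lemma mode_less_irrefl [simp]: "\<not> mode_less i i"
  by (auto simp: mode_less_def intro!: lexord_irreflexive)

lemma mode_less_iff_not: "i \<noteq> j \<Longrightarrow> mode_less i j \<longleftrightarrow> \<not> mode_less j i"
proof -
  assume "i \<noteq> j"
  have "(mode_key i, mode_key j) \<in> lexord {(a, b). a < b} \<or> mode_key i = mode_key j \<or>
      (mode_key j, mode_key i) \<in> lexord {(a, b). a < b}"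
    by (rule lexord_linear) auto
  moreover have "\<not> ((mode_key i, mode_key j) \<in> lexord {(a, b). a < b} \<and>
      (mode_key j, mode_key i) \<in> lexord {(a, b). a < b})"
    using lexord_asymmetric[of "{(a, b). a < (b :: nat)}"]
    by (auto simp: asym_on_def)
  ultimately show ?thesis using \<open>i \<noteq> j\<close> by (auto simp: mode_less_def mode_key_eq_iff)
qed

text \<open>The key lists the coordinates of the site before the spin, so the order of modes on two
  different sites ignores the spins. This makes fermion signs insensitive to spin flips.\<close>

lemma mode_less_spin: "z \<noteq> w \<Longrightarrow> mode_less (z, s) (w, s') \<longleftrightarrow> mode_less (z, True) (w, True)"
  by (cases z; cases w) (auto simp: mode_less_def mode_key_def split: prod.splits)

lemma fsign_insert:
  assumes "finite A" "i \<notin> A"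
  shows "fsign j (insert i A) = (if mode_less i j then -1 else 1) * fsign j A"
proof (cases "mode_less i j")
  case True
  then have "{k \<in> insert i A. mode_less k j} = insert i {k \<in> A. mode_less k j}" by auto
  then show ?thesis using assms True by (simp add: fsign_def)
next
  case False
  then have "{k \<in> insert i A. mode_less k j} = {k \<in> A. mode_less k j}" by auto
  then show ?thesis using assms False by (simp add: fsign_def)
qed

lemma fsign_self [simp]: "fsign j (insert j A) = fsign j A"
  unfolding fsign_def by (rule arg_cong[where f = "\<lambda>S. (-1) ^ card S"]) auto

lemma fsign_self_diff [simp]: "fsign j (A - {j}) = fsign j A"
  unfolding fsign_def by (rule arg_cong[where f = "\<lambda>S. (-1) ^ card S"]) auto

lemma fsign_square [simp]: "fsign j A * fsign j A = 1"
  by (simp add: fsign_def flip: power_mult_distrib)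

lemma cnj_fsign [simp]: "cnj (fsign j A) = fsign j A"
  by (simp add: fsign_def)

lemma norm_fsign [simp]: "norm (fsign j A) = 1"
  by (simp add: fsign_def norm_power)

text \<open>On infinite sets \<open>card\<close> is 0 and \<open>fsign\<close> no longer changes
  under insertion, so the anticommutation relations are proved for states supported on finite
  sets.\<close>

definition fin_supp :: "state \<Rightarrow> bool" where
  "fin_supp \<Phi> \<longleftrightarrow> (\<forall>A. \<Phi> A \<noteq> 0 \<longrightarrow> finite A)"

lemma fin_suppD: "fin_supp \<Phi> \<Longrightarrow> infinite A \<Longrightarrow> \<Phi> A = 0"
  by (auto simp: fin_supp_def)

lemma fin_supp_ann [simp]: "fin_supp \<Phi> \<Longrightarrow> fin_supp (ann j \<Phi>)"
  by (auto simp: fin_supp_def ann_def)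

lemma fin_supp_cre [simp]: "fin_supp \<Phi> \<Longrightarrow> fin_supp (cre j \<Phi>)"
  by (auto simp: fin_supp_def cre_def)

lemma ann_self [simp]: "ann i (ann i \<Phi>) A = 0"
  by (auto simp: ann_def)

lemma ann_ann:
  assumes "fin_supp \<Phi>"
  shows "ann i (ann j \<Phi>) A = - ann j (ann i \<Phi>) A"
proof (cases "finite A")
  case True
  then show ?thesis
    using mode_less_iff_not[of i j]
    by (cases "i = j") (auto simp: ann_def fsign_insert insert_commute)
next
  case False
  then show ?thesis using fin_suppD[OF assms] by (auto simp: ann_def)
qed

lemma ann_cre:
  assumes "fin_supp \<Phi>"
  shows "ann i (cre j \<Phi>) A = (if i = j then \<Phi> A else 0) - cre j (ann i \<Phi>) A"
proof (cases "finite A")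
  case fin: True
  show ?thesis
  proof (cases "i = j")
    case True
    then show ?thesis by (auto simp: ann_def cre_def insert_absorb)
  next
    case False
    show ?thesis
    proof (cases "i \<notin> A \<and> j \<in> A")
      case True
      then have ex: "insert i A - {j} = insert i (A - {j})" using False by auto
      have "fsign i A = fsign i (insert j (A - {j}))" using True by (simp add: insert_absorb)
      also have "\<dots> = (if mode_less j i then -1 else 1) * fsign i (A - {j})"
        using fin by (intro fsign_insert) auto
      finally show ?thesis
        using True False fin mode_less_iff_not[OF False]
        by (auto simp: ann_def cre_def ex fsign_insert)
    next
      case F: False
      then show ?thesis using False by (auto simp: ann_def cre_def)
    qed
  qed
next
  case False
  then show ?thesis using fin_suppD[OF assms] by (auto simp: ann_def cre_def)
qed

lemma cre_cre:
  assumes "fin_supp \<Phi>"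
  shows "cre i (cre j \<Phi>) A = - cre j (cre i \<Phi>) A"
proof (cases "finite A \<and> i \<noteq> j \<and> i \<in> A \<and> j \<in> A")
  case True
  define C where "C = A - {i, j}"
  have A: "A = insert i (insert j C)" "i \<notin> C" "j \<notin> C" "finite C" "i \<noteq> j"
    using True by (auto simp: C_def)
  have e: "insert i (insert j C) - {i} = insert j C" "insert i (insert j C) - {j} = insert i C"
    "insert j C - {j} = C" "insert i C - {i} = C"
    using A by auto
  show ?thesis
    using A mode_less_iff_not[of i j]
    by (auto simp: cre_def e A(1) fsign_insert)
next
  case False
  then show ?thesis using fin_suppD[OF assms, of "A - {i} - {j}"] fin_suppD[OF assms, of "A - {j} - {i}"]
    by (auto simp: cre_def)
qed

lemma numop_apply: "numop j \<Phi> A = (if j \<in> A then \<Phi> A else 0)"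
  by (auto simp: numop_def cre_def ann_def insert_absorb)

lemma ann_lin [simp]:
  "ann j (\<lambda>A. f A + g A) = (\<lambda>A. ann j f A + ann j g A)"
  "ann j (\<lambda>A. f A - g A) = (\<lambda>A. ann j f A - ann j g A)"
  "ann j (\<lambda>A. c * f A) = (\<lambda>A. c * ann j f A)"
  "ann j (\<lambda>A. f A / c) = (\<lambda>A. ann j f A / c)"
  "ann j (\<lambda>A. - f A) = (\<lambda>A. - ann j f A)"
  "ann j (\<lambda>A. 0) = (\<lambda>A. 0)"
  "ann j (\<lambda>A. \<Sum>i\<in>I. F i A) = (\<lambda>A. \<Sum>i\<in>I. ann j (F i) A)"
  by (auto simp: ann_def fun_eq_iff algebra_simps sum_distrib_left)

lemma cre_lin [simp]:
  "cre j (\<lambda>A. f A + g A) = (\<lambda>A. cre j f A + cre j g A)"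
  "cre j (\<lambda>A. f A - g A) = (\<lambda>A. cre j f A - cre j g A)"
  "cre j (\<lambda>A. c * f A) = (\<lambda>A. c * cre j f A)"
  "cre j (\<lambda>A. f A / c) = (\<lambda>A. cre j f A / c)"
  "cre j (\<lambda>A. - f A) = (\<lambda>A. - cre j f A)"
  "cre j (\<lambda>A. 0) = (\<lambda>A. 0)"
  "cre j (\<lambda>A. \<Sum>i\<in>I. F i A) = (\<lambda>A. \<Sum>i\<in>I. cre j (F i) A)"
  by (auto simp: cre_def fun_eq_iff algebra_simps sum_distrib_left)

lemma fin_supp_lin [intro]:
  "fin_supp f \<Longrightarrow> fin_supp g \<Longrightarrow> fin_supp (\<lambda>A. f A + g A)"
  "fin_supp f \<Longrightarrow> fin_supp g \<Longrightarrow> fin_supp (\<lambda>A. f A - g A)"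
  "fin_supp f \<Longrightarrow> fin_supp (\<lambda>A. c * f A)"
  "fin_supp f \<Longrightarrow> fin_supp (\<lambda>A. f A / c)"
  "(\<And>i. i \<in> I \<Longrightarrow> fin_supp (F i)) \<Longrightarrow> fin_supp (\<lambda>A. \<Sum>i\<in>I. F i A)"
proof -
  show "fin_supp f \<Longrightarrow> fin_supp g \<Longrightarrow> fin_supp (\<lambda>A. f A + g A)"
    unfolding fin_supp_def by (metis add_0)
  show "fin_supp f \<Longrightarrow> fin_supp g \<Longrightarrow> fin_supp (\<lambda>A. f A - g A)"
    unfolding fin_supp_def by (metis diff_0_right)
  show "fin_supp f \<Longrightarrow> fin_supp (\<lambda>A. c * f A)" "fin_supp f \<Longrightarrow> fin_supp (\<lambda>A. f A / c)"
    by (auto simp: fin_supp_def)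
  show "(\<And>i. i \<in> I \<Longrightarrow> fin_supp (F i)) \<Longrightarrow> fin_supp (\<lambda>A. \<Sum>i\<in>I. F i A)"
    unfolding fin_supp_def by (metis (mono_tags, lifting) sum.neutral)
qed

section \<open>Inner products over a set of modes, and number counting\<close>

definition ip :: "mode set \<Rightarrow> state \<Rightarrow> state \<Rightarrow> complex" where
  "ip S \<Phi> \<Psi> = (\<Sum>A\<in>Pow S. cnj (\<Phi> A) * \<Psi> A)"

lemma ip_lin:
  "ip S \<Phi> (\<lambda>A. f A + g A) = ip S \<Phi> f + ip S \<Phi> g"
  "ip S \<Phi> (\<lambda>A. f A - g A) = ip S \<Phi> f - ip S \<Phi> g"
  "ip S \<Phi> (\<lambda>A. c * f A) = c * ip S \<Phi> f"
  "ip S \<Phi> (\<lambda>A. f A / c) = ip S \<Phi> f / c"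
  "ip S \<Phi> (\<lambda>A. - f A) = - ip S \<Phi> f"
  "ip S \<Phi> (\<lambda>A. 0) = 0"
  "ip S (\<lambda>A. f A + g A) \<Psi> = ip S f \<Psi> + ip S g \<Psi>"
  "ip S (\<lambda>A. f A - g A) \<Psi> = ip S f \<Psi> - ip S g \<Psi>"
  "ip S (\<lambda>A. c * f A) \<Psi> = cnj c * ip S f \<Psi>"
  "ip S (\<lambda>A. f A / c) \<Psi> = ip S f \<Psi> / cnj c"
  "ip S (\<lambda>A. - f A) \<Psi> = - ip S f \<Psi>"
  "ip S (\<lambda>A. 0) \<Psi> = 0"
  by (simp_all add: ip_def algebra_simps sum.distrib sum_subtractf sum_distrib_left
      sum_negf sum_divide_distrib)

lemma ip_sum:
  "ip S \<Phi> (\<lambda>A. \<Sum>i\<in>I. F i A) = (\<Sum>i\<in>I. ip S \<Phi> (F i))"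
  "ip S (\<lambda>A. \<Sum>i\<in>I. F i A) \<Psi> = (\<Sum>i\<in>I. ip S (F i) \<Psi>)"
proof -
  show "ip S \<Phi> (\<lambda>A. \<Sum>i\<in>I. F i A) = (\<Sum>i\<in>I. ip S \<Phi> (F i))"
    unfolding ip_def by (simp add: sum_distrib_left) (rule sum.swap)
  show "ip S (\<lambda>A. \<Sum>i\<in>I. F i A) \<Psi> = (\<Sum>i\<in>I. ip S (F i) \<Psi>)"
    unfolding ip_def by (simp add: sum_distrib_right cnj_sum) (rule sum.swap)
qed

lemma ip_cnj: "cnj (ip S \<Phi> \<Psi>) = ip S \<Psi> \<Phi>"
  by (simp add: ip_def mult.commute)

lemma ip_self: "ip S \<Phi> \<Phi> = complex_of_real (\<Sum>A\<in>Pow S. (norm (\<Phi> A))\<^sup>2)"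
  by (simp add: ip_def complex_norm_square mult.commute del: of_real_power)

lemma Re_ip_self_nonneg: "Re (ip S \<Phi> \<Phi>) \<ge> 0"
  by (simp add: ip_self sum_nonneg)

lemma Re_ip_self_eq_0_iff:
  assumes "finite S"
  shows "Re (ip S \<Phi> \<Phi>) = 0 \<longleftrightarrow> (\<forall>A\<subseteq>S. \<Phi> A = 0)"
  using assms by (subst ip_self) (auto simp: sum_nonneg_eq_0_iff)

lemma ip_cong:
  assumes "\<And>A. A \<subseteq> S \<Longrightarrow> \<Phi> A = \<Phi>' A" "\<And>A. A \<subseteq> S \<Longrightarrow> \<Psi> A = \<Psi>' A"
  shows "ip S \<Phi> \<Psi> = ip S \<Phi>' \<Psi>'"
  using assms by (simp add: ip_def)

lemma ip_cre:
  assumes "finite S" "j \<in> S"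
  shows "ip S \<Phi> (cre j \<Psi>) = ip S (ann j \<Phi>) \<Psi>"
proof -
  have "ip S \<Phi> (cre j \<Psi>) = (\<Sum>A\<in>{A\<in>Pow S. j \<in> A}. cnj (\<Phi> A) * cre j \<Psi> A)"
    unfolding ip_def using assms by (intro sum.mono_neutral_right) (auto simp: cre_def)
  also have "\<dots> = (\<Sum>A\<in>{A\<in>Pow S. j \<notin> A}. cnj (ann j \<Phi> A) * \<Psi> A)"
    using assms
    by (intro sum.reindex_bij_witness[where i = "insert j" and j = "\<lambda>A. A - {j}"])
       (auto simp: cre_def ann_def insert_absorb)
  also have "\<dots> = ip S (ann j \<Phi>) \<Psi>"
    unfolding ip_def using assms by (intro sum.mono_neutral_left) (auto simp: ann_def)
  finally show ?thesis .
qed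

lemma ip_cre': "finite S \<Longrightarrow> j \<in> S \<Longrightarrow> ip S (cre j \<Phi>) \<Psi> = ip S \<Phi> (ann j \<Psi>)"
  by (metis ip_cnj ip_cre)

text \<open>The terms add up to the number operator once the creators are moved by
  \<open>ip_cre\<close>. \<open>S\<close> may be smaller than the support of the states, so
  \<open>ip_ker_b\<close> can use the identity once on the decorated lattice and once on M.\<close>

lemma sum_ip_ann:
  assumes "finite S" "\<And>A. \<Phi> A \<noteq> 0 \<Longrightarrow> card A = N"
  shows "(\<Sum>j\<in>S. ip S (ann j \<Phi>) (ann j \<Psi>)) = of_nat N * ip S \<Phi> \<Psi>"
proof -
  have "(\<Sum>j\<in>S. ip S (ann j \<Phi>) (ann j \<Psi>)) = (\<Sum>j\<in>S. ip S \<Phi> (numop j \<Psi>))"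
    using assms(1) by (simp add: numop_def ip_cre)
  also have "\<dots> = (\<Sum>A\<in>Pow S. \<Sum>j\<in>S. if j \<in> A then cnj (\<Phi> A) * \<Psi> A else 0)"
    unfolding ip_def by (subst sum.swap) (simp add: numop_apply if_distrib cong: if_cong)
  also have "\<dots> = (\<Sum>A\<in>Pow S. of_nat N * (cnj (\<Phi> A) * \<Psi> A))"
  proof (rule sum.cong)
    fix A assume "A \<in> Pow S"
    then have "A \<subseteq> S" by auto
    then have "(\<Sum>j\<in>S. if j \<in> A then cnj (\<Phi> A) * \<Psi> A else 0) = of_nat (card A) * (cnj (\<Phi> A) * \<Psi> A)"
      using assms(1) by (simp add: sum.If_cases Int_absorb1 flip: sum.inter_restrict)
    then show "(\<Sum>j\<in>S. if j \<in> A then cnj (\<Phi> A) * \<Psi> A else 0) = of_nat N * (cnj (\<Phi> A) * \<Psi> A)"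
      using assms(2) by (cases "\<Phi> A = 0") auto
  qed simp
  finally show ?thesis by (simp add: ip_def sum_distrib_left)
qed

section \<open>The lattice and the energy functional\<close>

definition dirs :: "(int \<times> int) set" where
  "dirs = {(1,0), (-1,0), (0,1), (0,-1), (1,-1), (-1,1)}"

lemma finite_dirs [simp]: "finite dirs" and card_dirs: "card dirs = 6"
  by (simp_all add: dirs_def)

lemma dirs_uminus: "d \<in> dirs \<Longrightarrow> - d \<in> dirs"
  by (auto simp: dirs_def)

lemma nn_iff: "nn L x y \<longleftrightarrow> x \<in> Msites L \<and> (\<exists>d\<in>dirs. y = shift L x d)"
  by (auto simp: nn_def dirs_def)

lemma finite_Msites [simp]: "finite (Msites L)" and card_Msites: "card (Msites L) = L * L"
  by (simp_all add: Msites_def card_cartesian_product)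

lemma shift_in_Msites: "L > 0 \<Longrightarrow> shift L x d \<in> Msites L"
  by (auto simp: shift_def Msites_def nat_less_iff)

lemma int_shift:
  "L > 0 \<Longrightarrow> int (fst (shift L x d)) = (int (fst x) + fst d) mod int L"
  "L > 0 \<Longrightarrow> int (snd (shift L x d)) = (int (snd x) + snd d) mod int L"
  by (simp_all add: shift_def)

lemma shift_shift: "L > 0 \<Longrightarrow> shift L (shift L x d) e = shift L x (d + e)"
  by (auto simp: prod_eq_iff int_shift mod_simps add.assoc simp flip: of_nat_eq_iff[where 'a = int])

lemma shift_eq_iff:
  assumes "L > 0"
  shows "shift L x d = shift L x e \<longleftrightarrow> int L dvd fst d - fst e \<and> int L dvd snd d - snd e"
proof -
  have *: "(a + b) mod int L = (a + c) mod int L \<longleftrightarrow> int L dvd b - c" for a b c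
    by (simp add: mod_eq_dvd_iff)
  have "shift L x d = shift L x e \<longleftrightarrow>
    int (fst (shift L x d)) = int (fst (shift L x e)) \<and> int (snd (shift L x d)) = int (snd (shift L x e))"
    by (auto simp: prod_eq_iff)
  then show ?thesis by (simp add: int_shift[OF assms] *)
qed

lemma shift_0: "x \<in> Msites L \<Longrightarrow> shift L x (0, 0) = x"
  by (auto simp: shift_def Msites_def)

lemma shift_uminus: "x \<in> Msites L \<Longrightarrow> shift L (shift L x d) (- d) = x"
  by (subst shift_shift) (auto simp: Msites_def zero_prod_def shift_def)

lemma nn_sym: "nn L x y \<Longrightarrow> nn L y x"
proof -
  assume "nn L x y"
  then obtain d where d: "x \<in> Msites L" "d \<in> dirs" "y = shift L x d" by (auto simp: nn_iff)
  then have "L > 0" by (auto simp: Msites_def)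
  then show "nn L y x"
    using d dirs_uminus shift_uminus[of x L d] unfolding nn_iff
    by (intro conjI bexI[of _ "- d"]) (auto simp only: shift_in_Msites)
qed

lemma nn_Msites: "nn L x y \<Longrightarrow> x \<in> Msites L" "nn L x y \<Longrightarrow> y \<in> Msites L"
  using nn_iff nn_sym by blast+

text \<open>Coordinates of two directions differ by at most 2 in absolute value, so a difference
  divisible by \<open>L\<close> vanishes once \<open>L\<close> is at least 3. Every site then has
  exactly six neighbours.\<close>

lemma inj_on_shift_dirs:
  assumes "L \<ge> 3"
  shows "inj_on (shift L x) dirs"
proof (rule inj_onI)
  fix d e assume d: "d \<in> dirs" "e \<in> dirs" and "shift L x d = shift L x e"
  then have *: "int L dvd fst d - fst e" "int L dvd snd d - snd e"
    using shift_eq_iff[of L] assms by auto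
  have **: "m = 0" if "int L dvd m" "\<bar>m\<bar> < 3" for m
    using that dvd_imp_le_int[of m "int L"] assms by auto
  have "fst d - fst e = 0" "snd d - snd e = 0"
    using d by (intro **[OF *(1)] **[OF *(2)]; auto simp: dirs_def)+
  then show "d = e" by (simp add: prod_eq_iff)
qed

lemma sum_nn:
  assumes "L \<ge> 3" "x \<in> Msites L"
  shows "(\<Sum>y\<in>{y. nn L x y}. F y) = (\<Sum>d\<in>dirs. F (shift L x d))"
proof -
  have "{y. nn L x y} = shift L x ` dirs" using assms by (auto simp: nn_iff)
  then show ?thesis using inj_on_shift_dirs[OF assms(1)] by (simp add: sum.reindex)
qed

lemma finite_nn: "finite {y. nn L x y}" "finite {(x, y). nn L x y}"
proof -
  have "{(x, y). nn L x y} \<subseteq> Msites L \<times> Msites L" using nn_Msites by blast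
  then show "finite {(x, y). nn L x y}" by (rule finite_subset) simp
  have "{y. nn L x y} \<subseteq> Msites L" using nn_Msites(2) by blast
  then show "finite {y. nn L x y}" by (rule finite_subset) simp
qed

lemma nn_irrefl: "L \<ge> 3 \<Longrightarrow> \<not> nn L x x"
proof
  assume L: "L \<ge> 3" and "nn L x x"
  then obtain d where d: "x \<in> Msites L" "d \<in> dirs" "x = shift L x d" by (auto simp: nn_iff)
  then have "shift L x d = shift L x (0,0)" by (simp add: shift_0)
  then have "int L dvd fst d" "int L dvd snd d" using shift_eq_iff[of L] L by auto
  then show False using d(2) L by (auto simp: dirs_def zdvd_not_zless)
qed

section \<open>Oriented bonds and sums over them\<close>

locale bonds =
  fixes L :: nat and B :: "(pt \<times> pt) set"
  assumes L3: "L \<ge> 3" and vb: "valid_bonds L B"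
begin

lemma bond_nn: "(x, y) \<in> B \<Longrightarrow> nn L x y"
  using vb unfolding valid_bonds_def by blast

lemma bond_orient: "nn L x y \<Longrightarrow> (x, y) \<in> B \<longleftrightarrow> (y, x) \<notin> B"
  using vb unfolding valid_bonds_def by blast

lemma bonds_Un: "B \<union> converse B = {(x, y). nn L x y}"
proof -
  have "p \<in> B \<union> converse B \<longleftrightarrow> nn L (fst p) (snd p)" for p
    using bond_nn[of "fst p" "snd p"] bond_nn[of "snd p" "fst p"] bond_orient[of "fst p" "snd p"]
      nn_sym[of L "snd p" "fst p"] by (cases p) (simp, blast)
  then show ?thesis by (simp add: set_eq_iff case_prod_beta)
qed

lemma bonds_disj: "B \<inter> converse B = {}"
  using bond_nn bond_orient by blast

lemma bond_M: "(x, y) \<in> B \<Longrightarrow> x \<in> Msites L" "(x, y) \<in> B \<Longrightarrow> y \<in> Msites L"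
  using bond_nn nn_Msites by blast+

lemma finite_B [simp]: "finite B"
  using finite_nn(2)[of L] bonds_Un by (metis finite_Un)

lemma finite_out [simp]: "finite {y. (x, y) \<in> B}" "finite {y. (y, x) \<in> B}"
  by (rule finite_subset[OF _ finite_nn(1)[of L x]], use bond_nn nn_sym in blast)+

lemma finite_Lambda [simp]: "finite (Lambda L B)"
  by (simp add: Lambda_def)

lemma sum_neighbours:
  fixes F :: "pt \<Rightarrow> 'a :: comm_monoid_add"
  shows "(\<Sum>y\<in>{y. (x, y) \<in> B}. F y) + (\<Sum>y\<in>{y. (y, x) \<in> B}. F y) = (\<Sum>y\<in>{y. nn L x y}. F y)"
proof -
  have "{y. nn L x y} = {y. (x, y) \<in> B} \<union> {y. (y, x) \<in> B}" using bonds_Un by auto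
  moreover have "{y. (x, y) \<in> B} \<inter> {y. (y, x) \<in> B} = {}" using bonds_disj by auto
  ultimately show ?thesis by (simp add: sum.union_disjoint)
qed

lemma sum_nn_const:
  fixes c :: "'a :: semiring_1"
  assumes "x \<in> Msites L"
  shows "(\<Sum>y\<in>{y. nn L x y}. c) = 6 * c"
  using sum_nn[OF L3 assms, of "\<lambda>_. c"] by (simp add: card_dirs del: sum_constant) (simp add: card_dirs)

lemma sum_edges:
  fixes F :: "pt \<Rightarrow> pt \<Rightarrow> 'a :: comm_monoid_add"
  shows "(\<Sum>(x, y)\<in>B \<union> converse B. F x y) = (\<Sum>x\<in>Msites L. \<Sum>y\<in>{y. nn L x y}. F x y)"
proof -
  have "B \<union> converse B = Sigma (Msites L) (\<lambda>x. {y. nn L x y})"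
    using bonds_Un nn_Msites by auto
  then show ?thesis by (simp add: sum.Sigma finite_nn)
qed

text \<open>Double counting: reversing the bonds turns second endpoints into first ones, and each
  site lies on six bonds.\<close>

lemma sum_bonds_endpoints:
  fixes F :: "pt \<Rightarrow> 'a :: semiring_1"
  shows "(\<Sum>(x, y)\<in>B. F x + F y) = 6 * (\<Sum>x\<in>Msites L. F x)"
proof -
  have "(\<Sum>(x, y)\<in>B. F x + F y) = (\<Sum>(x, y)\<in>B. F x) + (\<Sum>(x, y)\<in>B. F y)"
    by (simp add: case_prod_beta sum.distrib)
  also have "(\<Sum>(x, y)\<in>B. F y) = (\<Sum>(x, y)\<in>converse B. F x)"
    by (rule sum.reindex_bij_witness[where i = prod.swap and j = prod.swap]) auto
  also have "(\<Sum>(x, y)\<in>B. F x) + (\<Sum>(x, y)\<in>converse B. F x) = (\<Sum>(x, y)\<in>B \<union> converse B. F x)"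
    using bonds_disj by (simp add: sum.union_disjoint)
  also have "\<dots> = (\<Sum>x\<in>Msites L. 6 * F x)"
    unfolding sum_edges by (rule sum.cong) (auto simp only: sum_nn_const)
  finally show ?thesis by (simp add: sum_distrib_left)
qed

lemma sum_Lambda:
  fixes F :: "site \<Rightarrow> 'a :: comm_monoid_add"
  shows "(\<Sum>z\<in>Lambda L B. F z) = (\<Sum>x\<in>Msites L. F (msite x)) + (\<Sum>(x, y)\<in>B. F (usite x y) + F (ubsite x y))"
proof -
  have "inj_on msite (Msites L)" "inj_on (\<lambda>(x, y). usite x y) B" "inj_on (\<lambda>(x, y). ubsite x y) B"
    by (auto simp: inj_on_def msite_def usite_def ubsite_def)
  note inj = this[THEN sum.reindex, unfolded case_prod_beta]
  have "msite ` Msites L \<inter> (\<lambda>(x, y). usite x y) ` B = {}"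
    "(msite ` Msites L \<union> (\<lambda>(x, y). usite x y) ` B) \<inter> (\<lambda>(x, y). ubsite x y) ` B = {}"
    by (auto simp: msite_def usite_def ubsite_def)
  then show ?thesis unfolding Lambda_def
    by (simp add: sum.union_disjoint inj case_prod_beta sum.distrib o_def add.assoc)
qed

lemma Lambda_mem: "x \<in> Msites L \<Longrightarrow> msite x \<in> Lambda L B"
  "(x, y) \<in> B \<Longrightarrow> usite x y \<in> Lambda L B" "(x, y) \<in> B \<Longrightarrow> ubsite x y \<in> Lambda L B"
  by (auto simp: Lambda_def)

section \<open>Adjoints, the energy and its two limits\<close>

abbreviation "LM \<equiv> Lambda L B \<times> (UNIV :: bool set)"
abbreviation "MM \<equiv> msite ` Msites L \<times> (UNIV :: bool set)"

lemma inner_st_ip: "inner_st L B \<Phi> \<Psi> = ip LM \<Phi> \<Psi>"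
  by (simp add: inner_st_def ip_def)

lemma ip_a_dag:
  assumes "x \<in> Msites L"
  shows "ip LM \<Phi> (a_dag B \<mu> x \<sigma> \<Psi>) = ip LM (a_op B \<mu> x \<sigma> \<Phi>) \<Psi>"
  unfolding a_dag_def a_op_def
  using assms by (auto simp: ip_lin ip_sum ip_cre Lambda_mem intro!: arg_cong2[where f = "(+)"] sum.cong)

lemma ip_b_u_dag:
  assumes "(x, y) \<in> B"
  shows "ip LM \<Phi> (b_u_dag \<mu> x y \<sigma> \<Psi>) = ip LM (b_u \<mu> x y \<sigma> \<Phi>) \<Psi>"
  unfolding b_u_dag_def b_u_def
  using assms bond_M by (simp add: ip_lin ip_sum ip_cre Lambda_mem)

lemma ip_b_ub_dag:
  assumes "(x, y) \<in> B"
  shows "ip LM \<Phi> (b_ub_dag \<mu> x y \<sigma> \<Psi>) = ip LM (b_ub \<mu> x y \<sigma> \<Phi>) \<Psi>"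
  unfolding b_ub_dag_def b_ub_def
  using assms bond_M by (simp add: ip_lin ip_sum ip_cre Lambda_mem)

definition hop_form :: "real \<Rightarrow> state \<Rightarrow> state \<Rightarrow> complex" where
  "hop_form \<mu> \<Phi> \<Psi> = (\<Sum>(x, y)\<in>B \<union> converse B. \<Sum>\<sigma>\<in>UNIV. ip LM (a_op B \<mu> x \<sigma> \<Phi>) (a_op B \<mu> y \<sigma> \<Psi>))"

definition b_energy :: "real \<Rightarrow> state \<Rightarrow> real" where
  "b_energy \<mu> \<Phi> = (\<Sum>(x, y)\<in>B. \<Sum>\<sigma>\<in>UNIV. Re (ip LM (b_u \<mu> x y \<sigma> \<Phi>) (b_u \<mu> x y \<sigma> \<Phi>))
     + Re (ip LM (b_ub \<mu> x y \<sigma> \<Phi>) (b_ub \<mu> x y \<sigma> \<Phi>)))"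

definition double_occ :: "state \<Rightarrow> real" where
  "double_occ \<Phi> = (\<Sum>z\<in>Lambda L B. \<Sum>A\<in>Pow LM. if (z, True) \<in> A \<and> (z, False) \<in> A then (norm (\<Phi> A))\<^sup>2 else 0)"

text \<open>Moving the creators to the left argument turns the b-terms into squared norms and the
  interaction into a weighted sum of squared coefficients. The energy is thus affine in
  \<open>s\<close> and \<open>U\<close> with nonnegative slopes, which makes both limits
  explicit.\<close>

lemma energy_decomp:
  "energy L B t \<mu> s U \<Phi> = t * Re (hop_form \<mu> \<Phi> \<Phi>) + s * b_energy \<mu> \<Phi> + U * double_occ \<Phi>"
proof -
  have 1: "ip LM \<Phi> (\<lambda>A. \<Sum>(x, y)\<in>B \<union> converse B. \<Sum>\<sigma>\<in>UNIV. a_dag B \<mu> x \<sigma> (a_op B \<mu> y \<sigma> \<Phi>) A) = hop_form \<mu> \<Phi> \<Phi>"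
    unfolding hop_form_def case_prod_beta ip_sum using bond_M
    by (intro sum.cong refl ip_a_dag) auto
  have 2: "ip LM \<Phi> (\<lambda>A. \<Sum>(x, y)\<in>B. \<Sum>\<sigma>\<in>UNIV.
          b_u_dag \<mu> x y \<sigma> (b_u \<mu> x y \<sigma> \<Phi>) A + b_ub_dag \<mu> x y \<sigma> (b_ub \<mu> x y \<sigma> \<Phi>) A) =
     (\<Sum>(x, y)\<in>B. \<Sum>\<sigma>\<in>UNIV. ip LM (b_u \<mu> x y \<sigma> \<Phi>) (b_u \<mu> x y \<sigma> \<Phi>)
     + ip LM (b_ub \<mu> x y \<sigma> \<Phi>) (b_ub \<mu> x y \<sigma> \<Phi>))"
    unfolding case_prod_beta ip_sum ip_lin
    by (intro sum.cong refl arg_cong2[where f = "(+)"] ip_b_u_dag ip_b_ub_dag) auto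
  have 3: "ip LM \<Phi> (\<lambda>A. \<Sum>z\<in>Lambda L B. numop (z, True) (numop (z, False) \<Phi>) A) = complex_of_real (double_occ \<Phi>)"
    unfolding ip_sum double_occ_def of_real_sum unfolding ip_def
    by (intro sum.cong refl) (auto simp: numop_apply complex_norm_square mult.commute simp del: of_real_power)
  show ?thesis
    unfolding energy_def inner_st_ip ham_def ip_lin 1 2 3
    by (simp add: b_energy_def case_prod_beta)
qed

lemma b_energy_nonneg: "b_energy \<mu> \<Phi> \<ge> 0"
  unfolding b_energy_def by (intro sum_nonneg) (auto intro!: sum_nonneg add_nonneg_nonneg Re_ip_self_nonneg)

lemma double_occ_nonneg: "double_occ \<Phi> \<ge> 0"
  unfolding double_occ_def by (intro sum_nonneg) auto

lemma Lim_const_at_top: "Lim (at_top :: real filter) (\<lambda>_. c :: ereal) = c"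
  by (intro tendsto_Lim tendsto_const) simp

lemma lim_energy_finite:
  assumes "b_energy \<mu> \<Phi> = 0" "double_occ \<Phi> = 0"
  shows "lim_energy L B t \<mu> \<Phi> = ereal (t * Re (hop_form \<mu> \<Phi> \<Phi>))"
  unfolding lim_energy_def energy_decomp using assms by (simp add: Lim_const_at_top)

lemma tendsto_affine_PInfty:
  assumes "(c :: real) > 0"
  shows "((\<lambda>u. ereal (a + u * c)) \<longlongrightarrow> \<infinity>) at_top"
proof -
  have "filterlim (\<lambda>u. a + u * c) at_top at_top"
    using assms by (intro filterlim_tendsto_add_at_top tendsto_const filterlim_at_top_mult_tendsto_pos[OF tendsto_const])
      (auto intro: filterlim_ident)
  then show ?thesis by (simp add: tendsto_PInfty_eq_at_top)
qed

text \<open>The limit in \<open>U\<close> is taken first: a positive \<open>double_occ\<close> makes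
  it infinite for every \<open>s\<close>. Otherwise the energy does not depend on \<open>U\<close>,
  and the positive slope \<open>b_energy\<close> makes the outer limit infinite.\<close>

lemma lim_energy_PInfty:
  assumes "b_energy \<mu> \<Phi> \<noteq> 0 \<or> double_occ \<Phi> \<noteq> 0"
  shows "lim_energy L B t \<mu> \<Phi> = \<infinity>"
proof (cases "double_occ \<Phi> = 0")
  case False
  then have "double_occ \<Phi> > 0" using double_occ_nonneg[of \<Phi>] by auto
  then have "Lim at_top (\<lambda>U. ereal (energy L B t \<mu> s U \<Phi>)) = \<infinity>" for s
    unfolding energy_decomp by (intro tendsto_Lim tendsto_affine_PInfty) auto
  then show ?thesis by (simp add: lim_energy_def Lim_const_at_top)
next
  case True
  then have "b_energy \<mu> \<Phi> > 0" using assms b_energy_nonneg[of \<mu> \<Phi>] by auto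
  then have "Lim at_top (\<lambda>s. ereal (t * Re (hop_form \<mu> \<Phi> \<Phi>) + s * b_energy \<mu> \<Phi>)) = \<infinity>"
    by (intro tendsto_Lim tendsto_affine_PInfty) auto
  then show ?thesis by (simp add: lim_energy_def energy_decomp True Lim_const_at_top)
qed

end

section \<open>States of finite energy\<close>

context bonds
begin

lemma nstate_fin_supp: "nstate L B N \<Phi> \<Longrightarrow> fin_supp \<Phi>"
proof -
  have "finite LM" by simp
  then show "nstate L B N \<Phi> \<Longrightarrow> fin_supp \<Phi>"
    unfolding nstate_def fin_supp_def using finite_subset by blast
qed

lemma nstate_ann: "nstate L B (Suc N) \<Phi> \<Longrightarrow> nstate L B N (ann j \<Phi>)"
proof -
  assume n: "nstate L B (Suc N) \<Phi>"
  have "A \<subseteq> LM \<and> card A = N" if "ann j \<Phi> A \<noteq> 0" for A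
  proof -
    have "j \<notin> A" and *: "\<Phi> (insert j A) \<noteq> 0" using that by (auto simp: ann_def split: if_splits)
    moreover have "insert j A \<subseteq> LM \<and> card (insert j A) = Suc N" using n * by (auto simp: nstate_def)
    moreover from this have "finite A" by (metis card.infinite finite_insert nat.distinct(1))
    ultimately show ?thesis by auto
  qed
  then show "nstate L B N (ann j \<Phi>)" by (auto simp: nstate_def)
qed

lemma nstate_cre:
  assumes n: "nstate L B N \<Phi>" and j: "j \<in> LM"
  shows "nstate L B (Suc N) (cre j \<Phi>)"
proof -
  have "A \<subseteq> LM \<and> card A = Suc N" if "cre j \<Phi> A \<noteq> 0" for A
  proof -
    have "j \<in> A" and *: "\<Phi> (A - {j}) \<noteq> 0" using that by (auto simp: cre_def split: if_splits)
    moreover have "A - {j} \<subseteq> LM \<and> card (A - {j}) = N" using n * by (auto simp: nstate_def)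
    moreover from this have "finite A" using finite_subset[of "A - {j}" LM] by auto
    ultimately show ?thesis using j card_Suc_Diff1[of A j] by auto
  qed
  then show ?thesis by (auto simp: nstate_def)
qed

lemma nstate_lin:
  "nstate L B N f \<Longrightarrow> nstate L B N g \<Longrightarrow> nstate L B N (\<lambda>A. f A + g A)"
  "nstate L B N f \<Longrightarrow> nstate L B N g \<Longrightarrow> nstate L B N (\<lambda>A. f A - g A)"
  "nstate L B N f \<Longrightarrow> nstate L B N (\<lambda>A. c * f A)"
  "(\<And>i. i \<in> I \<Longrightarrow> nstate L B N (F i)) \<Longrightarrow> nstate L B N (\<lambda>A. \<Sum>i\<in>I. F i A)"
proof -
  show "nstate L B N f \<Longrightarrow> nstate L B N g \<Longrightarrow> nstate L B N (\<lambda>A. f A + g A)"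
    unfolding nstate_def by (metis add_0)
  show "nstate L B N f \<Longrightarrow> nstate L B N g \<Longrightarrow> nstate L B N (\<lambda>A. f A - g A)"
    unfolding nstate_def by (metis diff_0_right)
  show "nstate L B N f \<Longrightarrow> nstate L B N (\<lambda>A. c * f A)"
    by (auto simp: nstate_def)
  show "(\<And>i. i \<in> I \<Longrightarrow> nstate L B N (F i)) \<Longrightarrow> nstate L B N (\<lambda>A. \<Sum>i\<in>I. F i A)"
    unfolding nstate_def by (metis (mono_tags, lifting) sum.neutral)
qed

text \<open>The equations of the b-operators solved for the decoration sites: an annihilator there
  becomes a combination of annihilators at the two ends of the bond. In this form it serves as a
  rewrite rule that eliminates the decoration.\<close>

definition ker_b :: "real \<Rightarrow> state \<Rightarrow> bool" where
  "ker_b \<mu> \<Phi> \<longleftrightarrow> (\<forall>x y \<sigma>. (x, y) \<in> B \<longrightarrow>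
     ann (usite x y, \<sigma>) \<Phi> = (\<lambda>A. complex_of_real \<mu> * (ann (msite x, \<sigma>) \<Phi> A + ann (msite y, \<sigma>) \<Phi> A)) \<and>
     ann (ubsite x y, \<sigma>) \<Phi> = (\<lambda>A. - complex_of_real \<mu> * (ann (msite x, \<sigma>) \<Phi> A - ann (msite y, \<sigma>) \<Phi> A)))"

lemma ker_bD:
  assumes "ker_b \<mu> \<Phi>" "(x, y) \<in> B"
  shows "ann (usite x y, \<sigma>) \<Phi> = (\<lambda>A. complex_of_real \<mu> * (ann (msite x, \<sigma>) \<Phi> A + ann (msite y, \<sigma>) \<Phi> A))"
    "ann (ubsite x y, \<sigma>) \<Phi> = (\<lambda>A. - complex_of_real \<mu> * (ann (msite x, \<sigma>) \<Phi> A - ann (msite y, \<sigma>) \<Phi> A))"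
  using assms unfolding ker_b_def by blast+

lemma ker_b_iff: "ker_b \<mu> \<Phi> \<longleftrightarrow> (\<forall>x y \<sigma>. (x, y) \<in> B \<longrightarrow>
    b_u \<mu> x y \<sigma> \<Phi> = (\<lambda>_. 0) \<and> b_ub \<mu> x y \<sigma> \<Phi> = (\<lambda>_. 0))"
  by (simp add: ker_b_def b_u_def b_ub_def fun_eq_iff eq_neg_iff_add_eq_0)

lemma ker_b_lin:
  "ker_b \<mu> f \<Longrightarrow> ker_b \<mu> g \<Longrightarrow> ker_b \<mu> (\<lambda>A. f A + g A)"
  "ker_b \<mu> f \<Longrightarrow> ker_b \<mu> g \<Longrightarrow> ker_b \<mu> (\<lambda>A. f A - g A)"
  "ker_b \<mu> f \<Longrightarrow> ker_b \<mu> (\<lambda>A. c * f A)"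
  by (auto simp: ker_b_def algebra_simps)

text \<open>Annihilators anticommute, so removing an electron stays in the kernel. This opens the
  way to induction on the number of electrons.\<close>

lemma ker_b_ann:
  assumes "ker_b \<mu> \<Phi>" "fin_supp \<Phi>"
  shows "ker_b \<mu> (ann j \<Phi>)"
  unfolding ker_b_def
proof (intro allI impI)
  fix x y \<sigma> assume b: "(x, y) \<in> B"
  have *: "ann i (ann j \<Phi>) = (\<lambda>A. - ann j (ann i \<Phi>) A)" for i
    using ann_ann[OF assms(2)] by blast
  show "ann (usite x y, \<sigma>) (ann j \<Phi>) = (\<lambda>A. complex_of_real \<mu> * (ann (msite x, \<sigma>) (ann j \<Phi>) A + ann (msite y, \<sigma>) (ann j \<Phi>) A)) \<and>
     ann (ubsite x y, \<sigma>) (ann j \<Phi>) = (\<lambda>A. - complex_of_real \<mu> * (ann (msite x, \<sigma>) (ann j \<Phi>) A - ann (msite y, \<sigma>) (ann j \<Phi>) A))"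
    unfolding * ker_bD[OF assms(1) b] by (simp add: fun_eq_iff algebra_simps)
qed

text \<open>The signs in \<open>a_op\<close> are such that on every bond at \<open>x\<close> the
  contributions of the other end cancel and those of \<open>x\<close> double. Six bonds yield the
  factor 1 + 12 \<open>\<mu>\<close>^2, of which the normalisation takes the square root
  away.\<close>

lemma a_op_ker_b:
  assumes "ker_b \<mu> \<Phi>" "x \<in> Msites L"
  shows "a_op B \<mu> x \<sigma> \<Phi> = (\<lambda>A. complex_of_real (sqrt (1 + 12 * \<mu>\<^sup>2)) * ann (msite x, \<sigma>) \<Phi> A)"
proof
  fix A
  define c where "c = ann (msite x, \<sigma>) \<Phi> A"
  have 1: "(\<Sum>y\<in>{y. (x,y) \<in> B}. ann (usite x y, \<sigma>) \<Phi> A - ann (ubsite x y, \<sigma>) \<Phi> A)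
      = (\<Sum>y\<in>{y. (x,y) \<in> B}. 2 * complex_of_real \<mu> * c)"
    by (intro sum.cong refl) (simp add: ker_bD[OF assms(1)] c_def algebra_simps)
  have 2: "(\<Sum>y\<in>{y. (y,x) \<in> B}. ann (usite y x, \<sigma>) \<Phi> A + ann (ubsite y x, \<sigma>) \<Phi> A)
      = (\<Sum>y\<in>{y. (y,x) \<in> B}. 2 * complex_of_real \<mu> * c)"
    by (intro sum.cong refl) (simp add: ker_bD[OF assms(1)] c_def algebra_simps)
  have 3: "(\<Sum>y\<in>{y. (x,y) \<in> B}. 2 * complex_of_real \<mu> * c) + (\<Sum>y\<in>{y. (y,x) \<in> B}. 2 * complex_of_real \<mu> * c)
     = 6 * (2 * complex_of_real \<mu> * c)"
    unfolding sum_neighbours sum_nn_const[OF assms(2)] ..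
  have "a_op B \<mu> x \<sigma> \<Phi> A = complex_of_real (1 / sqrt (1 + 2 * 6 * \<mu>\<^sup>2)) * (c + complex_of_real \<mu> *
      ((\<Sum>y\<in>{y. (x,y) \<in> B}. 2 * complex_of_real \<mu> * c) + (\<Sum>y\<in>{y. (y,x) \<in> B}. 2 * complex_of_real \<mu> * c)))"
    unfolding a_op_def 1 2 c_def[symmetric] by (simp add: algebra_simps)
  also have "\<dots> = complex_of_real (1 / sqrt (1 + 12 * \<mu>\<^sup>2) * (1 + 12 * \<mu>\<^sup>2)) * c"
    unfolding 3 by (simp add: algebra_simps power2_eq_square)
  also have "1 / sqrt (1 + 12 * \<mu>\<^sup>2) * (1 + 12 * \<mu>\<^sup>2) = sqrt (1 + 12 * \<mu>\<^sup>2)"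
    by (simp add: real_div_sqrt)
  finally show "a_op B \<mu> x \<sigma> \<Phi> A = complex_of_real (sqrt (1 + 12 * \<mu>\<^sup>2)) * ann (msite x, \<sigma>) \<Phi> A"
    by (simp add: c_def)
qed

text \<open>Parallelogram law on each bond: the sum and the difference of the two ends have no mixed
  terms together. Every site is met by six bonds, each contributing 2
  \<open>\<mu>\<close>^2.\<close>

lemma ip_ker_b_step:
  assumes "ker_b \<mu> \<Phi>" "ker_b \<mu> \<Psi>"
  shows "(\<Sum>z\<in>Lambda L B. ip S (ann (z, \<sigma>) \<Phi>) (ann (z, \<sigma>) \<Psi>)) =
    complex_of_real (1 + 12 * \<mu>\<^sup>2) * (\<Sum>x\<in>Msites L. ip S (ann (msite x, \<sigma>) \<Phi>) (ann (msite x, \<sigma>) \<Psi>))"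
proof -
  have "(\<Sum>(x, y)\<in>B. ip S (ann (usite x y, \<sigma>) \<Phi>) (ann (usite x y, \<sigma>) \<Psi>) + ip S (ann (ubsite x y, \<sigma>) \<Phi>) (ann (ubsite x y, \<sigma>) \<Psi>))
    = (\<Sum>(x, y)\<in>B. 2 * complex_of_real (\<mu>\<^sup>2) * ip S (ann (msite x, \<sigma>) \<Phi>) (ann (msite x, \<sigma>) \<Psi>) +
       2 * complex_of_real (\<mu>\<^sup>2) * ip S (ann (msite y, \<sigma>) \<Phi>) (ann (msite y, \<sigma>) \<Psi>))"
    by (intro sum.cong refl) (auto simp: ker_bD[OF assms(1)] ker_bD[OF assms(2)] ip_lin algebra_simps power2_eq_square)
  also have "\<dots> = 12 * complex_of_real (\<mu>\<^sup>2) * (\<Sum>x\<in>Msites L. ip S (ann (msite x, \<sigma>) \<Phi>) (ann (msite x, \<sigma>) \<Psi>))"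
    unfolding sum_bonds_endpoints by (simp add: sum_distrib_left mult.assoc)
  finally show ?thesis unfolding sum_Lambda by (simp add: algebra_simps)
qed

lemma sum_modes:
  fixes F :: "'a \<times> bool \<Rightarrow> 'b :: comm_monoid_add"
  shows "(\<Sum>j\<in>S \<times> UNIV. F j) = (\<Sum>\<sigma>\<in>UNIV. \<Sum>z\<in>S. F (z, \<sigma>))"
  by (subst sum.swap) (simp add: sum.cartesian_product)

lemma inj_msite: "inj_on msite X"
  by (auto simp: inj_on_def msite_def)

text \<open>Induction on the number of electrons: count electrons on the decorated lattice,
  eliminate its decoration at the cost of one factor 1 + 12 \<open>\<mu>\<close>^2, apply the
  hypothesis to the states with one electron removed, and count backwards on M.\<close>

lemma ip_ker_b:
  assumes "nstate L B N \<Phi>" "nstate L B N \<Psi>" "ker_b \<mu> \<Phi>" "ker_b \<mu> \<Psi>"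
  shows "ip LM \<Phi> \<Psi> = complex_of_real ((1 + 12 * \<mu>\<^sup>2) ^ N) * ip MM \<Phi> \<Psi>"
  using assms
proof (induction N arbitrary: \<Phi> \<Psi>)
  case 0
  \<comment> \<open>Without electrons only the empty configuration contributes, whatever the set of
    modes.\<close>
  have "ip S \<Phi> \<Psi> = cnj (\<Phi> {}) * \<Psi> {}" if "finite S" "S \<subseteq> LM" for S
  proof -
    have "ip S \<Phi> \<Psi> = (\<Sum>A\<in>{{}}. cnj (\<Phi> A) * \<Psi> A)"
      unfolding ip_def
    proof (intro sum.mono_neutral_right ballI)
      fix A assume "A \<in> Pow S - {{}}"
      then have "card A \<noteq> 0" using that by (auto dest: finite_subset)
      then show "cnj (\<Phi> A) * \<Psi> A = 0" using 0 by (auto simp: nstate_def)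
    qed (use that in auto)
    then show ?thesis by simp
  qed
  moreover have "MM \<subseteq> LM" using Lambda_mem(1) by blast
  ultimately show ?case by simp
next
  case (Suc N)
  let ?K = "complex_of_real (1 + 12 * \<mu>\<^sup>2)"
  have fs: "fin_supp \<Phi>" "fin_supp \<Psi>" using Suc.prems nstate_fin_supp by auto
  have IH: "ip LM (ann j \<Phi>) (ann j \<Psi>) = ?K ^ N * ip MM (ann j \<Phi>) (ann j \<Psi>)" for j
    using Suc.IH[of "ann j \<Phi>" "ann j \<Psi>"] Suc.prems nstate_ann ker_b_ann fs by simp
  have c: "\<Phi> A \<noteq> 0 \<Longrightarrow> card A = Suc N" for A using Suc.prems by (auto simp: nstate_def)
  have "of_nat (Suc N) * ip LM \<Phi> \<Psi> = (\<Sum>\<sigma>\<in>UNIV. \<Sum>z\<in>Lambda L B. ip LM (ann (z, \<sigma>) \<Phi>) (ann (z, \<sigma>) \<Psi>))"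
    by (subst sum_ip_ann[symmetric, OF _ c]) (simp_all add: sum_modes del: UNIV_bool)
  also have "\<dots> = (\<Sum>\<sigma>\<in>UNIV. ?K * (\<Sum>x\<in>Msites L. ip LM (ann (msite x, \<sigma>) \<Phi>) (ann (msite x, \<sigma>) \<Psi>)))"
    using Suc.prems by (intro sum.cong refl ip_ker_b_step) auto
  also have "\<dots> = ?K ^ Suc N * (\<Sum>\<sigma>\<in>UNIV. \<Sum>x\<in>Msites L. ip MM (ann (msite x, \<sigma>) \<Phi>) (ann (msite x, \<sigma>) \<Psi>))"
    by (simp only: IH sum_distrib_left power_Suc mult.assoc)
  also have "\<dots> = ?K ^ Suc N * (\<Sum>j\<in>MM. ip MM (ann j \<Phi>) (ann j \<Psi>))"
    by (simp only: sum_modes sum.reindex[OF inj_msite] o_def)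
  also have "\<dots> = ?K ^ Suc N * (of_nat (Suc N) * ip MM \<Phi> \<Psi>)"
    by (subst sum_ip_ann[OF _ c]) simp_all
  finally have "of_nat (Suc N) * ip LM \<Phi> \<Psi> = of_nat (Suc N) * (?K ^ Suc N * ip MM \<Phi> \<Psi>)"
    by (simp only: mult.left_commute)
  then show ?case
    by (simp only: mult_cancel_left of_real_power of_nat_eq_0_iff) simp
qed

lemma hop_form_ker_b:
  assumes "ker_b \<mu> \<Phi>" "ker_b \<mu> \<Psi>"
  shows "hop_form \<mu> \<Phi> \<Psi> = complex_of_real (1 + 12 * \<mu>\<^sup>2) *
    (\<Sum>(x, y)\<in>B \<union> converse B. \<Sum>\<sigma>\<in>UNIV. ip LM (ann (msite x, \<sigma>) \<Phi>) (ann (msite y, \<sigma>) \<Psi>))"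
proof -
  have "complex_of_real (sqrt (1 + 12 * \<mu>\<^sup>2)) * complex_of_real (sqrt (1 + 12 * \<mu>\<^sup>2)) = complex_of_real (1 + 12 * \<mu>\<^sup>2)"
    by (simp flip: of_real_mult)
  then have *: "complex_of_real (sqrt (1 + 12 * \<mu>\<^sup>2)) * (cnj (complex_of_real (sqrt (1 + 12 * \<mu>\<^sup>2))) * w) = complex_of_real (1 + 12 * \<mu>\<^sup>2) * w" for w
    by (simp only: complex_cnj_complex_of_real mult.assoc[symmetric])
  have "hop_form \<mu> \<Phi> \<Psi> = (\<Sum>(x, y)\<in>B \<union> converse B. \<Sum>\<sigma>\<in>UNIV. complex_of_real (1 + 12 * \<mu>\<^sup>2) * ip LM (ann (msite x, \<sigma>) \<Phi>) (ann (msite y, \<sigma>) \<Psi>))"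
    unfolding hop_form_def
  proof (intro sum.cong refl, clarify)
    fix x1 x2 y1 y2 assume "((x1, x2), (y1, y2)) \<in> B \<union> converse B"
    then have "(x1, x2) \<in> Msites L" "(y1, y2) \<in> Msites L" using bond_M by blast+
    then show "(\<Sum>\<sigma>\<in>UNIV. ip LM (a_op B \<mu> (x1, x2) \<sigma> \<Phi>) (a_op B \<mu> (y1, y2) \<sigma> \<Psi>)) = (\<Sum>\<sigma>\<in>UNIV. complex_of_real (1 + 12 * \<mu>\<^sup>2) * ip LM (ann (msite (x1, x2), \<sigma>) \<Phi>) (ann (msite (y1, y2), \<sigma>) \<Psi>))"
      by (simp only: a_op_ker_b[OF assms(1)] a_op_ker_b[OF assms(2)] ip_lin *)
  qed
  then show ?thesis unfolding case_prod_beta by (simp only: sum_distrib_left)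
qed

definition hop_M :: "state \<Rightarrow> state \<Rightarrow> complex" where
  "hop_M \<Phi> \<Psi> = (\<Sum>(x, y)\<in>B \<union> converse B. \<Sum>\<sigma>\<in>UNIV. ip MM (ann (msite x, \<sigma>) \<Phi>) (ann (msite y, \<sigma>) \<Psi>))"

text \<open>The annihilated states have N - 1 electrons and account for the power N - 1; the two
  a-operators supply the last factor. The multiple equals that of \<open>ip_ker_b\<close>, so energy
  quotients can be computed on M.\<close>

lemma hop_form_eq_hop_M:
  assumes "nstate L B N \<Phi>" "nstate L B N \<Psi>" "ker_b \<mu> \<Phi>" "ker_b \<mu> \<Psi>" "N > 0"
  shows "hop_form \<mu> \<Phi> \<Psi> = complex_of_real ((1 + 12 * \<mu>\<^sup>2) ^ N) * hop_M \<Phi> \<Psi>"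
proof -
  obtain n where n: "N = Suc n" using \<open>N > 0\<close> by (cases N) auto
  have fs: "fin_supp \<Phi>" "fin_supp \<Psi>" using assms nstate_fin_supp by auto
  have *: "ip LM (ann j \<Phi>) (ann k \<Psi>) = complex_of_real ((1 + 12 * \<mu>\<^sup>2) ^ n) * ip MM (ann j \<Phi>) (ann k \<Psi>)" for j k
    using assms nstate_ann ker_b_ann fs n by (intro ip_ker_b) auto
  show ?thesis
    unfolding hop_form_ker_b[OF assms(3,4)] * hop_M_def n power_Suc
    by (simp only: sum_distrib_left case_prod_beta of_real_mult mult.assoc)
qed

section \<open>Total spin operators, given by a two-by-two spin matrix\<close>

definition spin_op :: "(bool \<Rightarrow> bool \<Rightarrow> complex) \<Rightarrow> state \<Rightarrow> state" where
  "spin_op m \<Phi> = (\<lambda>A. \<Sum>z\<in>Lambda L B. \<Sum>s\<in>UNIV. \<Sum>s'\<in>UNIV. m s s' * cre (z, s) (ann (z, s') \<Phi>) A)"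

lemma spin_op_lin:
  "spin_op m (\<lambda>A. f A + g A) = (\<lambda>A. spin_op m f A + spin_op m g A)"
  "spin_op m (\<lambda>A. f A - g A) = (\<lambda>A. spin_op m f A - spin_op m g A)"
  "spin_op m (\<lambda>A. c * f A) = (\<lambda>A. c * spin_op m f A)"
  "spin_op m (\<lambda>A. 0) = (\<lambda>A. 0)"
  by (simp_all add: spin_op_def fun_eq_iff algebra_simps sum.distrib sum_subtractf sum_distrib_left)

text \<open>The commutator mixes the two spins at one site, with the same coefficients
  \<open>m\<close> at every site. Linear relations between sites that hold for both spins, such as
  \<open>ker_b\<close>, therefore survive a spin operator.\<close>

lemma ann_spin_op:
  assumes "fin_supp \<Phi>" "z \<in> Lambda L B"
  shows "ann (z, s) (spin_op m \<Phi>) = (\<lambda>A. spin_op m (ann (z, s) \<Phi>) A + (\<Sum>s'\<in>UNIV. m s s' * ann (z, s') \<Phi> A))"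
proof
  fix A
  have *: "ann (z, s) (cre (w, r) (ann (w, r') \<Phi>)) A = cre (w, r) (ann (w, r') (ann (z, s) \<Phi>)) A +
     (if w = z then if r = s then ann (w, r') \<Phi> A else 0 else 0)" for w r r'
  proof -
    have "ann (z, s) (ann (w, r') \<Phi>) = (\<lambda>A. - ann (w, r') (ann (z, s) \<Phi>) A)"
      using ann_ann[OF assms(1)] by blast
    then show ?thesis using assms(1) by (simp add: ann_cre)
  qed
  have "ann (z, s) (spin_op m \<Phi>) A = (\<Sum>w\<in>Lambda L B. \<Sum>r\<in>UNIV. \<Sum>r'\<in>UNIV. m r r' * ann (z, s) (cre (w, r) (ann (w, r') \<Phi>)) A)"
    by (simp only: spin_op_def ann_lin)
  also have "\<dots> = spin_op m (ann (z, s) \<Phi>) A +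
      (\<Sum>w\<in>Lambda L B. \<Sum>r\<in>UNIV. \<Sum>r'\<in>UNIV. m r r' * (if w = z then if r = s then ann (w, r') \<Phi> A else 0 else 0))"
    by (simp only: * distrib_left sum.distrib spin_op_def)
  also have "(\<Sum>w\<in>Lambda L B. \<Sum>r\<in>UNIV. \<Sum>r'\<in>UNIV. m r r' * (if w = z then if r = s then ann (w, r') \<Phi> A else 0 else 0))
     = (\<Sum>w\<in>Lambda L B. if w = z then \<Sum>r'\<in>UNIV. m s r' * ann (w, r') \<Phi> A else 0)"
    by (intro sum.cong refl) (cases s; simp add: UNIV_bool)
  also have "\<dots> = (\<Sum>s'\<in>UNIV. m s s' * ann (z, s') \<Phi> A)" using assms(2) by simp
  finally show "ann (z, s) (spin_op m \<Phi>) A = spin_op m (ann (z, s) \<Phi>) A + (\<Sum>s'\<in>UNIV. m s s' * ann (z, s') \<Phi> A)" .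
qed

lemma nstate_spin_op:
  assumes "nstate L B N \<Phi>"
  shows "nstate L B N (spin_op m \<Phi>)"
proof (cases N)
  case 0
  then have "ann j \<Phi> = (\<lambda>_. 0)" for j
    using assms nstate_fin_supp[OF assms] by (auto simp: ann_def fun_eq_iff nstate_def fin_supp_def)
  then show ?thesis by (simp add: spin_op_def nstate_def)
next
  case (Suc n)
  show ?thesis unfolding spin_op_def
    using assms Suc by (intro nstate_lin) (auto intro!: nstate_cre nstate_ann)
qed

lemma ker_b_spin_op:
  assumes "ker_b \<mu> \<Phi>" "fin_supp \<Phi>"
  shows "ker_b \<mu> (spin_op m \<Phi>)"
  unfolding ker_b_def
proof (intro allI impI)
  fix x y \<sigma> assume b: "(x, y) \<in> B"
  note mem = Lambda_mem(1)[OF bond_M(1)[OF b]] Lambda_mem(1)[OF bond_M(2)[OF b]] Lambda_mem(2,3)[OF b]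
  show "ann (usite x y, \<sigma>) (spin_op m \<Phi>) = (\<lambda>A. complex_of_real \<mu> * (ann (msite x, \<sigma>) (spin_op m \<Phi>) A + ann (msite y, \<sigma>) (spin_op m \<Phi>) A)) \<and>
     ann (ubsite x y, \<sigma>) (spin_op m \<Phi>) = (\<lambda>A. - complex_of_real \<mu> * (ann (msite x, \<sigma>) (spin_op m \<Phi>) A - ann (msite y, \<sigma>) (spin_op m \<Phi>) A))"
    unfolding mem[THEN ann_spin_op[OF assms(2)]] ker_bD[OF assms(1) b] spin_op_lin
    by (auto simp: fun_eq_iff algebra_simps UNIV_bool)
qed

text \<open>Written with annihilators rather than coefficients so that \<open>ann_spin_op\<close>
  applies. That commutator turns one pair of spins into others, and the family of all pairs is
  closed under it.\<close>

definition no_double :: "state \<Rightarrow> bool" where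
  "no_double \<Phi> \<longleftrightarrow> (\<forall>z\<in>Lambda L B. \<forall>s s'. ann (z, s) (ann (z, s') \<Phi>) = (\<lambda>_. 0))"

lemma no_double_lin:
  "no_double f \<Longrightarrow> no_double g \<Longrightarrow> no_double (\<lambda>A. f A + g A)"
  "no_double f \<Longrightarrow> no_double g \<Longrightarrow> no_double (\<lambda>A. f A - g A)"
  "no_double f \<Longrightarrow> no_double (\<lambda>A. c * f A)"
  by (auto simp: no_double_def)

lemma no_doubleD:
  assumes "no_double \<Phi>" "z \<in> Lambda L B" "(z, s) \<in> A" "(z, \<not> s) \<in> A"
  shows "\<Phi> A = 0"
proof -
  have "ann (z, True) (ann (z, False) \<Phi>) (A - {(z, True), (z, False)}) = 0"
    using assms by (simp add: no_double_def)
  moreover have "insert (z, False) (insert (z, True) (A - {(z, True), (z, False)})) = A"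
    using assms(3,4) by (cases s) auto
  ultimately show ?thesis
    by (simp add: ann_def) (simp add: fsign_def)
qed

lemma no_doubleI:
  assumes "\<And>z A. z \<in> Lambda L B \<Longrightarrow> (z, True) \<in> A \<Longrightarrow> (z, False) \<in> A \<Longrightarrow> \<Phi> A = 0"
  shows "no_double \<Phi>"
proof -
  have "ann (z, s) (ann (z, s') \<Phi>) A = 0" if "z \<in> Lambda L B" for z s s' A
    using assms[OF that] by (cases s; cases s'; simp add: ann_def)
  then show ?thesis by (auto simp: no_double_def)
qed

lemma no_double_spin_op:
  assumes "no_double \<Phi>" "fin_supp \<Phi>"
  shows "no_double (spin_op m \<Phi>)"
  using assms unfolding no_double_def
  by (auto simp: ann_spin_op spin_op_lin)

lemma ip_spin_op:
  assumes "\<And>s s'. cnj (m s s') = m s' s"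
  shows "ip LM \<Phi> (spin_op m \<Psi>) = ip LM (spin_op m \<Phi>) \<Psi>"
proof -
  have "ip LM \<Phi> (spin_op m \<Psi>) = (\<Sum>z\<in>Lambda L B. \<Sum>s\<in>UNIV. \<Sum>s'\<in>UNIV. m s s' * ip LM (ann (z, s) \<Phi>) (ann (z, s') \<Psi>))"
    by (simp add: spin_op_def ip_sum ip_lin ip_cre)
  also have "\<dots> = (\<Sum>z\<in>Lambda L B. \<Sum>s'\<in>UNIV. \<Sum>s\<in>UNIV. m s s' * ip LM (ann (z, s) \<Phi>) (ann (z, s') \<Psi>))"
    by (intro sum.cong refl sum.swap)
  also have "\<dots> = ip LM (spin_op m \<Phi>) \<Psi>"
    by (simp add: spin_op_def ip_sum ip_lin ip_cre' assms)
  finally show ?thesis .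
qed

lemma edge_Lambda: "p \<in> B \<union> converse B \<Longrightarrow> msite (fst p) \<in> Lambda L B"
  "p \<in> B \<union> converse B \<Longrightarrow> msite (snd p) \<in> Lambda L B"
  using bond_M[of "fst p" "snd p"] bond_M[of "snd p" "fst p"]
  by (cases p, simp, blast intro: Lambda_mem)+

text \<open>Spin invariance of the hopping, as a statement about matrix elements. After commuting
  the spin operator past the annihilators, the extra terms on the two sides are the same double sum
  over spins because \<open>m\<close> is Hermitian.\<close>

lemma hop_form_spin_op:
  assumes "\<And>s s'. cnj (m s s') = m s' s"
    and "ker_b \<mu> \<Phi>" "ker_b \<mu> \<Psi>" "fin_supp \<Phi>" "fin_supp \<Psi>"
  shows "hop_form \<mu> \<Phi> (spin_op m \<Psi>) = hop_form \<mu> (spin_op m \<Phi>) \<Psi>"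
proof -
  have key: "(\<Sum>\<sigma>\<in>UNIV. ip LM (ann (x, \<sigma>) \<Phi>) (ann (y, \<sigma>) (spin_op m \<Psi>))) =
     (\<Sum>\<sigma>\<in>UNIV. ip LM (ann (x, \<sigma>) (spin_op m \<Phi>)) (ann (y, \<sigma>) \<Psi>))" if "x \<in> Lambda L B" "y \<in> Lambda L B" for x y
    unfolding that[THEN ann_spin_op[OF assms(4)]] that[THEN ann_spin_op[OF assms(5)]]
      ip_lin ip_sum ip_spin_op[OF assms(1)] assms(1)
    by (simp add: UNIV_bool)
  show ?thesis
    unfolding hop_form_ker_b[OF assms(2) ker_b_spin_op[OF assms(3,5)]] hop_form_ker_b[OF ker_b_spin_op[OF assms(2,4)] assms(3)]
    unfolding case_prod_beta
    by (rule arg_cong2[where f = "(*)"], rule refl, rule sum.cong, rule refl, rule key) (rule edge_Lambda, assumption)+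
qed

end

section \<open>Hole configurations that disconnect the lattice\<close>

lemma finite_subset_Msites: "A \<subseteq> Msites L \<Longrightarrow> finite A"
  by (rule finite_subset[OF _ finite_Msites])

text \<open>\<open>f\<close> is a lattice coordinate modulo \<open>L\<close> with increment
  \<open>\<phi>\<close>, and \<open>C\<close> together with the holes avoids the level
  \<open>r\<close>, so the coordinate counted from \<open>r\<close> stays in 1, ..., L - 1 and
  cannot wrap around. At a highest site of \<open>C\<close> the two upward neighbours lie outside
  \<open>C\<close>, hence are holes, and they differ by \<open>e2 - e1\<close>. A lowest site yields
  a second such pair.\<close>

lemma strip_extremes:
  fixes f :: "pt \<Rightarrow> int" and \<phi> :: "int \<times> int \<Rightarrow> int"
  assumes L: "L > 0"
    and f: "\<And>x e. x \<in> Msites L \<Longrightarrow> f (shift L x e) mod int L = (f x + \<phi> e) mod int L"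
    and \<phi>: "\<And>e. \<phi> (- e) = - \<phi> e"
    and C: "C \<subseteq> Msites L" "C \<noteq> {}"
    and avoid: "\<And>x. x \<in> C \<union> H \<Longrightarrow> (f x - r) mod int L \<noteq> 0"
    and nbr: "\<And>x d. x \<in> C \<Longrightarrow> d \<in> dirs \<Longrightarrow> shift L x d \<in> C \<union> H"
    and e: "e1 \<in> dirs" "e2 \<in> dirs" "\<phi> e1 = 1" "\<phi> e2 = 1"
    and H: "finite H"
  shows "2 \<le> card {y \<in> H. shift L y (e2 - e1) \<in> H}"
proof -
  define g where "g x = (f x - r) mod int L" for x
  have fin: "finite (g ` C)" using finite_subset_Msites[OF C(1)] by simp
  have "Max (g ` C) \<in> g ` C" "Min (g ` C) \<in> g ` C" using fin C(2) by (auto intro!: Max_in Min_in)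
  then obtain x x' where x: "x \<in> C" "g x = Max (g ` C)" and x': "x' \<in> C" "g x' = Min (g ` C)" by (metis imageE)
  have mx: "g z \<le> g x" if "z \<in> C" for z using that fin x(2) by auto
  have mn: "g x' \<le> g z" if "z \<in> C" for z using that fin x'(2) by auto
  have gs: "g (shift L z e) = (g z + \<phi> e) mod int L" if "z \<in> C" for z e
  proof -
    have "g (shift L z e) = (f (shift L z e) mod int L - r) mod int L" by (simp add: g_def mod_simps)
    also have "\<dots> = (f z + \<phi> e - r) mod int L" using f[OF subsetD[OF C(1) that], of e] by (metis mod_diff_left_eq)
    finally show ?thesis by (simp add: g_def mod_simps algebra_simps)
  qed
  have pos: "0 < g z" if "z \<in> C \<union> H" for z
    using avoid[OF that] L pos_mod_sign[of "int L" "f z - r"] unfolding g_def by linarith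
  have lt: "g z < int L" for z using L by (simp add: g_def)
  have up: "shift L x e \<in> H \<and> g (shift L x e) = g x + 1" if "e \<in> dirs" "\<phi> e = 1" for e
  proof -
    have m: "shift L x e \<in> C \<union> H" using nbr x that by auto
    have "g (shift L x e) = (g x + 1) mod int L" using gs[OF x(1), of e] that by simp
    \<comment> \<open>The value \<open>L\<close> would be level 0 modulo \<open>L\<close>, which the
      upper neighbour avoids.\<close>
    moreover have "g x + 1 \<noteq> int L" using pos[OF m] calculation by auto
    ultimately have "g (shift L x e) = g x + 1" using lt[of x] pos[of x] x(1) by auto
    then show ?thesis using m mx[of "shift L x e"] by auto
  qed
  have down: "shift L x' (- e) \<in> H \<and> g (shift L x' (- e)) = g x' - 1" if "e \<in> dirs" "\<phi> e = 1" for e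
  proof -
    have m: "shift L x' (- e) \<in> C \<union> H" using nbr[OF x'(1) dirs_uminus] that by auto
    have "g (shift L x' (- e)) = (g x' - 1) mod int L" using gs[OF x'(1), of "- e"] that \<phi>[of e] by simp
    then have "g (shift L x' (- e)) = g x' - 1" using lt[of x'] pos[of x'] x'(1) by simp
    then show ?thesis using m mn[of "shift L x' (- e)"] by auto
  qed
  \<comment> \<open>At the lowest site the roles are exchanged: the pair starts at x' - e2 and ends
    at x' - e1.\<close>
  have "shift L (shift L x e1) (e2 - e1) = shift L x e2"
    "shift L (shift L x' (- e2)) (e2 - e1) = shift L x' (- e1)" using L by (simp_all add: shift_shift)
  then have sub: "{shift L x e1, shift L x' (- e2)} \<subseteq> {y \<in> H. shift L y (e2 - e1) \<in> H}"
    using up[OF e(1,3)] up[OF e(2,4)] down[OF e(1,3)] down[OF e(2,4)] by auto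
  have "g x' \<le> g x" using mx[OF x'(1)] .
  \<comment> \<open>The first hole of the upper pair lies strictly above level \<open>g x\<close>,
    that of the lower pair strictly below level \<open>g x'\<close>.\<close>
  then have "shift L x e1 \<noteq> shift L x' (- e2)"
    using up[OF e(1,3)] down[OF e(2,4)] by auto
  then have "card {shift L x e1, shift L x' (- e2)} = 2" by simp
  then show ?thesis using card_mono[OF _ sub] H by simp
qed

lemma exists_avoiding_level:
  assumes "finite H" "card H < L" "\<And>x. x \<in> H \<Longrightarrow> lv x < (L :: nat)"
  obtains r where "r < L" "\<And>x. x \<in> H \<Longrightarrow> lv x \<noteq> r"
proof -
  have "card (lv ` H) < card {..<L}" using card_image_le[OF assms(1), of lv] assms(2) by simp
  then have "\<not> {..<L} \<subseteq> lv ` H" using card_mono[of "lv ` H" "{..<L}"] assms(1) by auto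
  then show ?thesis using that by auto
qed

text \<open>Fewer than L holes leave free a line in each of the three lattice directions; the three free
  lines lie in one class, so another class is caught in a strip in each direction, and its extreme
  sites produce adjacent pairs of holes.\<close>

lemma hole_pairs_if_disconnected:
  assumes L: "L \<ge> 3"
    and H: "H \<subseteq> Msites L" "card H < L"
    and sym: "\<And>x y. R x y \<Longrightarrow> R y x"
    and trans: "\<And>x y z. R x y \<Longrightarrow> R y z \<Longrightarrow> R x z"
    and refl: "\<And>x. x \<in> Msites L - H \<Longrightarrow> R x x"
    and nbr: "\<And>x y. x \<in> Msites L - H \<Longrightarrow> y \<in> Msites L - H \<Longrightarrow> nn L x y \<Longrightarrow> R x y"
    and pq: "p \<in> Msites L - H" "q \<in> Msites L - H" "\<not> R p q"
    and d: "d \<in> dirs"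
  shows "2 \<le> card {y \<in> H. shift L y d \<in> H}"
proof -
  have L0: "L > 0" using L by simp
  have fH: "finite H" using finite_subset_Msites[OF H(1)] .
  have bnd: "fst x < L" "snd x < L" if "x \<in> Msites L" for x using that by (auto simp: Msites_def)
  obtain r where r: "r < L" "\<And>x. x \<in> H \<Longrightarrow> snd x \<noteq> r"
    using exists_avoiding_level[OF fH H(2), of snd] bnd H(1) by blast
  obtain c where c: "c < L" "\<And>x. x \<in> H \<Longrightarrow> fst x \<noteq> c"
    using exists_avoiding_level[OF fH H(2), of fst] bnd H(1) by blast
  obtain a where a: "a < L" "\<And>x. x \<in> H \<Longrightarrow> (fst x + snd x) mod L \<noteq> a"
    using exists_avoiding_level[OF fH H(2), of "\<lambda>x. (fst x + snd x) mod L"] L0 by auto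
  \<comment> \<open>Consecutive sites of a straight line without holes are occupied neighbours, so
    the whole line lies in one class.\<close>
  have line: "R x (shift L x (int k * d1, int k * d2))"
    if x: "x \<in> Msites L" and dd: "(d1, d2) \<in> dirs" and free: "\<And>k. shift L x (int k * d1, int k * d2) \<notin> H" for x k d1 d2
  proof (induction k)
    case 0
    then show ?case using free[of 0] x by (auto simp: shift_0 intro!: refl)
  next
    case (Suc k)
    have "shift L x (int (Suc k) * d1, int (Suc k) * d2) = shift L (shift L x (int k * d1, int k * d2)) (d1, d2)"
      using L0 by (simp add: shift_shift algebra_simps)
    then have "nn L (shift L x (int k * d1, int k * d2)) (shift L x (int (Suc k) * d1, int (Suc k) * d2))"
      using dd shift_in_Msites[OF L0] by (auto simp only: nn_iff)
    then have "R (shift L x (int k * d1, int k * d2)) (shift L x (int (Suc k) * d1, int (Suc k) * d2))"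
      using free[of k] free[of "Suc k"] shift_in_Msites[OF L0] by (intro nbr) auto
    then show ?case using Suc trans by blast
  qed
  \<comment> \<open>The crossing of the free column and the free row; all three free lines will be
    tied to its class.\<close>
  define o' where "o' = (c, r)"
  have row: "R o' x" if "x \<in> Msites L" "snd x = r" for x
  proof -
    define k where "k = nat ((int (fst x) - int c) mod int L)"
    have k: "int k = (int (fst x) - int c) mod int L" using L0 by (simp add: k_def)
    have "R o' (shift L o' (int k * 1, int k * 0))"
    proof (rule line)
      show "shift L o' (int k * 1, int k * 0) \<notin> H" for k
        using r L0 by (auto simp: o'_def shift_def dest!: r(2))
    qed (use c r in \<open>auto simp: o'_def Msites_def dirs_def\<close>)
    also have "shift L o' (int k * 1, int k * 0) = x"
      using that bnd[OF that(1)] L0 by (auto simp: o'_def shift_def k mod_simps prod_eq_iff)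
    finally show ?thesis .
  qed
  have col: "R o' x" if "x \<in> Msites L" "fst x = c" for x
  proof -
    define k where "k = nat ((int (snd x) - int r) mod int L)"
    have k: "int k = (int (snd x) - int r) mod int L" using L0 by (simp add: k_def)
    have "R o' (shift L o' (int k * 0, int k * 1))"
    proof (rule line)
      show "shift L o' (int k * 0, int k * 1) \<notin> H" for k
        using c L0 by (auto simp: o'_def shift_def dest!: c(2))
    qed (use c r in \<open>auto simp: o'_def Msites_def dirs_def\<close>)
    also have "shift L o' (int k * 0, int k * 1) = x"
      using that bnd[OF that(1)] L0 by (auto simp: o'_def shift_def k mod_simps prod_eq_iff)
    finally show ?thesis .
  qed
  have diag: "R o' x" if x: "x \<in> Msites L" "(fst x + snd x) mod L = a" for x
  proof -
    \<comment> \<open>Walking in direction (-1, 1) stays on the free diagonal, and after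
      \<open>k\<close> steps the second coordinate is \<open>r\<close>, so the walk ends on the free
      row.\<close>
    define k where "k = nat ((int r - int (snd x)) mod int L)"
    have k: "int k = (int r - int (snd x)) mod int L" using L0 by (simp add: k_def)
    let ?y = "shift L x (int k * - 1, int k * 1)"
    have "R x ?y"
    proof (rule line[OF x(1)])
      fix k :: nat
      have "int ((fst (shift L x (int k * - 1, int k * 1)) + snd (shift L x (int k * - 1, int k * 1))) mod L) = int ((fst x + snd x) mod L)"
        using L0 by (simp add: zmod_int int_shift mod_simps)
      then show "shift L x (int k * - 1, int k * 1) \<notin> H" using a(2) x(2) by (metis of_nat_eq_iff)
    qed (simp add: dirs_def)
    moreover have "R o' ?y"
      using L0 r bnd[OF x(1)] by (intro row) (auto simp: shift_in_Msites simp del: of_nat_eq_iff simp flip: of_nat_eq_iff[where 'a = int] simp: int_shift k mod_simps)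
    ultimately show ?thesis using sym trans by blast
  qed
  \<comment> \<open>\<open>p\<close> and \<open>q\<close> cannot both be related to the crossing,
    since they would then be related to each other.\<close>
  obtain p' where p': "p' \<in> Msites L - H" "\<not> R o' p'"
    using pq(1,2) pq(3) sym[of o' p] trans[of p o' q] by blast
  define C where "C = {z \<in> Msites L - H. R p' z}"
  have "p' \<in> C" using p'(1) refl[OF p'(1)] by (simp add: C_def)
  then have C: "C \<subseteq> Msites L" "C \<noteq> {}" unfolding C_def by blast+
  have nR: "\<not> R o' z" if "z \<in> C" for z
  proof
    assume "R o' z"
    moreover have "R z p'" using that sym by (simp add: C_def)
    ultimately show False using p'(2) trans by blast
  qed
  have nb: "shift L x e \<in> C \<union> H" if "x \<in> C" "e \<in> dirs" for x e
  proof (rule ccontr)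
    assume n: "shift L x e \<notin> C \<union> H"
    have "nn L x (shift L x e)" using that C unfolding nn_iff by blast
    then have "R x (shift L x e)" using that n shift_in_Msites[OF L0] by (intro nbr) (auto simp: C_def)
    moreover have "R p' x" using that by (simp add: C_def)
    ultimately have "R p' (shift L x e)" using trans by blast
    then show False using n shift_in_Msites[OF L0] by (auto simp: C_def)
  qed
  \<comment> \<open>The holes avoid the free lines by choice, and the class \<open>C\<close> avoids
    them because their sites belong to the class of the crossing.\<close>
  have CH: "x \<in> Msites L \<and> snd x \<noteq> r \<and> fst x \<noteq> c \<and> (fst x + snd x) mod L \<noteq> a" if "x \<in> C \<union> H" for x
    using that C H r c a nR row col diag by blast
  have av: "(int m - int n) mod int L \<noteq> 0" if "m < L" "n < L" "m \<noteq> n" for m n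
    using that by (metis mod_eq_dvd_iff mod_eq_0_iff_dvd of_nat_eq_iff of_nat_mod mod_less)
  have avr: "(int (snd x) - int r) mod int L \<noteq> 0" if "x \<in> C \<union> H" for x
    using CH[OF that] bnd r by (intro av) blast+
  have avc: "(int (fst x) - int c) mod int L \<noteq> 0" if "x \<in> C \<union> H" for x
    using CH[OF that] bnd c by (intro av) blast+
  have avd: "(int (fst x) + int (snd x) - int a) mod int L \<noteq> 0" if "x \<in> C \<union> H" for x
  proof -
    have "(int ((fst x + snd x) mod L) - int a) mod int L \<noteq> 0"
      using CH[OF that] a(1) L0 by (intro av) simp_all
    then show ?thesis by (simp add: zmod_int mod_simps)
  qed
  have R: "2 \<le> card {y \<in> H. shift L y (e2 - e1) \<in> H}" if "e1 \<in> dirs" "e2 \<in> dirs" "snd e1 = 1" "snd e2 = 1" for e1 e2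
    by (rule strip_extremes[where f = "\<lambda>x. int (snd x)" and \<phi> = "snd" and r = "int r", OF L0 _ _ C avr nb])
       (use that L0 fH in \<open>simp_all add: int_shift mod_simps algebra_simps\<close>)
  have Cc: "2 \<le> card {y \<in> H. shift L y (e2 - e1) \<in> H}" if "e1 \<in> dirs" "e2 \<in> dirs" "fst e1 = 1" "fst e2 = 1" for e1 e2
    by (rule strip_extremes[where f = "\<lambda>x. int (fst x)" and \<phi> = "fst" and r = "int c", OF L0 _ _ C avc nb])
       (use that L0 fH in \<open>simp_all add: int_shift mod_simps algebra_simps\<close>)
  have fd: "(int (fst (shift L x e)) + int (snd (shift L x e))) mod int L =
      (int (fst x) + int (snd x) + (fst e + snd e)) mod int L" for x e
    by (simp only: int_shift[OF L0] mod_add_eq) (simp only: add_ac)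
  have D: "2 \<le> card {y \<in> H. shift L y (e2 - e1) \<in> H}" if "e1 \<in> dirs" "e2 \<in> dirs" "fst e1 + snd e1 = 1" "fst e2 + snd e2 = 1" for e1 e2
    by (rule strip_extremes[where f = "\<lambda>x. int (fst x) + int (snd x)" and \<phi> = "\<lambda>e. fst e + snd e" and r = "int a", OF L0 fd _ C avd nb])
       (use that L0 fH in \<open>simp_all\<close>)
  \<comment> \<open>Each of the six directions is a difference of two directions that raise the same
    coordinate by 1, for instance (1,0) = (0,1) - (-1,1) for the second coordinate; the row, column
    and diagonal cases cover two opposite directions each.\<close>
  from d show ?thesis
    using R[of "(-1,1)" "(0,1)"] R[of "(0,1)" "(-1,1)"] Cc[of "(1,0)" "(1,-1)"] Cc[of "(1,-1)" "(1,0)"]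
      D[of "(1,0)" "(0,1)"] D[of "(0,1)" "(1,0)"]
    by (auto simp: dirs_def)
qed

section \<open>Spin symmetry on connected configurations\<close>

definition swap_sites :: "site \<Rightarrow> site \<Rightarrow> mode set \<Rightarrow> mode set" where
  "swap_sites z w A = {m. (Transposition.transpose z w (fst m), snd m) \<in> A}"

definition flip :: "site \<Rightarrow> bool \<Rightarrow> mode set \<Rightarrow> mode set" where
  "flip z s A = insert (z, \<not> s) (A - {(z, s)})"

lemma fsign_spin:
  assumes "\<And>r. (z, r) \<notin> C"
  shows "fsign (z, s) C = fsign (z, s') C"
proof -
  have "mode_less i (z, s) \<longleftrightarrow> mode_less i (z, s')" if "i \<in> C" for i
    using that assms mode_less_spin[of "fst i" z "snd i"] by (metis prod.collapse)
  then show ?thesis unfolding fsign_def by (intro arg_cong[where f = "\<lambda>S. (-1) ^ card S"]) auto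
qed

lemma swap_sites_id [simp]: "swap_sites z z A = A"
  by (auto simp: swap_sites_def)

lemma swap_sites_commute: "swap_sites z w A = swap_sites w z A"
  by (simp add: swap_sites_def transpose_commute)

lemma swap_sites_same_spin:
  assumes "(z, s) \<in> A" "(w, s) \<in> A" "(z, \<not> s) \<notin> A" "(w, \<not> s) \<notin> A"
  shows "swap_sites z w A = A"
proof -
  have "(Transposition.transpose z w p, r) \<in> A \<longleftrightarrow> (p, r) \<in> A" for p r
    using assms by (cases "r = s") (auto simp: Transposition.transpose_def)
  then show ?thesis by (auto simp: swap_sites_def)
qed

lemma swap_sites_opposite:
  assumes "(z, s) \<in> A" "(w, \<not> s) \<in> A" "(z, \<not> s) \<notin> A" "(w, s) \<notin> A" "z \<noteq> w"
  shows "swap_sites z w A = insert (w, s) (insert (z, \<not> s) (A - {(z, s), (w, \<not> s)}))"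
proof -
  have "(Transposition.transpose z w p, r) \<in> A \<longleftrightarrow> (p, r) \<in> insert (w, s) (insert (z, \<not> s) (A - {(z, s), (w, \<not> s)}))" for p r
    using assms by (cases "r = s"; cases "p = z"; cases "p = w") auto
  then show ?thesis by (auto simp: swap_sites_def)
qed

section \<open>Spin flips, total spin and exchange symmetry without double occupancy\<close>

context bonds
begin

definition single :: "mode set \<Rightarrow> bool" where
  "single A \<longleftrightarrow> A \<subseteq> MM \<and> (\<forall>z s. (z, s) \<in> A \<longrightarrow> (z, \<not> s) \<notin> A)"

lemma singleD: "single A \<Longrightarrow> (z, s) \<in> A \<Longrightarrow> (z, \<not> s) \<notin> A"
  unfolding single_def by blast

lemma MM_subset: "MM \<subseteq> LM"
  using Lambda_mem(1) by blast

lemma finite_MM [simp]: "finite MM"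
  by simp

lemma single_finite: "single A \<Longrightarrow> finite A"
  unfolding single_def using finite_subset finite_MM by blast

lemma single_Lambda: "single A \<Longrightarrow> (z, s) \<in> A \<Longrightarrow> z \<in> Lambda L B"
  unfolding single_def using MM_subset by blast

text \<open>Removal and insertion happen at the same site, so by \<open>fsign_spin\<close> the two
  fermion signs cancel and a spin flip just relabels the configuration.\<close>

lemma flip_apply:
  assumes "single A" "(z, s) \<in> A"
  shows "cre (z, s) (ann (z, \<not> s) \<Phi>) A = \<Phi> (flip z s A)"
proof -
  have n: "(z, r) \<notin> A - {(z, s)}" for r
    using singleD[OF assms] by (cases "r = s") auto
  have "fsign (z, s) A = fsign (z, s) (A - {(z, s)})" by simp
  also have "\<dots> = fsign (z, \<not> s) (A - {(z, s)})" by (rule fsign_spin[OF n])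
  finally show ?thesis using assms n[of "\<not> s"] by (simp add: cre_def ann_def flip_def)
qed

lemma single_flip:
  assumes "single A" "(z, s) \<in> A"
  shows "single (flip z s A)"
  using assms unfolding single_def flip_def by fast

text \<open>The total raising operator for \<open>True\<close> and the total lowering operator for
  \<open>False\<close>.\<close>

definition spin_flip :: "bool \<Rightarrow> state \<Rightarrow> state" where
  "spin_flip s \<Phi> = (\<lambda>A. \<Sum>z\<in>Lambda L B. cre (z, s) (ann (z, \<not> s) \<Phi>) A)"

definition sites_of :: "bool \<Rightarrow> mode set \<Rightarrow> site set" where
  "sites_of s A = {z. (z, s) \<in> A}"

lemma finite_sites_of: "finite A \<Longrightarrow> finite (sites_of s A)"
  using finite_surj[of A "sites_of s A" fst] by (force simp: sites_of_def)

lemma card_sites_of: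
  assumes "finite A"
  shows "card (sites_of True A) + card (sites_of False A) = card A"
proof -
  have *: "card (sites_of s A) = card {m \<in> A. snd m = s}" for s
    by (rule bij_betw_same_card[where f = "\<lambda>z. (z, s)"]) (auto simp: bij_betw_def inj_on_def sites_of_def)
  have "A = {m \<in> A. snd m = True} \<union> {m \<in> A. snd m = False}" by auto
  then have "card A = card ({m \<in> A. snd m = True} \<union> {m \<in> A. snd m = False})" by simp
  also have "\<dots> = card {m \<in> A. snd m = True} + card {m \<in> A. snd m = False}"
    using assms by (intro card_Un_disjoint) auto
  finally show ?thesis by (simp add: *)
qed

lemma spin_flip_apply:
  assumes "single A"
  shows "spin_flip s \<Phi> A = (\<Sum>z\<in>sites_of s A. \<Phi> (flip z s A))"
proof -
  have "spin_flip s \<Phi> A = (\<Sum>z\<in>sites_of s A. cre (z, s) (ann (z, \<not> s) \<Phi>) A)"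
    unfolding spin_flip_def using single_Lambda[OF assms]
    by (intro sum.mono_neutral_right) (auto simp: sites_of_def cre_def)
  also have "\<dots> = (\<Sum>z\<in>sites_of s A. \<Phi> (flip z s A))"
    using flip_apply[OF assms] by (intro sum.cong refl) (simp add: sites_of_def)
  finally show ?thesis .
qed

text \<open>After the spin at \<open>z\<close> has been flipped, the second flip either restores
  \<open>A\<close> at \<open>z\<close> itself or acts at some \<open>w\<close> of opposite spin,
  which amounts to exchanging the contents of \<open>z\<close> and \<open>w\<close>. By symmetry all
  these coefficients equal that of \<open>A\<close>, so only the number of choices remains.\<close>

lemma spin_flip_spin_flip:
  assumes A: "single A"
    and sym: "\<And>z w. z \<in> fst ` A \<Longrightarrow> w \<in> fst ` A \<Longrightarrow> \<Phi> (swap_sites z w A) = \<Phi> A"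
  shows "spin_flip s (spin_flip (\<not> s) \<Phi>) A = of_nat (card (sites_of s A) * (1 + card (sites_of (\<not> s) A))) * \<Phi> A"
proof -
  have "spin_flip (\<not> s) \<Phi> (flip z s A) = of_nat (1 + card (sites_of (\<not> s) A)) * \<Phi> A" if z: "z \<in> sites_of s A" for z
  proof -
    have zA: "(z, s) \<in> A" using z by (simp add: sites_of_def)
    have nz: "z \<notin> sites_of (\<not> s) A" using singleD[OF A zA] by (simp add: sites_of_def)
    have "sites_of (\<not> s) (flip z s A) = insert z (sites_of (\<not> s) A)"
      by (auto simp: sites_of_def flip_def)
    then have "spin_flip (\<not> s) \<Phi> (flip z s A) =
        (\<Sum>w\<in>insert z (sites_of (\<not> s) A). \<Phi> (flip w (\<not> s) (flip z s A)))"
      using spin_flip_apply[OF single_flip[OF A zA], of "\<not> s"] by simp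
    also have "\<dots> = (\<Sum>w\<in>insert z (sites_of (\<not> s) A). \<Phi> A)"
    proof (intro sum.cong refl)
      fix w assume w: "w \<in> insert z (sites_of (\<not> s) A)"
      show "\<Phi> (flip w (\<not> s) (flip z s A)) = \<Phi> A"
      proof (cases "w = z")
        case True
        then have "flip w (\<not> s) (flip z s A) = A"
          using singleD[OF A zA] zA by (auto simp: flip_def)
        then show ?thesis by simp
      next
        case False
        then have wA: "(w, \<not> s) \<in> A" using w by (simp add: sites_of_def)
        have "(z, \<not> s) \<notin> A" "(w, s) \<notin> A" using singleD[OF A zA] singleD[OF A wA] by simp_all
        then have "flip w (\<not> s) (flip z s A) = swap_sites z w A"
          using False zA wA by (subst swap_sites_opposite[of z s]) (auto simp: flip_def)
        then show ?thesis using sym[of z w] zA wA by force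
      qed
    qed
    also have "\<dots> = of_nat (1 + card (sites_of (\<not> s) A)) * \<Phi> A"
      using nz finite_sites_of[OF single_finite[OF A]] by simp
    finally show ?thesis .
  qed
  then show ?thesis
    unfolding spin_flip_apply[OF A, of s] by (simp add: algebra_simps)
qed

lemma Stot3_apply:
  assumes "A \<subseteq> LM"
  shows "Stot3 L B \<Phi> A = (of_nat (card (sites_of True A)) - of_nat (card (sites_of False A))) / 2 * \<Phi> A"
proof -
  have *: "(\<Sum>z\<in>Lambda L B. numop (z, s) \<Phi> A) = of_nat (card (sites_of s A)) * \<Phi> A" for s
  proof -
    have "Lambda L B \<inter> {z. (z, s) \<in> A} = sites_of s A" using assms by (auto simp: sites_of_def)
    then show ?thesis by (simp add: numop_apply sum.If_cases)
  qed
  show ?thesis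
    by (simp add: Stot3_def sum_divide_distrib[symmetric] sum_subtractf * algebra_simps)
qed

lemma Stot1_spin_flip: "Stot1 L B \<Phi> = (\<lambda>A. (spin_flip True \<Phi> A + spin_flip False \<Phi> A) / 2)"
  and Stot2_spin_flip: "Stot2 L B \<Phi> = (\<lambda>A. (spin_flip True \<Phi> A - spin_flip False \<Phi> A) / (2 * \<i>))"
  unfolding Stot1_def Stot2_def spin_flip_def Splus_def Sminus_def sum_divide_distrib[symmetric]
      sum.distrib sum_subtractf by simp_all

lemma spin_flip_lin:
  "spin_flip s (\<lambda>A. f A + g A) = (\<lambda>A. spin_flip s f A + spin_flip s g A)"
  "spin_flip s (\<lambda>A. f A - g A) = (\<lambda>A. spin_flip s f A - spin_flip s g A)"
  "spin_flip s (\<lambda>A. f A / c) = (\<lambda>A. spin_flip s f A / c)"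
  by (simp_all add: spin_flip_def sum.distrib sum_subtractf sum_divide_distrib[symmetric])

lemma Stot_sq_spin_flip:
  "Stot_sq L B \<Phi> A = (spin_flip True (spin_flip False \<Phi>) A + spin_flip False (spin_flip True \<Phi>) A) / 2
     + Stot3 L B (Stot3 L B \<Phi>) A"
  by (simp add: Stot_sq_def Stot1_spin_flip Stot2_spin_flip spin_flip_lin field_simps)

text \<open>With u up and d down electrons, (u (1 + d) + d (1 + u)) / 2 + (u - d)^2 / 4 depends on u
  + d alone. The evaluation is local: only the exchanges within the configuration \<open>A\<close>
  have to leave the coefficient invariant.\<close>

lemma Stot_sq_if_symmetric:
  assumes A: "single A"
    and sym: "\<And>z w. z \<in> fst ` A \<Longrightarrow> w \<in> fst ` A \<Longrightarrow> \<Phi> (swap_sites z w A) = \<Phi> A"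
  shows "Stot_sq L B \<Phi> A = of_real (real (card A) / 2 * (real (card A) / 2 + 1)) * \<Phi> A"
proof -
  have LM: "A \<subseteq> LM" using A MM_subset by (auto simp only: single_def)
  define u where "u = complex_of_nat (card (sites_of True A))"
  define d where "d = complex_of_nat (card (sites_of False A))"
  have 1: "spin_flip True (spin_flip False \<Phi>) A = u * (1 + d) * \<Phi> A"
    using spin_flip_spin_flip[OF A sym, of True] by (simp add: u_def d_def distrib_left)
  have 2: "spin_flip False (spin_flip True \<Phi>) A = d * (1 + u) * \<Phi> A"
    using spin_flip_spin_flip[OF A sym, of False] by (simp add: u_def d_def distrib_left)
  have 3: "Stot3 L B (Stot3 L B \<Phi>) A = (u - d) / 2 * ((u - d) / 2 * \<Phi> A)"
    by (simp add: Stot3_apply[OF LM] u_def d_def)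
  have "complex_of_nat (card A) = u + d"
    using card_sites_of[OF single_finite[OF A]] by (simp add: u_def d_def flip: of_nat_add)
  then show ?thesis
    unfolding Stot_sq_spin_flip 1 2 3 by (simp add: field_simps)
qed

lemma ann_ann_bond:
  assumes b: "(x, y) \<in> B" and \<Phi>: "ker_b \<mu> \<Phi>" "fin_supp \<Phi>" "no_double \<Phi>" and "\<mu> \<noteq> 0"
  shows "ann (msite x, s) (ann (msite y, s') \<Phi>) C + ann (msite y, s) (ann (msite x, s') \<Phi>) C = 0"
proof -
  have z: "ann (w, s) (ann (w, s') \<Phi>) C = 0" if "w \<in> Lambda L B" for w
    using \<Phi>(3) that by (simp add: no_double_def)
  note k = ker_bD(1)[OF ker_b_ann[OF \<Phi>(1,2)] b]
  \<comment> \<open>Double annihilation at u vanishes, and on the kernel each annihilator at u is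
    \<open>\<mu>\<close> times the sum over the two ends. Of the four products the two with equal
    sites vanish as well, which leaves the mixed ones.\<close>
  have "0 = ann (usite x y, s) (ann (usite x y, s') \<Phi>) C" using z Lambda_mem(2)[OF b] by simp
  also have "\<dots> = complex_of_real \<mu> * (complex_of_real \<mu> *
     (ann (msite x, s) (ann (msite x, s') \<Phi>) C + ann (msite y, s) (ann (msite x, s') \<Phi>) C +
      ann (msite x, s) (ann (msite y, s') \<Phi>) C + ann (msite y, s) (ann (msite y, s') \<Phi>) C))"
    unfolding ker_bD(1)[OF \<Phi>(1) b] by (simp add: k algebra_simps)
  finally have "complex_of_real \<mu> * (complex_of_real \<mu> *
     (ann (msite x, s) (ann (msite x, s') \<Phi>) C + ann (msite y, s) (ann (msite x, s') \<Phi>) C +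
      ann (msite x, s) (ann (msite y, s') \<Phi>) C + ann (msite y, s) (ann (msite y, s') \<Phi>) C)) = 0"
    by (rule sym)
  then have "ann (msite x, s) (ann (msite x, s') \<Phi>) C + ann (msite y, s) (ann (msite x, s') \<Phi>) C +
      ann (msite x, s) (ann (msite y, s') \<Phi>) C + ann (msite y, s) (ann (msite y, s') \<Phi>) C = 0"
    unfolding mult_eq_0_iff of_real_eq_0_iff using \<open>\<mu> \<noteq> 0\<close> by blast
  then show ?thesis using z Lambda_mem(1)[OF bond_M(1)[OF b]] Lambda_mem(1)[OF bond_M(2)[OF b]]
    by (simp add: add.commute)
qed

lemma ann_ann_nn:
  assumes "nn L x y" and \<Phi>: "ker_b \<mu> \<Phi>" "fin_supp \<Phi>" "no_double \<Phi>" "\<mu> \<noteq> 0"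
  shows "ann (msite x, s) (ann (msite y, s') \<Phi>) C + ann (msite y, s) (ann (msite x, s') \<Phi>) C = 0"
proof (cases "(x, y) \<in> B")
  case True
  then show ?thesis using ann_ann_bond[OF _ \<Phi>] by blast
next
  case False
  then have "(y, x) \<in> B" using bond_orient[OF assms(1)] by simp
  then show ?thesis using ann_ann_bond[OF _ \<Phi>, of y x s s' C] by (simp add: add.commute)
qed

text \<open>Equal spins make the exchange trivial. For opposite spins \<open>ann_ann_nn\<close>
  relates the two coefficients up to signs, and the signs turn its sum into a difference.\<close>

lemma swap_nn:
  assumes nn: "nn L x y" and \<Phi>: "ker_b \<mu> \<Phi>" "fin_supp \<Phi>" "no_double \<Phi>" "\<mu> \<noteq> 0"
    and A: "single A" "msite x \<in> fst ` A" "msite y \<in> fst ` A"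
  shows "\<Phi> (swap_sites (msite x) (msite y) A) = \<Phi> A"
proof -
  define z w where "z = msite x" "w = msite y"
  have zw: "z \<noteq> w" using nn_irrefl[OF L3, of x] nn by (auto simp: z_w_def msite_def)
  obtain s r where s: "(z, s) \<in> A" "(w, r) \<in> A" using A by (auto simp: z_w_def)
  have n: "(z, \<not> s) \<notin> A" "(w, \<not> r) \<notin> A" using s singleD[OF A(1)] by auto
  show ?thesis
  proof (cases "r = s")
    case True
    then show ?thesis using swap_sites_same_spin[of z s A w] s n by (simp add: z_w_def)
  next
    case False
    then have r: "r = (\<not> s)" by auto
    define C where "C = A - {(z, s), (w, \<not> s)}"
    have C: "(z, t) \<notin> C" "(w, t) \<notin> C" for t using s n r by (cases "t = s"; auto simp: C_def)+
    have fC: "finite C" using single_finite[OF A(1)] by (simp add: C_def)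
    have AC: "A = insert (z, s) (insert (w, \<not> s) C)" using s r by (auto simp: C_def)
    have sw: "swap_sites z w A = insert (w, s) (insert (z, \<not> s) C)"
      unfolding C_def using s n r zw by (intro swap_sites_opposite) auto
    \<comment> \<open>The two terms insert the sites in opposite orders, and exactly one of the two
      orders carries a fermion sign; hence the relative minus.\<close>
    have l1: "mode_less (z, s) (w, \<not> s) \<longleftrightarrow> mode_less (z, True) (w, True)"
      "mode_less (w, s) (z, \<not> s) \<longleftrightarrow> \<not> mode_less (z, True) (w, True)"
      using mode_less_spin[OF zw] mode_less_spin[OF zw[symmetric]] mode_less_iff_not[of "(z, True)" "(w, True)"] zw by auto
    have "ann (z, s) (ann (w, \<not> s) \<Phi>) C + ann (w, s) (ann (z, \<not> s) \<Phi>) C = 0"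
      unfolding z_w_def by (rule ann_ann_nn[OF nn \<Phi>])
    then have "fsign (z, s) C * (fsign (w, \<not> s) (insert (z, s) C) * \<Phi> A) +
      fsign (w, s) C * (fsign (z, \<not> s) (insert (w, s) C) * \<Phi> (swap_sites z w A)) = 0"
      using C zw unfolding AC sw[unfolded AC] by (simp add: ann_def insert_commute)
    moreover have "fsign (z, \<not> s) C = fsign (z, s) C" "fsign (w, \<not> s) C = fsign (w, s) C"
      using fsign_spin C by auto
    ultimately have "fsign (z, s) C * (fsign (w, s) C * (\<Phi> A - \<Phi> (swap_sites z w A))) = 0"
      using C fC by (auto simp: fsign_insert l1 algebra_simps split: if_splits)
    moreover have "fsign i C \<noteq> 0" for i by (simp add: fsign_def)
    ultimately show ?thesis by (simp add: z_w_def)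
  qed
qed

lemma single_sites: "single A \<Longrightarrow> fst ` A \<subseteq> msite ` Msites L"
  unfolding single_def by fastforce

lemma single_swap:
  assumes "single A" "z \<in> fst ` A" "w \<in> fst ` A"
  shows "single (swap_sites z w A)" "fst ` swap_sites z w A = fst ` A"
proof -
  let ?t = "Transposition.transpose z w"
  have mem: "(p, s) \<in> swap_sites z w A \<longleftrightarrow> (?t p, s) \<in> A" for p s by (simp add: swap_sites_def)
  have im: "?t p \<in> fst ` A \<longleftrightarrow> p \<in> fst ` A" for p
    using assms(2,3) by (auto simp: Transposition.transpose_def)
  have dom: "p \<in> fst ` E \<longleftrightarrow> (\<exists>s. (p, s) \<in> E)" for p :: site and E :: "mode set" by force
  have "p \<in> fst ` swap_sites z w A \<longleftrightarrow> p \<in> fst ` A" for p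
    using im[of p] by (simp only: dom mem)
  then show *: "fst ` swap_sites z w A = fst ` A" by (rule set_eqI)
  have "fst ` swap_sites z w A \<subseteq> msite ` Msites L" unfolding * by (rule single_sites[OF assms(1)])
  then have "swap_sites z w A \<subseteq> MM" by (auto simp del: split_paired_All)
  then show "single (swap_sites z w A)"
    using assms(1) mem unfolding single_def by blast
qed

text \<open>The pairs of sites whose exchange leaves \<open>\<Phi>\<close> invariant form an
  equivalence relation that contains all neighbouring occupied sites. A violated exchange therefore
  separates the occupied sites into several classes.\<close>

lemma hole_pairs_if_not_symmetric:
  assumes \<Phi>: "ker_b \<mu> \<Phi>" "fin_supp \<Phi>" "no_double \<Phi>" "\<mu> \<noteq> 0"
    and A: "single A" and zw: "z \<in> fst ` A" "w \<in> fst ` A" "\<Phi> (swap_sites z w A) \<noteq> \<Phi> A"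
    and H: "H = {x \<in> Msites L. msite x \<notin> fst ` A}" "card H < L" and d: "d \<in> dirs"
  shows "2 \<le> card {y \<in> H. shift L y d \<in> H}"
proof -
  \<comment> \<open>Invariance is demanded on all configurations with the same occupied sites,
    because transitivity applies it at intermediate configurations.\<close>
  define R where "R x y \<longleftrightarrow> msite x \<in> fst ` A \<and> msite y \<in> fst ` A \<and>
    (\<forall>A'. single A' \<and> fst ` A' = fst ` A \<longrightarrow> \<Phi> (swap_sites (msite x) (msite y) A') = \<Phi> A')" for x y
  have O: "x \<in> Msites L - H \<longleftrightarrow> x \<in> Msites L \<and> msite x \<in> fst ` A" for x by (auto simp: H(1))
  obtain p q where p: "p \<in> Msites L" "z = msite p" and q: "q \<in> Msites L" "w = msite q"
    using zw(1,2) single_sites[OF A] by blast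
  show ?thesis
  proof (rule hole_pairs_if_disconnected[where R = R and p = p and q = q, OF L3 _ H(2)])
    show "H \<subseteq> Msites L" by (auto simp: H(1))
    show "R x y \<Longrightarrow> R y x" for x y by (simp add: R_def swap_sites_commute)
    show "R x x" if "x \<in> Msites L - H" for x using that unfolding O by (simp add: R_def)
    show "p \<in> Msites L - H" "q \<in> Msites L - H" using p q zw(1,2) by (simp_all only: O conj_absorb)
    show "\<not> R p q" using zw(3) A unfolding R_def p(2) q(2) by blast
    show "R x y" if "x \<in> Msites L - H" "y \<in> Msites L - H" "nn L x y" for x y
      using that swap_nn[OF that(3) \<Phi>] unfolding O R_def by blast
    show "R x v" if xy: "R x y" and yv: "R y v" for x y v
    proof (cases "x = v \<or> y = v")
      case True
      then show ?thesis using that by (auto simp: R_def)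
    next
      case False
      show ?thesis unfolding R_def
      proof (intro conjI allI impI)
        show mem: "msite x \<in> fst ` A" "msite v \<in> fst ` A" using that by (auto simp: R_def)
        fix A' assume A': "single A' \<and> fst ` A' = fst ` A"
        have step: "single (swap_sites (msite a) (msite b) E) \<and> fst ` swap_sites (msite a) (msite b) E = fst ` A
           \<and> \<Phi> (swap_sites (msite a) (msite b) E) = \<Phi> E" if "R a b" "single E \<and> fst ` E = fst ` A" for a b E
          using that single_swap[of E "msite a" "msite b"] unfolding R_def by auto
        have "msite x \<noteq> msite v" "msite y \<noteq> msite v" using False by (auto simp: msite_def)
        \<comment> \<open>Transitivity: the transposition of x and v is the one of y and v
          conjugated by that of x and y.\<close>
        then have "Transposition.transpose (msite x) (msite y) \<circ> Transposition.transpose (msite y) (msite v) \<circ>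
            Transposition.transpose (msite x) (msite y) = Transposition.transpose (msite x) (msite v)"
          by (rule transpose_comp_triple)
        then have "swap_sites (msite x) (msite v) A' =
            swap_sites (msite x) (msite y) (swap_sites (msite y) (msite v) (swap_sites (msite x) (msite y) A'))"
          by (auto simp: swap_sites_def fun_eq_iff)
        then show "\<Phi> (swap_sites (msite x) (msite v) A') = \<Phi> A'"
          using step[OF xy A'] step[OF yv, of "swap_sites (msite x) (msite y) A'"]
            step[OF xy, of "swap_sites (msite y) (msite v) (swap_sites (msite x) (msite y) A')"]
          by simp
      qed
    qed
  qed (rule d)
qed

end

section \<open>A lower bound for the hopping energy\<close>

lemma Re_cnj_mult_ge: "Re (cnj a * b) \<ge> - ((norm a)\<^sup>2 + (norm b)\<^sup>2) / 2"
proof -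
  have "- Re (cnj a * b) \<le> norm a * norm b"
    using abs_Re_le_cmod[of "cnj a * b"] by (simp add: norm_mult)
  also have "\<dots> \<le> ((norm a)\<^sup>2 + (norm b)\<^sup>2) / 2"
    using sum_squares_bound[of "norm a" "norm b"] by simp
  finally show ?thesis by (simp only: minus_divide_left[symmetric] minus_le_iff)
qed

context bonds
begin

definition moves :: "mode set \<Rightarrow> (pt \<times> pt) set" where
  "moves A = {(x, y). nn L x y \<and> msite x \<in> fst ` A \<and> msite y \<notin> fst ` A}"

lemma no_double_single:
  assumes "no_double \<Phi>" "A \<subseteq> MM" "\<Phi> A \<noteq> 0"
  shows "single A"
  unfolding single_def
proof (intro conjI allI impI notI assms(2))
  fix z s assume a: "(z, s) \<in> A" "(z, \<not> s) \<in> A"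
  have "z \<in> Lambda L B" using a(1) assms(2) MM_subset by blast
  then show False using no_doubleD[OF assms(1) _ a] assms(3) by simp
qed

text \<open>A Gershgorin-type bound: the diagonal part of the hopping form vanishes, and the off-diagonal
  terms are estimated by AM-GM.\<close>

lemma hop_M_ge:
  assumes nd: "no_double \<Phi>"
  shows "Re (hop_M \<Phi> \<Phi>) \<ge> - (\<Sum>A\<in>Pow MM. real (card (moves A)) * (norm (\<Phi> A))\<^sup>2)"
proof -
  define E where "E = {(x, y). nn L x y}"
  have E: "B \<union> converse B = E" "finite E" using bonds_Un finite_nn by (auto simp only: E_def)
  \<comment> \<open>\<open>g\<close> charges the weight of a configuration to a possible move;
    \<open>f\<close> is the same charge indexed by the configuration with the moving electron taken
    out, as it occurs in the hopping form.\<close>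
  define g where "g p \<sigma> A = (if (msite (fst p), \<sigma>) \<in> A \<and> msite (snd p) \<notin> fst ` A then (norm (\<Phi> A))\<^sup>2 else 0)"
    for p :: "pt \<times> pt" and \<sigma> A
  define f where "f p \<sigma> A = (if (msite (fst p), \<sigma>) \<notin> A then g p \<sigma> (insert (msite (fst p), \<sigma>) A) else 0)"
    for p :: "pt \<times> pt" and \<sigma> A
  have f0: "f p \<sigma> A \<ge> 0" for p \<sigma> A by (simp add: f_def g_def)
  have pair_ge: "Re (cnj (ann (msite x, \<sigma>) \<Phi> A) * ann (msite y, \<sigma>) \<Phi> A) \<ge> - (f (x, y) \<sigma> A + f (y, x) \<sigma> A) / 2"
    if xy: "(x, y) \<in> E" and A: "A \<in> Pow MM" for x y \<sigma> A
  proof (cases "ann (msite x, \<sigma>) \<Phi> A = 0 \<or> ann (msite y, \<sigma>) \<Phi> A = 0")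
    case True
    then show ?thesis using f0[of "(x, y)" \<sigma> A] f0[of "(y, x)" \<sigma> A] by auto
  next
    case False
    let ?x = "msite x" and ?y = "msite y"
    have M: "x \<in> Msites L" "y \<in> Msites L" using xy nn_Msites by (auto simp only: E_def mem_Collect_eq split_conv)
    have ne: "?x \<noteq> ?y" using xy nn_irrefl[OF L3, of x] by (auto simp: E_def msite_def)
    have n: "(?x, \<sigma>) \<notin> A" "(?y, \<sigma>) \<notin> A" "\<Phi> (insert (?x, \<sigma>) A) \<noteq> 0" "\<Phi> (insert (?y, \<sigma>) A) \<noteq> 0"
      using False by (auto simp: ann_def split: if_splits)
    have "insert (?x, \<sigma>) A \<subseteq> MM" "insert (?y, \<sigma>) A \<subseteq> MM" using A M by auto
    then have s: "single (insert (?x, \<sigma>) A)" "single (insert (?y, \<sigma>) A)"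
      using no_double_single[OF nd] n by blast+
    \<comment> \<open>Both one-electron extensions of \<open>A\<close> are singly occupied, so the
      two sites are completely empty in \<open>A\<close>, and either extension is a genuine move to
      an empty neighbour.\<close>
    have "(?x, \<not> \<sigma>) \<notin> A" "(?y, \<not> \<sigma>) \<notin> A"
      using singleD[OF s(1), of ?x \<sigma>] singleD[OF s(2), of ?y \<sigma>] by auto
    then have "(?x, r) \<notin> A" "(?y, r) \<notin> A" for r using n by (cases "r = \<sigma>"; auto)+
    then have "?x \<notin> fst ` A" "?y \<notin> fst ` A" by force+
    then have "f (x, y) \<sigma> A = (norm (ann (?x, \<sigma>) \<Phi> A))\<^sup>2" "f (y, x) \<sigma> A = (norm (ann (?y, \<sigma>) \<Phi> A))\<^sup>2"
      using n ne by (auto simp: f_def g_def ann_def norm_mult)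
    then show ?thesis using Re_cnj_mult_ge by simp
  qed
  \<comment> \<open>AM-GM yields half of each of the two orientations of an edge; summed over the
    symmetric edge set they give one full copy.\<close>
  have swap: "(\<Sum>p\<in>E. \<Sum>\<sigma>\<in>UNIV. \<Sum>A\<in>Pow MM. f (prod.swap p) \<sigma> A) = (\<Sum>p\<in>E. \<Sum>\<sigma>\<in>UNIV. \<Sum>A\<in>Pow MM. f p \<sigma> A)"
    using nn_sym by (intro sum.reindex_bij_witness[where i = prod.swap and j = prod.swap]) (auto simp: E_def)
  have fg: "(\<Sum>A\<in>Pow MM. f p \<sigma> A) = (\<Sum>A\<in>Pow MM. g p \<sigma> A)" if "p \<in> E" for p \<sigma>
  proof -
    have m: "(msite (fst p), \<sigma>) \<in> MM" using that nn_Msites by (auto simp: E_def)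
    have "(\<Sum>A\<in>Pow MM. f p \<sigma> A) = (\<Sum>A\<in>{A \<in> Pow MM. (msite (fst p), \<sigma>) \<notin> A}. g p \<sigma> (insert (msite (fst p), \<sigma>) A))"
      by (intro sum.mono_neutral_cong_right) (auto simp: f_def)
    also have "\<dots> = (\<Sum>A\<in>{A \<in> Pow MM. (msite (fst p), \<sigma>) \<in> A}. g p \<sigma> A)"
      using m by (intro sum.reindex_bij_witness[where i = "\<lambda>A. A - {(msite (fst p), \<sigma>)}" and j = "insert (msite (fst p), \<sigma>)"])
        (auto simp: insert_absorb)
    also have "\<dots> = (\<Sum>A\<in>Pow MM. g p \<sigma> A)"
      by (intro sum.mono_neutral_left) (auto simp: g_def)
    finally show ?thesis .
  qed
  have gm: "(\<Sum>p\<in>E. \<Sum>\<sigma>\<in>UNIV. g p \<sigma> A) = real (card (moves A)) * (norm (\<Phi> A))\<^sup>2" if A: "A \<in> Pow MM" for A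
  proof (cases "\<Phi> A = 0")
    case True
    then have "g p \<sigma> A = 0" for p \<sigma> by (simp add: g_def)
    then show ?thesis using True by simp
  next
    case False
    then have s: "single A" using no_double_single[OF nd] A by auto
    \<comment> \<open>An occupied site carries exactly one spin, so the sum over spins counts each
      move once.\<close>
    have "(\<Sum>\<sigma>\<in>UNIV. g p \<sigma> A) = (if p \<in> moves A then (norm (\<Phi> A))\<^sup>2 else 0)" if "p \<in> E" for p
    proof -
      have "msite (fst p) \<in> fst ` A \<longleftrightarrow> (msite (fst p), True) \<in> A \<or> (msite (fst p), False) \<in> A"
      proof -
        have "q \<in> fst ` A \<longleftrightarrow> (\<exists>s. (q, s) \<in> A)" for q by force
        then show ?thesis by (simp only: ex_bool_eq)
      qed
      moreover have "\<not> ((msite (fst p), True) \<in> A \<and> (msite (fst p), False) \<in> A)"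
        using singleD[OF s, of "msite (fst p)" True] by auto
      moreover have "p \<in> moves A \<longleftrightarrow> msite (fst p) \<in> fst ` A \<and> msite (snd p) \<notin> fst ` A"
        using that by (auto simp only: moves_def E_def mem_Collect_eq case_prod_beta)
      ultimately show ?thesis by (auto simp: g_def UNIV_bool simp del: image_iff)
    qed
    then have "(\<Sum>p\<in>E. \<Sum>\<sigma>\<in>UNIV. g p \<sigma> A) = (\<Sum>p\<in>E. if p \<in> moves A then (norm (\<Phi> A))\<^sup>2 else 0)"
      by (intro sum.cong refl) auto
    also have "\<dots> = (\<Sum>p\<in>E \<inter> moves A. (norm (\<Phi> A))\<^sup>2)"
      using E(2) by (simp only: sum.inter_restrict)
    also have "E \<inter> moves A = moves A" by (auto simp only: E_def moves_def)
    finally show ?thesis by simp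
  qed
  have "- (\<Sum>A\<in>Pow MM. real (card (moves A)) * (norm (\<Phi> A))\<^sup>2) = - (\<Sum>A\<in>Pow MM. \<Sum>p\<in>E. \<Sum>\<sigma>\<in>UNIV. g p \<sigma> A)"
    using gm by simp
  also have "\<dots> = - (\<Sum>p\<in>E. \<Sum>\<sigma>\<in>UNIV. \<Sum>A\<in>Pow MM. g p \<sigma> A)"
    by (simp only: sum.swap[of _ _ "Pow MM"])
  also have "\<dots> = - (\<Sum>p\<in>E. \<Sum>\<sigma>\<in>UNIV. \<Sum>A\<in>Pow MM. f p \<sigma> A)"
    by (simp only: fg cong: sum.cong)
  also have "\<dots> = (\<Sum>p\<in>E. \<Sum>\<sigma>\<in>UNIV. \<Sum>A\<in>Pow MM. - (f p \<sigma> A + f (prod.swap p) \<sigma> A) / 2)"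
  proof -
    have "(\<Sum>p\<in>E. \<Sum>\<sigma>\<in>UNIV. \<Sum>A\<in>Pow MM. - (f p \<sigma> A + f (prod.swap p) \<sigma> A) / 2)
      = - ((\<Sum>p\<in>E. \<Sum>\<sigma>\<in>UNIV. \<Sum>A\<in>Pow MM. f p \<sigma> A) + (\<Sum>p\<in>E. \<Sum>\<sigma>\<in>UNIV. \<Sum>A\<in>Pow MM. f (prod.swap p) \<sigma> A)) / 2"
      by (simp only: sum_divide_distrib[symmetric] sum_negf sum.distrib)
    then show ?thesis unfolding swap by simp
  qed
  also have "\<dots> \<le> (\<Sum>p\<in>E. \<Sum>\<sigma>\<in>UNIV. \<Sum>A\<in>Pow MM. Re (cnj (ann (msite (fst p), \<sigma>) \<Phi> A) * ann (msite (snd p), \<sigma>) \<Phi> A))"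
  proof (intro sum_mono)
    fix p \<sigma> A assume "p \<in> E" "A \<in> Pow MM"
    then show "- (f p \<sigma> A + f (prod.swap p) \<sigma> A) / 2 \<le> Re (cnj (ann (msite (fst p), \<sigma>) \<Phi> A) * ann (msite (snd p), \<sigma>) \<Phi> A)"
      using pair_ge[of "fst p" "snd p" A \<sigma>] by (cases p) simp
  qed
  also have "\<dots> = Re (hop_M \<Phi> \<Phi>)"
    unfolding hop_M_def E ip_def by (simp only: Re_sum case_prod_beta)
  finally show ?thesis .
qed

text \<open>Count moves from their holes. In each direction a hole admits a move only if the
  adjacent site is not a hole, so at least two holes are lost per direction, and 12 over the six
  directions.\<close>

lemma card_moves_le:
  assumes H: "H = {x \<in> Msites L. msite x \<notin> fst ` A}"
    and pairs: "\<And>d. d \<in> dirs \<Longrightarrow> 2 \<le> card {y \<in> H. shift L y d \<in> H}"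
  shows "card (moves A) + 12 \<le> 6 * card H"
proof -
  have L0: "L > 0" using L3 by simp
  have fH: "finite H" by (simp add: H)
  have sub: "moves A \<subseteq> (\<Union>d\<in>dirs. (\<lambda>y. (shift L y d, y)) ` {y \<in> H. shift L y d \<notin> H})"
  proof
    fix p assume "p \<in> moves A"
    then obtain x y where p: "p = (x, y)" "nn L x y" "msite x \<in> fst ` A" "msite y \<notin> fst ` A"
      unfolding moves_def by blast
    then obtain d where d: "d \<in> dirs" "x = shift L y d" using nn_sym nn_iff by blast
    have "y \<in> H" "x \<notin> H" using p nn_Msites by (simp_all add: H)
    then show "p \<in> (\<Union>d\<in>dirs. (\<lambda>y. (shift L y d, y)) ` {y \<in> H. shift L y d \<notin> H})"
      using d p(1) by blast
  qed
  have "card (moves A) \<le> card (\<Union>d\<in>dirs. (\<lambda>y. (shift L y d, y)) ` {y \<in> H. shift L y d \<notin> H})"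
    by (rule card_mono[OF _ sub]) (simp add: fH)
  also have "\<dots> \<le> (\<Sum>d\<in>dirs. card ((\<lambda>y. (shift L y d, y)) ` {y \<in> H. shift L y d \<notin> H}))"
    by (rule card_UN_le) simp
  also have "\<dots> \<le> (\<Sum>d\<in>dirs. card {y \<in> H. shift L y d \<notin> H})"
    by (intro sum_mono card_image_le) (simp add: fH)
  finally have 1: "card (moves A) \<le> (\<Sum>d\<in>dirs. card {y \<in> H. shift L y d \<notin> H})" .
  have "(\<Sum>d\<in>dirs. card {y \<in> H. shift L y d \<notin> H}) + 12 = (\<Sum>d\<in>dirs. card {y \<in> H. shift L y d \<notin> H} + 2)"
    by (simp only: sum.distrib sum_constant card_dirs) simp
  also have "\<dots> \<le> (\<Sum>d\<in>dirs. card H)"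
  proof (intro sum_mono)
    fix d assume d: "d \<in> dirs"
    have "H = {y \<in> H. shift L y d \<notin> H} \<union> {y \<in> H. shift L y d \<in> H}" by auto
    then have "card H = card ({y \<in> H. shift L y d \<notin> H} \<union> {y \<in> H. shift L y d \<in> H})" by simp
    also have "\<dots> = card {y \<in> H. shift L y d \<notin> H} + card {y \<in> H. shift L y d \<in> H}"
      using fH by (intro card_Un_disjoint) auto
    finally show "card {y \<in> H. shift L y d \<notin> H} + 2 \<le> card H" using pairs[OF d] by simp
  qed
  finally show ?thesis using 1 by (simp add: card_dirs)
qed

text \<open>With at most two holes every direction would map the whole hole set into itself, which
  would then contain the six distinct neighbours of a hole.\<close>

lemma card_holes_ge_3:
  assumes fH: "finite H"
    and pairs: "\<And>d. d \<in> dirs \<Longrightarrow> 2 \<le> card {y \<in> H. shift L y d \<in> H}"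
  shows "3 \<le> card H"
proof (rule ccontr)
  assume "\<not> 3 \<le> card H"
  then have "card H \<le> 2" by simp
  have all: "{y \<in> H. shift L y d \<in> H} = H" if "d \<in> dirs" for d
    using pairs[OF that] \<open>card H \<le> 2\<close> fH by (intro card_seteq) auto
  have "(1, 0) \<in> dirs" by (simp add: dirs_def)
  then have "2 \<le> card H" using pairs all by metis
  then have "H \<noteq> {}" by auto
  then obtain y where "y \<in> H" by blast
  then have "shift L y ` dirs \<subseteq> H" using all by blast
  then have "card (shift L y ` dirs) \<le> card H" using fH by (rule card_mono[rotated])
  then show False using \<open>card H \<le> 2\<close> inj_on_shift_dirs[OF L3, of y] by (simp add: card_image card_dirs)
qed

end

section \<open>Slater determinants\<close>

definition vac :: state where
  "vac = (\<lambda>A. if A = {} then 1 else 0)"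

lemma ann_vac [simp]: "ann j vac = (\<lambda>_. 0)"
  by (auto simp: ann_def vac_def)

lemma fin_supp_vac [simp]: "fin_supp vac"
  by (auto simp: fin_supp_def vac_def)

text \<open>The one-electron wave function with values \<open>g\<close> on M that is orthogonal to
  all b-orbitals; its values on the decoration obey the relations of \<open>ker_b\<close>.\<close>

definition ext :: "real \<Rightarrow> (pt \<Rightarrow> complex) \<Rightarrow> site \<Rightarrow> complex" where
  "ext \<mu> g z = (case z of (k, x, y) \<Rightarrow> if k = 0 then g x
     else if k = 1 then complex_of_real \<mu> * (g x + g y) else - complex_of_real \<mu> * (g x - g y))"

lemma ext_simps [simp]:
  "ext \<mu> g (msite x) = g x"
  "ext \<mu> g (usite x y) = complex_of_real \<mu> * (g x + g y)"
  "ext \<mu> g (ubsite x y) = - complex_of_real \<mu> * (g x - g y)"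
  by (simp_all add: ext_def msite_def usite_def ubsite_def)

definition cre_up :: "site set \<Rightarrow> (site \<Rightarrow> complex) \<Rightarrow> state \<Rightarrow> state" where
  "cre_up S f \<Phi> = (\<lambda>A. \<Sum>z\<in>S. f z * cre (z, True) \<Phi> A)"

definition ann_up :: "site set \<Rightarrow> (site \<Rightarrow> complex) \<Rightarrow> state \<Rightarrow> state" where
  "ann_up S f \<Phi> = (\<lambda>A. \<Sum>z\<in>S. cnj (f z) * ann (z, True) \<Phi> A)"

lemma cre_up_lin:
  "cre_up S f (\<lambda>A. h A + k A) = (\<lambda>A. cre_up S f h A + cre_up S f k A)"
  "cre_up S f (\<lambda>A. h A - k A) = (\<lambda>A. cre_up S f h A - cre_up S f k A)"
  "cre_up S f (\<lambda>A. c * h A) = (\<lambda>A. c * cre_up S f h A)"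
  "cre_up S f (\<lambda>A. - h A) = (\<lambda>A. - cre_up S f h A)"
  "cre_up S f (\<lambda>A. 0) = (\<lambda>A. 0)"
  by (simp_all add: cre_up_def fun_eq_iff algebra_simps sum.distrib sum_subtractf sum_distrib_left sum_negf)

lemma cre_up_sum: "cre_up S f (\<lambda>A. \<Sum>i\<in>I. F i A) = (\<lambda>A. \<Sum>i\<in>I. cre_up S f (F i) A)"
proof
  fix A
  show "cre_up S f (\<lambda>A. \<Sum>i\<in>I. F i A) A = (\<Sum>i\<in>I. cre_up S f (F i) A)"
    by (simp add: cre_up_def sum_distrib_left) (rule sum.swap)
qed

lemma fin_supp_cre_up: "fin_supp \<Phi> \<Longrightarrow> fin_supp (cre_up S f \<Phi>)"
  unfolding cre_up_def by (intro fin_supp_lin fin_supp_cre)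

lemma ann_cre_up:
  assumes "fin_supp \<Phi>" "finite S" "z \<in> S"
  shows "ann (z, s) (cre_up S f \<Phi>) = (\<lambda>A. (if s then f z else 0) * \<Phi> A - cre_up S f (ann (z, s) \<Phi>) A)"
proof
  fix A
  have "ann (z, s) (cre_up S f \<Phi>) A = (\<Sum>w\<in>S. f w * ((if w = z then if s then \<Phi> A else 0 else 0) - cre (w, True) (ann (z, s) \<Phi>) A))"
    unfolding cre_up_def ann_lin
    by (intro sum.cong refl) (auto simp: ann_cre[OF assms(1)])
  also have "\<dots> = (\<Sum>w\<in>S. if w = z then f w * (if s then \<Phi> A else 0) else 0) - cre_up S f (ann (z, s) \<Phi>) A"
    unfolding right_diff_distrib sum_subtractf cre_up_def
    by (intro arg_cong2[where f = "(-)"] sum.cong refl) simp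
  also have "\<dots> = (if s then f z else 0) * \<Phi> A - cre_up S f (ann (z, s) \<Phi>) A"
    using assms(2,3) by simp
  finally show "ann (z, s) (cre_up S f \<Phi>) A = (if s then f z else 0) * \<Phi> A - cre_up S f (ann (z, s) \<Phi>) A" .
qed

lemma cre_cre_up:
  assumes "fin_supp \<Phi>"
  shows "cre j (cre_up S f \<Phi>) = (\<lambda>A. - cre_up S f (cre j \<Phi>) A)"
proof
  fix A
  show "cre j (cre_up S f \<Phi>) A = - cre_up S f (cre j \<Phi>) A"
    unfolding cre_up_def cre_lin sum_negf[symmetric] mult_minus_right[symmetric]
    by (intro sum.cong refl arg_cong2[where f = "(*)"] cre_cre assms)
qed

lemma ann_up_cre_up:
  assumes "fin_supp \<Phi>" "finite S"
  shows "ann_up S f (cre_up S g \<Phi>) = (\<lambda>A. (\<Sum>z\<in>S. cnj (f z) * g z) * \<Phi> A - cre_up S g (ann_up S f \<Phi>) A)"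
proof
  fix A
  have "ann_up S f (cre_up S g \<Phi>) A = (\<Sum>z\<in>S. cnj (f z) * (g z * \<Phi> A - cre_up S g (ann (z, True) \<Phi>) A))"
    unfolding ann_up_def by (intro sum.cong refl) (simp add: ann_cre_up[OF assms])
  also have "\<dots> = (\<Sum>z\<in>S. cnj (f z) * g z) * \<Phi> A - (\<Sum>z\<in>S. cnj (f z) * cre_up S g (ann (z, True) \<Phi>) A)"
    by (simp add: right_diff_distrib sum_subtractf sum_distrib_right mult.assoc)
  also have "(\<Sum>z\<in>S. cnj (f z) * cre_up S g (ann (z, True) \<Phi>) A) = cre_up S g (ann_up S f \<Phi>) A"
    unfolding ann_up_def cre_up_sum cre_up_lin ..
  finally show "ann_up S f (cre_up S g \<Phi>) A = (\<Sum>z\<in>S. cnj (f z) * g z) * \<Phi> A - cre_up S g (ann_up S f \<Phi>) A" .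
qed

definition slater :: "site set \<Rightarrow> ('k \<Rightarrow> site \<Rightarrow> complex) \<Rightarrow> 'k list \<Rightarrow> state" where
  "slater S g ks = foldr (\<lambda>k. cre_up S (g k)) ks vac"

lemma slater_simps [simp]:
  "slater S g [] = vac"
  "slater S g (k # ks) = cre_up S (g k) (slater S g ks)"
  by (simp_all add: slater_def)

lemma fin_supp_slater [simp]: "fin_supp (slater S g ks)"
  by (induction ks) (simp_all add: fin_supp_cre_up)

lemma slater_support:
  assumes "slater S g ks A \<noteq> 0"
  shows "A \<subseteq> S \<times> {True} \<and> finite A \<and> card A = length ks"
  using assms
proof (induction ks arbitrary: A)
  case Nil
  then show ?case by (auto simp: vac_def split: if_splits)
next
  case (Cons k ks)
  then obtain z where z: "z \<in> S" "cre (z, True) (slater S g ks) A \<noteq> 0"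
    by (auto simp: cre_up_def elim!: sum.not_neutral_contains_not_neutral)
  then have zA: "(z, True) \<in> A" "slater S g ks (A - {(z, True)}) \<noteq> 0" by (auto simp: cre_def split: if_splits)
  from Cons.IH[OF zA(2)] have IH: "A - {(z, True)} \<subseteq> S \<times> {True}" "finite A" "card (A - {(z, True)}) = length ks" by auto
  show ?case using IH z(1) zA(1) card_Suc_Diff1[OF IH(2) zA(1)] by auto
qed

lemma ann_up_slater:
  assumes "finite S" "\<And>k'. k' \<in> set ks \<Longrightarrow> (\<Sum>z\<in>S. cnj (g k z) * g k' z) = 0"
  shows "ann_up S (g k) (slater S g ks) = (\<lambda>_. 0)"
  using assms(2)
proof (induction ks)
  case Nil
  then show ?case by (simp add: ann_up_def)
next
  case (Cons k' ks)
  then show ?case by (simp add: ann_up_cre_up assms(1) cre_up_lin)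
qed

text \<open>Annihilating the orbital added last returns \<open>c\<close> times the shorter
  determinant, because that orbital is orthogonal to the others.\<close>

lemma slater_nonzero:
  assumes "finite S" "distinct ks"
    and "\<And>k k'. k \<in> set ks \<Longrightarrow> k' \<in> set ks \<Longrightarrow> (\<Sum>z\<in>S. cnj (g k z) * g k' z) = (if k = k' then c else 0)"
    and "c \<noteq> 0"
  shows "\<exists>A. slater S g ks A \<noteq> 0"
  using assms(2,3)
proof (induction ks)
  case Nil
  then show ?case by (auto simp: vac_def)
next
  case (Cons k ks)
  then obtain A where A: "slater S g ks A \<noteq> 0" by auto
  have 0: "ann_up S (g k) (slater S g ks) = (\<lambda>_. 0)"
    using Cons.prems assms(1) by (intro ann_up_slater) auto
  have "ann_up S (g k) (slater S g (k # ks)) A = c * slater S g ks A"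
    using Cons.prems(2)[of k k] by (simp add: ann_up_cre_up assms(1) 0 cre_up_lin)
  moreover have "ann_up S (g k) (\<lambda>_. 0) A = 0" by (simp add: ann_up_def)
  ultimately have "slater S g (k # ks) \<noteq> (\<lambda>_. 0)" using A \<open>c \<noteq> 0\<close> by auto
  then show ?case by (auto simp: fun_eq_iff)
qed

section \<open>Slater determinants on the decorated lattice and their hopping energy\<close>

context bonds
begin

lemma ker_b_cre_up:
  assumes "ker_b \<mu> \<Phi>" "fin_supp \<Phi>"
  shows "ker_b \<mu> (cre_up (Lambda L B) (ext \<mu> g) \<Phi>)"
  unfolding ker_b_def
proof (intro allI impI)
  fix x y \<sigma> assume b: "(x, y) \<in> B"
  note mem = Lambda_mem(1)[OF bond_M(1)[OF b]] Lambda_mem(1)[OF bond_M(2)[OF b]] Lambda_mem(2,3)[OF b]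
  note ac = mem[THEN ann_cre_up[OF assms(2) finite_Lambda]]
  let ?F = "cre_up (Lambda L B) (ext \<mu> g) \<Phi>"
  show "ann (usite x y, \<sigma>) ?F = (\<lambda>A. complex_of_real \<mu> * (ann (msite x, \<sigma>) ?F A + ann (msite y, \<sigma>) ?F A)) \<and>
     ann (ubsite x y, \<sigma>) ?F = (\<lambda>A. - complex_of_real \<mu> * (ann (msite x, \<sigma>) ?F A - ann (msite y, \<sigma>) ?F A))"
    unfolding ac ker_bD[OF assms(1) b] cre_up_lin by (simp add: fun_eq_iff algebra_simps)
qed

lemma ker_b_vac: "ker_b \<mu> vac"
  by (simp add: ker_b_def)

lemma ker_b_slater: "ker_b \<mu> (slater (Lambda L B) (\<lambda>k. ext \<mu> (g k)) ks)"
  by (induction ks) (simp_all add: ker_b_vac ker_b_cre_up)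

lemma no_double_slater: "no_double (slater S g ks)"
proof (rule no_doubleI)
  fix z :: site and A assume "(z, True) \<in> A" "(z, False) \<in> A"
  then show "slater S g ks A = 0" using slater_support[of S g ks A] by auto
qed

lemma nstate_slater: "nstate L B (length ks) (slater (Lambda L B) g ks)"
  using slater_support[of "Lambda L B" g ks] unfolding nstate_def by blast

text \<open>A configuration inside M is built only by creators on M. The determinant can thus be
  replaced by one on M, where the orbitals are eigenfunctions of the hopping.\<close>

lemma slater_restrict:
  assumes "A \<subseteq> MM"
  shows "slater (Lambda L B) (\<lambda>k. ext \<mu> (g k)) ks A = slater (msite ` Msites L) (\<lambda>k. ext \<mu> (g k)) ks A"
  using assms
proof (induction ks arbitrary: A)
  case (Cons k ks)
  have "slater (Lambda L B) (\<lambda>k. ext \<mu> (g k)) (k # ks) A = (\<Sum>z\<in>msite ` Msites L. ext \<mu> (g k) z * cre (z, True) (slater (Lambda L B) (\<lambda>k. ext \<mu> (g k)) ks) A)"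
    unfolding slater_simps cre_up_def using Cons.prems
    by (intro sum.mono_neutral_right) (auto simp: Lambda_def cre_def)
  also have "\<dots> = (\<Sum>z\<in>msite ` Msites L. ext \<mu> (g k) z * cre (z, True) (slater (msite ` Msites L) (\<lambda>k. ext \<mu> (g k)) ks) A)"
  proof (intro sum.cong refl)
    fix z
    have "A - {(z, True)} \<subseteq> MM" using Cons.prems by blast
    from Cons.IH[OF this]
    show "ext \<mu> (g k) z * cre (z, True) (slater (Lambda L B) (\<lambda>k. ext \<mu> (g k)) ks) A =
        ext \<mu> (g k) z * cre (z, True) (slater (msite ` Msites L) (\<lambda>k. ext \<mu> (g k)) ks) A"
      by (simp add: cre_def)
  qed
  finally show ?case by (simp add: cre_up_def)
qed simp

definition hop_op :: "state \<Rightarrow> state" where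
  "hop_op \<Phi> = (\<lambda>A. \<Sum>x\<in>Msites L. \<Sum>y\<in>{y. nn L x y}. \<Sum>\<sigma>\<in>UNIV. cre (msite x, \<sigma>) (ann (msite y, \<sigma>) \<Phi>) A)"

lemma hop_M_hop_op: "hop_M \<Phi> \<Psi> = ip MM \<Phi> (hop_op \<Psi>)"
  unfolding hop_M_def hop_op_def sum_edges ip_sum
  by (intro sum.cong refl) (simp add: ip_cre)

text \<open>The hopping commutes with creation of an eigenfunction up to \<open>e\<close> times that
  creation, so in a determinant the one-electron energies add up.\<close>

lemma hop_op_cre_up:
  assumes "fin_supp \<Phi>" and eig: "\<And>x. x \<in> Msites L \<Longrightarrow> (\<Sum>y\<in>{y. nn L x y}. g y) = e * g x"
  shows "hop_op (cre_up (msite ` Msites L) (ext \<mu> g) \<Phi>) =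
    (\<lambda>A. e * cre_up (msite ` Msites L) (ext \<mu> g) \<Phi> A + cre_up (msite ` Msites L) (ext \<mu> g) (hop_op \<Phi>) A)"
proof
  fix A
  let ?S = "msite ` Msites L" let ?D = "cre_up ?S (ext \<mu> g)"
  have *: "cre (msite x, \<sigma>) (ann (msite y, \<sigma>) (?D \<Phi>)) A =
      (if \<sigma> then g y * cre (msite x, \<sigma>) \<Phi> A else 0) + ?D (cre (msite x, \<sigma>) (ann (msite y, \<sigma>) \<Phi>)) A"
    if "y \<in> Msites L" for x y \<sigma>
    using that assms(1) by (simp add: ann_cre_up cre_cre_up)
  have "hop_op (?D \<Phi>) A = (\<Sum>x\<in>Msites L. \<Sum>y\<in>{y. nn L x y}. \<Sum>\<sigma>\<in>UNIV.
      (if \<sigma> then g y * cre (msite x, \<sigma>) \<Phi> A else 0) + ?D (cre (msite x, \<sigma>) (ann (msite y, \<sigma>) \<Phi>)) A)"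
    unfolding hop_op_def using nn_Msites(2) by (intro sum.cong refl *) auto
  also have "\<dots> = (\<Sum>x\<in>Msites L. \<Sum>y\<in>{y. nn L x y}. g y * cre (msite x, True) \<Phi> A) + ?D (hop_op \<Phi>) A"
    by (simp add: sum.distrib hop_op_def cre_up_sum UNIV_bool cre_up_lin)
  also have "(\<Sum>x\<in>Msites L. \<Sum>y\<in>{y. nn L x y}. g y * cre (msite x, True) \<Phi> A) = (\<Sum>x\<in>Msites L. e * (g x * cre (msite x, True) \<Phi> A))"
    by (intro sum.cong refl) (simp add: sum_distrib_right[symmetric] eig)
  also have "\<dots> = e * ?D \<Phi> A"
    by (simp add: cre_up_def sum.reindex[OF inj_msite] sum_distrib_left)
  finally show "hop_op (?D \<Phi>) A = e * ?D \<Phi> A + ?D (hop_op \<Phi>) A" .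
qed

lemma hop_op_slater:
  assumes "\<And>k x. k \<in> set ks \<Longrightarrow> x \<in> Msites L \<Longrightarrow> (\<Sum>y\<in>{y. nn L x y}. g k y) = e k * g k x"
  shows "hop_op (slater (msite ` Msites L) (\<lambda>k. ext \<mu> (g k)) ks) =
    (\<lambda>A. sum_list (map e ks) * slater (msite ` Msites L) (\<lambda>k. ext \<mu> (g k)) ks A)"
  using assms
proof (induction ks)
  case Nil
  show ?case by (simp add: hop_op_def)
next
  case (Cons k ks)
  then have IH: "hop_op (slater (msite ` Msites L) (\<lambda>k. ext \<mu> (g k)) ks) =
    (\<lambda>A. sum_list (map e ks) * slater (msite ` Msites L) (\<lambda>k. ext \<mu> (g k)) ks A)" by simp
  show ?case
    using Cons.prems by (simp add: hop_op_cre_up[where e = "e k"] IH cre_up_lin distrib_right)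
qed

lemma exists_slater_state:
  assumes "distinct ks" "ks \<noteq> []"
    and eig: "\<And>k x. k \<in> set ks \<Longrightarrow> x \<in> Msites L \<Longrightarrow> (\<Sum>y\<in>{y. nn L x y}. g k y) = complex_of_real (e k) * g k x"
    and orth: "\<And>k k'. k \<in> set ks \<Longrightarrow> k' \<in> set ks \<Longrightarrow> (\<Sum>x\<in>Msites L. cnj (g k x) * g k' x) = (if k = k' then c else 0)"
    and "c \<noteq> 0"
  shows "\<exists>\<Psi>. nstate L B (length ks) \<Psi> \<and> inner_st L B \<Psi> \<Psi> = 1 \<and> ker_b \<mu> \<Psi> \<and> no_double \<Psi> \<and>
     Re (hop_form \<mu> \<Psi> \<Psi>) = sum_list (map e ks)"
proof -
  let ?S = "msite ` Msites L"
  define \<Psi> where "\<Psi> = slater (Lambda L B) (\<lambda>k. ext \<mu> (g k)) ks"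
  define \<xi> where "\<xi> = slater ?S (\<lambda>k. ext \<mu> (g k)) ks"
  let ?E = "complex_of_real (sum_list (map e ks))"
  have n: "nstate L B (length ks) \<Psi>" and k: "ker_b \<mu> \<Psi>" and d: "no_double \<Psi>"
    unfolding \<Psi>_def by (rule nstate_slater ker_b_slater no_double_slater)+
  have agree: "\<Psi> A = \<xi> A" if "A \<subseteq> MM" for A unfolding \<Psi>_def \<xi>_def by (rule slater_restrict[OF that])
  have "sum_list (map (\<lambda>k. complex_of_real (e k)) ks) = ?E" by (induction ks) auto
  then have hop: "hop_op \<xi> = (\<lambda>A. ?E * \<xi> A)"
    using hop_op_slater[where ks = ks and g = g and e = "\<lambda>k. complex_of_real (e k)", OF eig]
    unfolding \<xi>_def by (simp only:)
  have "hop_M \<Psi> \<Psi> = ip MM \<xi> (hop_op \<Psi>)"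
    unfolding hop_M_hop_op using agree by (intro ip_cong) auto
  \<comment> \<open>Hopping reaches a configuration inside M only from configurations inside M,
    where the two determinants agree.\<close>
  also have "ip MM \<xi> (hop_op \<Psi>) = ip MM \<xi> (hop_op \<xi>)"
  proof (rule ip_cong)
    fix A assume A: "A \<subseteq> MM"
    have "cre (msite x, \<sigma>) (ann (msite y, \<sigma>) \<Psi>) A = cre (msite x, \<sigma>) (ann (msite y, \<sigma>) \<xi>) A" if "y \<in> Msites L" for x y \<sigma>
      using agree[of "insert (msite y, \<sigma>) (A - {(msite x, \<sigma>)})"] A that by (auto simp: cre_def ann_def)
    then show "hop_op \<Psi> A = hop_op \<xi> A" unfolding hop_op_def
      using nn_Msites(2) by (intro sum.cong refl) auto
  qed simp
  also have "\<dots> = ?E * ip MM \<xi> \<xi>" unfolding hop ip_lin ..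
  also have "ip MM \<xi> \<xi> = ip MM \<Psi> \<Psi>" using agree by (intro ip_cong) auto
  finally have hM: "hop_M \<Psi> \<Psi> = ?E * ip MM \<Psi> \<Psi>" .
  \<comment> \<open>The hopping form and the inner product both pass from M to the decorated lattice
    with the same factor, so the eigenvalue on M is the energy quotient of the whole state.\<close>
  have hf: "hop_form \<mu> \<Psi> \<Psi> = ?E * ip LM \<Psi> \<Psi>"
  proof -
    have "length ks > 0" using \<open>ks \<noteq> []\<close> by simp
    from hop_form_eq_hop_M[OF n n k k this] show ?thesis
      unfolding ip_ker_b[OF n n k k] hM by (simp only: mult_ac)
  qed
  obtain A where A: "\<xi> A \<noteq> 0" unfolding \<xi>_def
    using slater_nonzero[of ?S ks "\<lambda>k. ext \<mu> (g k)" c] assms(1,5) orth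
    by (auto simp: sum.reindex[OF inj_msite])
  have "A \<subseteq> MM" using slater_support[OF A[unfolded \<xi>_def]] by blast
  then have "\<Psi> A \<noteq> 0" "A \<subseteq> LM" using A agree MM_subset by auto
  then have "Re (ip LM \<Psi> \<Psi>) \<noteq> 0" by (subst Re_ip_self_eq_0_iff) auto
  then have pos: "Re (ip LM \<Psi> \<Psi>) > 0" using Re_ip_self_nonneg[of LM \<Psi>] by simp
  define r where "r = Re (ip LM \<Psi> \<Psi>)"
  have r: "ip LM \<Psi> \<Psi> = complex_of_real r" "r > 0" using pos by (simp_all add: r_def ip_self)
  define c where "c = complex_of_real (1 / sqrt r)"
  have cc: "cnj c * (c * complex_of_real r) = 1"
    using r(2) by (simp add: c_def mult.assoc[symmetric] flip: of_real_mult)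
  have kc: "ker_b \<mu> (\<lambda>A. c * \<Psi> A)" and nc: "nstate L B (length ks) (\<lambda>A. c * \<Psi> A)" and dc: "no_double (\<lambda>A. c * \<Psi> A)"
    using ker_b_lin(3)[OF k] nstate_lin(3)[OF n] no_double_lin(3)[OF d] by auto
  have hs: "hop_form \<mu> (\<lambda>A. c * \<Psi> A) (\<lambda>A. c * \<Psi> A) = cnj c * (c * hop_form \<mu> \<Psi> \<Psi>)"
    unfolding hop_form_ker_b[OF kc kc] hop_form_ker_b[OF k k] ann_lin ip_lin
    by (simp add: sum_distrib_left case_prod_beta mult_ac)
  have "hop_form \<mu> (\<lambda>A. c * \<Psi> A) (\<lambda>A. c * \<Psi> A) = ?E * (cnj c * (c * complex_of_real r))"
    unfolding hs hf r(1) by (simp only: mult_ac)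
  then have "Re (hop_form \<mu> (\<lambda>A. c * \<Psi> A) (\<lambda>A. c * \<Psi> A)) = sum_list (map e ks)"
    unfolding cc by simp
  moreover have "inner_st L B (\<lambda>A. c * \<Psi> A) (\<lambda>A. c * \<Psi> A) = 1"
    unfolding inner_st_ip ip_lin r(1) using cc by (simp only: mult_ac)
  ultimately show ?thesis using kc nc dc by blast
qed

end

section \<open>Plane waves\<close>

definition wave :: "nat \<Rightarrow> int \<Rightarrow> complex" where
  "wave L m = cis (2 * pi * real_of_int m / real L)"

lemma wave_0 [simp]: "wave L 0 = 1"
  by (simp add: wave_def)

lemma wave_add: "wave L (a + b) = wave L a * wave L b"
  by (simp add: wave_def cis_mult ring_distribs add_divide_distrib)

lemma cnj_wave: "cnj (wave L m) = wave L (- m)"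
  by (simp add: wave_def cis_cnj)

lemma wave_power: "wave L (m * int j) = wave L m ^ j"
  by (induction j) (simp_all add: distrib_left wave_add mult.commute)

lemma wave_eq_1_iff:
  assumes "L > 0"
  shows "wave L m = 1 \<longleftrightarrow> int L dvd m"
proof
  assume "wave L m = 1"
  then have "Re (wave L m) = 1" by simp
  then have "cos (2 * pi * real_of_int m / real L) = 1" by (simp add: wave_def)
  then obtain k :: int where "2 * pi * real_of_int m / real L = real_of_int k * 2 * pi"
    using cos_one_2pi_int by metis
  then have "2 * pi * real_of_int m = 2 * pi * (real_of_int k * real L)" using assms by (simp add: field_simps)
  then have "real_of_int m = real_of_int (k * int L)" by (simp only: mult_cancel_left) simp
  then have "m = k * int L" by linarith
  then show "int L dvd m" by simp
next
  assume "int L dvd m"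
  then obtain k where "m = int L * k" by blast
  then have "wave L m = cis (2 * pi * real_of_int k)" using assms by (simp add: wave_def field_simps)
  then show "wave L m = 1" by simp
qed

lemma wave_cong: "L > 0 \<Longrightarrow> int L dvd a - b \<Longrightarrow> wave L a = wave L b"
  using wave_add[of L b "a - b"] wave_eq_1_iff[of L "a - b"] by simp

lemma sum_wave:
  assumes "L > 0" "\<not> int L dvd m"
  shows "(\<Sum>j<L. wave L (m * int j)) = 0"
proof -
  have "wave L m \<noteq> 1" using wave_eq_1_iff assms by blast
  moreover have "wave L m ^ L = 1" using wave_eq_1_iff[of L "m * int L"] assms by (simp add: wave_power)
  ultimately show ?thesis by (simp add: wave_power geometric_sum)
qed

lemma sum_wave_shifted:
  assumes "L > 0" "\<not> int L dvd m"
  shows "(\<Sum>i\<in>{a..<a + int L}. wave L (i * m)) = 0"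
proof -
  have "(\<Sum>i\<in>{a..<a + int L}. wave L (i * m)) = (\<Sum>j<L. wave L (a * m) * wave L (m * int j))"
    by (rule sum.reindex_bij_witness[where i = "\<lambda>j. a + int j" and j = "\<lambda>i. nat (i - a)"])
       (auto simp: algebra_simps simp flip: wave_add)
  then show ?thesis using sum_wave[OF assms] by (simp flip: sum_distrib_left)
qed

definition plane_wave :: "nat \<Rightarrow> int \<times> int \<Rightarrow> pt \<Rightarrow> complex" where
  "plane_wave L n x = wave L (fst n * int (fst x) + snd n * int (snd x))"

definition dispersion :: "nat \<Rightarrow> int \<times> int \<Rightarrow> real" where
  "dispersion L n = (\<Sum>d\<in>dirs. cos (2 * pi * real_of_int (fst n * fst d + snd n * snd d) / real L))"

lemma plane_wave_shift:
  assumes "L > 0"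
  shows "plane_wave L n (shift L x d) = plane_wave L n x * wave L (fst n * fst d + snd n * snd d)"
proof -
  have *: "int L dvd a * (b mod int L) - a * b" for a b
  proof -
    have "a * (b mod int L) mod int L = a * b mod int L" by (simp add: mod_mult_right_eq)
    then show ?thesis by (simp add: mod_eq_dvd_iff)
  qed
  have "int L dvd (fst n * ((int (fst x) + fst d) mod int L) - fst n * (int (fst x) + fst d)) +
       (snd n * ((int (snd x) + snd d) mod int L) - snd n * (int (snd x) + snd d))"
    by (intro dvd_add *)
  then show ?thesis
    unfolding plane_wave_def wave_add[symmetric] int_shift[OF assms]
    by (intro wave_cong[OF assms]) (simp add: algebra_simps)
qed

text \<open>The directions come in opposite pairs, so the imaginary parts cancel.\<close>

lemma sum_dirs_wave: "(\<Sum>d\<in>dirs. wave L (fst n * fst d + snd n * snd d)) = complex_of_real (dispersion L n)"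
  unfolding dispersion_def of_real_sum wave_def
  by (simp add: dirs_def complex_eq_iff minus_divide_left[symmetric] right_diff_distrib
      diff_divide_distrib cos_diff sin_diff cos_add sin_add)

lemma plane_wave_eigen:
  assumes "L \<ge> 3" "x \<in> Msites L"
  shows "(\<Sum>y\<in>{y. nn L x y}. plane_wave L n y) = complex_of_real (dispersion L n) * plane_wave L n x"
  unfolding sum_nn[OF assms] using assms(1)
  by (simp add: plane_wave_shift sum_dirs_wave flip: sum_distrib_left)

text \<open>Momenta from windows of \<open>L\<close> consecutive integers are distinct modulo
  \<open>L\<close>. The windows are movable so that one can be placed around a symmetric box of
  small momenta.\<close>

lemma plane_wave_orth:
  assumes "L > 0"
    and n: "n \<in> {a..<a + int L} \<times> {b..<b + int L}" "n' \<in> {a..<a + int L} \<times> {b..<b + int L}"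
  shows "(\<Sum>x\<in>Msites L. cnj (plane_wave L n x) * plane_wave L n' x) = (if n = n' then of_nat (L * L) else 0)"
proof -
  have "(\<Sum>x\<in>Msites L. cnj (plane_wave L n x) * plane_wave L n' x)
     = (\<Sum>x\<in>{..<L} \<times> {..<L}. wave L ((fst n' - fst n) * int (fst x)) * wave L ((snd n' - snd n) * int (snd x)))"
    unfolding Msites_def plane_wave_def cnj_wave wave_add[symmetric]
    by (intro sum.cong refl arg_cong[where f = "wave L"]) (simp add: algebra_simps)
  also have "\<dots> = (\<Sum>i<L. wave L ((fst n' - fst n) * int i)) * (\<Sum>j<L. wave L ((snd n' - snd n) * int j))"
    by (simp add: sum_product sum.cartesian_product case_prod_beta)
  also have "\<dots> = (if n = n' then of_nat (L * L) else 0)"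
  proof (cases "n = n'")
    case False
    have nd: "\<not> int L dvd m" if "m \<noteq> 0" "\<bar>m\<bar> < int L" for m
      using that dvd_imp_le_int[of m "int L"] by auto
    have "\<bar>fst n' - fst n\<bar> < int L" "\<bar>snd n' - snd n\<bar> < int L" using n by auto
    moreover have "fst n' - fst n \<noteq> 0 \<or> snd n' - snd n \<noteq> 0" using False by (auto simp: prod_eq_iff)
    ultimately have "\<not> int L dvd fst n' - fst n \<or> \<not> int L dvd snd n' - snd n" using nd by blast
    then show ?thesis using False sum_wave[OF assms(1)] by auto
  qed simp
  finally show ?thesis .
qed

text \<open>The trace of the hopping matrix: no direction vanishes modulo \<open>L\<close>, so for
  each one a character sum over a full period is zero.\<close>

lemma sum_dispersion:
  assumes "L \<ge> 3"
  shows "(\<Sum>n\<in>{a..<a + int L} \<times> {b..<b + int L}. dispersion L n) = 0"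
proof -
  let ?I = "{a..<a + int L}" and ?J = "{b..<b + int L}"
  have "complex_of_real (\<Sum>n\<in>?I \<times> ?J. dispersion L n) =
     (\<Sum>n\<in>?I \<times> ?J. \<Sum>d\<in>dirs. wave L (fst n * fst d) * wave L (snd n * snd d))"
    by (simp only: of_real_sum sum_dirs_wave[symmetric] wave_add)
  also have "\<dots> = (\<Sum>d\<in>dirs. (\<Sum>i\<in>?I. wave L (i * fst d)) * (\<Sum>j\<in>?J. wave L (j * snd d)))"
    by (subst sum.swap) (simp add: sum_product sum.cartesian_product case_prod_beta)
  also have "\<dots> = (\<Sum>d\<in>dirs. 0)"
  proof (rule sum.cong)
    fix d assume "d \<in> dirs"
    then have "\<not> int L dvd fst d \<or> \<not> int L dvd snd d" using assms by (auto simp: dirs_def)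
    then show "(\<Sum>i\<in>?I. wave L (i * fst d)) * (\<Sum>j\<in>?J. wave L (j * snd d)) = 0"
      using sum_wave_shifted assms by auto
  qed simp
  finally have "complex_of_real (\<Sum>n\<in>?I \<times> ?J. dispersion L n) = 0" by simp
  then show ?thesis by (simp only: of_real_eq_0_iff)
qed

section \<open>Choosing the momenta that stay empty\<close>

lemma exists_subset_below_average:
  fixes f :: "'a \<Rightarrow> real"
  assumes "finite S" "h \<le> card S"
  shows "\<exists>K\<subseteq>S. card K = h \<and> real (card S) * sum f K \<le> real h * sum f S"
  using assms
proof (induction "card S" arbitrary: S)
  case 0
  then show ?case by auto
next
  case (Suc c)
  show ?case
  proof (cases "h = card S")
    case True
    then show ?thesis by auto
  next
    case False
    have "S \<noteq> {}" using Suc.hyps(2) by auto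
    then have "Max (f ` S) \<in> f ` S" using Suc.prems by (intro Max_in) auto
    then obtain m where m: "m \<in> S" "f m = Max (f ` S)" by auto
    have mx: "f x \<le> f m" if "x \<in> S" for x using that m Suc.prems by auto
    have c: "card (S - {m}) = c" using Suc.hyps(2) m Suc.prems by simp
    then obtain K where K: "K \<subseteq> S - {m}" "card K = h" "real c * sum f K \<le> real h * sum f (S - {m})"
      using Suc.hyps(1)[of "S - {m}"] Suc.prems False Suc.hyps(2) by auto
    \<comment> \<open>The removed element has the largest value, and this pays for raising the
      factor on the left from \<open>c\<close> to \<open>c\<close> + 1.\<close>
    have "sum f K \<le> (\<Sum>x\<in>K. f m)" using K(1) mx by (intro sum_mono) auto
    then have "sum f K \<le> real h * f m" using K(2) by simp
    then have "real (card S) * sum f K \<le> real h * (sum f (S - {m}) + f m)"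
      using K(3) unfolding Suc.hyps(2)[symmetric] by (simp add: algebra_simps)
    also have "sum f (S - {m}) + f m = sum f S" using m Suc.prems by (simp add: sum.remove[of S m])
    finally show ?thesis using K by blast
  qed
qed

lemma symmetric_interval_Suc:
  "{- int (Suc r)..int (Suc r)} = insert (int (Suc r)) (insert (- int (Suc r)) {- int r..int r})"
  by auto

lemma sum_symmetric_interval:
  "(\<Sum>i\<in>{- int r..int r}. real_of_int i) = 0"
  "3 * (\<Sum>i\<in>{- int r..int r}. (real_of_int i)\<^sup>2) = real r * (real r + 1) * (2 * real r + 1)"
proof -
  show "(\<Sum>i\<in>{- int r..int r}. real_of_int i) = 0"
  proof (induction r)
    case (Suc r)
    then show ?case unfolding symmetric_interval_Suc by (subst sum.insert; simp)+
  qed simp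
  show "3 * (\<Sum>i\<in>{- int r..int r}. (real_of_int i)\<^sup>2) = real r * (real r + 1) * (2 * real r + 1)"
  proof (induction r)
    case (Suc r)
    have "(\<Sum>i\<in>{- int (Suc r)..int (Suc r)}. (real_of_int i)\<^sup>2) = 2 * (real r + 1)\<^sup>2 + (\<Sum>i\<in>{- int r..int r}. (real_of_int i)\<^sup>2)"
      unfolding symmetric_interval_Suc by (subst sum.insert; simp)+ (simp add: power2_eq_square algebra_simps)
    then show ?case using Suc by (simp add: power2_eq_square algebra_simps)
  qed simp
qed

lemma one_minus_cos_le: "1 - cos x \<le> x\<^sup>2 / 2" for x :: real
proof -
  have "cos x = 1 - 2 * (sin (x / 2))\<^sup>2" using cos_double_sin[of "x / 2"] by simp
  moreover have "(sin (x / 2))\<^sup>2 \<le> (x / 2)\<^sup>2" using abs_sin_x_le_abs_x[of "x / 2"] by (simp only: abs_le_square_iff)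
  ultimately show ?thesis by (simp add: power2_eq_square)
qed

text \<open>From pi / 4 = arctan (1/2) + arctan (1/3) <= 5/6; the bound enters through pi^2 <=
  100/9.\<close>

lemma pi_le_10_div_3: "pi \<le> 10 / 3"
proof -
  have "arctan (1 / 2) + arctan (1 / 3) = arctan 1" by (subst arctan_add) auto
  moreover have "arctan (1 / 2) \<le> 1 / 2" "arctan (1 / 3) \<le> 1 / 3" by (rule arctan_le_self; simp)+
  ultimately have "arctan 1 \<le> 5 / 6" by linarith
  then show ?thesis by (simp add: arctan_one)
qed

definition momentum_box :: "nat \<Rightarrow> (int \<times> int) set" where
  "momentum_box r = {- int r..int r} \<times> {- int r..int r}"

text \<open>The squares belong to the phases along the three lattice axes. Their mixed term sums to
  zero because the box is symmetric.\<close>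

lemma sum_box: "3 * (\<Sum>n\<in>momentum_box r. (real_of_int (fst n))\<^sup>2 + (real_of_int (snd n))\<^sup>2 + (real_of_int (fst n - snd n))\<^sup>2)
   = 4 * (2 * real r + 1)\<^sup>2 * (real r * (real r + 1))"
proof -
  let ?I = "{- int r..int r}"
  have c: "real (card ?I) = 2 * real r + 1" by simp
  have "(\<Sum>n\<in>momentum_box r. (real_of_int (fst n))\<^sup>2 + (real_of_int (snd n))\<^sup>2 + (real_of_int (fst n - snd n))\<^sup>2)
    = (\<Sum>i\<in>?I. \<Sum>j\<in>?I. 2 * (real_of_int i)\<^sup>2 + (2 * (real_of_int j)\<^sup>2 - 2 * (real_of_int i * real_of_int j)))"
    unfolding momentum_box_def sum.cartesian_product
    by (intro sum.cong refl) (auto simp: power2_eq_square algebra_simps)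
  also have "\<dots> = (\<Sum>i\<in>?I. real (card ?I) * (2 * (real_of_int i)\<^sup>2) + (2 * (\<Sum>j\<in>?I. (real_of_int j)\<^sup>2) - 2 * (real_of_int i * (\<Sum>j\<in>?I. real_of_int j))))"
    by (simp only: sum.distrib sum_subtractf sum_constant sum_distrib_left[symmetric])
  also have "\<dots> = 4 * (2 * real r + 1) * (\<Sum>i\<in>?I. (real_of_int i)\<^sup>2)"
    unfolding sum_symmetric_interval(1) mult_zero_right diff_zero sum.distrib sum_constant c sum_distrib_left[symmetric] by simp
  finally have "3 * (\<Sum>n\<in>momentum_box r. (real_of_int (fst n))\<^sup>2 + (real_of_int (snd n))\<^sup>2 + (real_of_int (fst n - snd n))\<^sup>2)
    = 4 * (2 * real r + 1) * (3 * (\<Sum>i\<in>?I. (real_of_int i)\<^sup>2))" by (simp only: mult_ac)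
  then show ?thesis unfolding sum_symmetric_interval(2) by (simp only: power2_eq_square mult_ac)
qed

text \<open>The h lowest momenta fit into a box; averaging over the box bounds their excitation energy.\<close>

lemma exists_momenta:
  assumes h: "3 \<le> h" and L: "2 * h \<le> L"
  shows "\<exists>r K. 2 * r + 1 \<le> L \<and> K \<subseteq> momentum_box r \<and> card K = h \<and> (\<Sum>n\<in>K. 6 - dispersion L n) < 12"
proof -
  \<comment> \<open>The smallest box with room for \<open>h\<close> momenta; minimality says that
    the box of radius \<open>q\<close> = r - 1 is too small, which bounds \<open>r\<close> in terms
    of \<open>h\<close>.\<close>
  define r where "r = (LEAST r. h \<le> (2 * r + 1)\<^sup>2)"
  have "h \<le> (2 * h + 1)\<^sup>2" by (simp add: power2_eq_square)
  then have hr: "h \<le> (2 * r + 1)\<^sup>2" unfolding r_def by (rule LeastI)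
  have "r \<noteq> 0" using hr h by (cases "r = 0") simp_all
  then obtain q where q: "r = Suc q" by (cases r) auto
  have hq: "(2 * q + 1)\<^sup>2 < h" using not_less_Least[of q "\<lambda>r. h \<le> (2 * r + 1)\<^sup>2"] q unfolding r_def by simp
  \<comment> \<open>For \<open>q\<close> = 0 this reads 200 < 81 h and needs h >= 3; otherwise it
    follows from h >= (2 q + 1)^2 + 1. The ratio 81/100 combines with pi^2 <= 100/9 to 9.\<close>
  have num: "100 * (real r * (real r + 1)) < 81 * real h"
  proof (cases "q = 0")
    case True
    then show ?thesis using h q by simp
  next
    case False
    then have q1: "real q \<ge> 1" by simp
    then have "real q * 1 \<le> real q * real q" by (intro mult_left_mono) auto
    moreover have "real ((2 * q + 1)\<^sup>2 + 1) \<le> real h" using hq by linarith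
    then have "4 * (real q * real q) + 4 * real q + 2 \<le> real h" by (simp add: power2_eq_square algebra_simps)
    ultimately have "100 * (real q * real q) + 300 * real q + 200 < 81 * real h" using q1 by linarith
    then show ?thesis by (simp add: q algebra_simps)
  qed
  \<comment> \<open>The box must fit into a period: (2 q + 1)^2 + 3 < h + 3 <= 2 h <= L.\<close>
  have "2 * r + 1 \<le> (2 * q + 1)\<^sup>2 + 3" by (simp add: q power2_eq_square)
  then have rL: "2 * r + 1 \<le> L" using hq h L by linarith
  have "card {- int r..int r} = 2 * r + 1" unfolding card_atLeastAtMost_int by arith
  then have cb: "card (momentum_box r) = (2 * r + 1)\<^sup>2"
    by (simp only: momentum_box_def card_cartesian_product power2_eq_square)
  define Q where "Q n = (real_of_int (fst n))\<^sup>2 + (real_of_int (snd n))\<^sup>2 + (real_of_int (fst n - snd n))\<^sup>2" for n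
  obtain K where K: "K \<subseteq> momentum_box r" "card K = h" "real (card (momentum_box r)) * sum Q K \<le> real h * sum Q (momentum_box r)"
    using exists_subset_below_average[of "momentum_box r" h Q] hr cb by (auto simp: momentum_box_def)
  have "(2 * real r + 1)\<^sup>2 * (3 * sum Q K) \<le> real h * (3 * sum Q (momentum_box r))" using K(3) by (simp add: cb add.commute)
  also have "\<dots> = (2 * real r + 1)\<^sup>2 * (4 * real h * (real r * (real r + 1)))"
    unfolding Q_def sum_box by simp
  finally have QK: "3 * sum Q K \<le> 4 * real h * (real r * (real r + 1))"
    by (rule mult_left_le_imp_le) simp
  \<comment> \<open>Each cosine is replaced by its quadratic bound; opposite directions contribute
    equally, which absorbs the factor 1/2.\<close>
  have disp: "6 - dispersion L n \<le> (2 * pi / real L)\<^sup>2 * Q n" for n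
  proof -
    have "6 - dispersion L n = (\<Sum>d\<in>dirs. 1 - cos (2 * pi * real_of_int (fst n * fst d + snd n * snd d) / real L))"
      unfolding dispersion_def sum_subtractf by (simp add: card_dirs)
    also have "\<dots> \<le> (\<Sum>d\<in>dirs. (2 * pi * real_of_int (fst n * fst d + snd n * snd d) / real L)\<^sup>2 / 2)"
      by (intro sum_mono one_minus_cos_le)
    also have "\<dots> = (\<Sum>d\<in>dirs. (2 * pi / real L)\<^sup>2 * ((real_of_int (fst n * fst d + snd n * snd d))\<^sup>2 / 2))"
      by (intro sum.cong refl) (simp add: power_mult_distrib power_divide)
    also have "\<dots> = (2 * pi / real L)\<^sup>2 * (\<Sum>d\<in>dirs. (real_of_int (fst n * fst d + snd n * snd d))\<^sup>2 / 2)"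
      by (simp only: sum_distrib_left)
    also have "(\<Sum>d\<in>dirs. (real_of_int (fst n * fst d + snd n * snd d))\<^sup>2 / 2) = Q n"
      by (simp add: dirs_def Q_def power2_eq_square algebra_simps)
    finally show ?thesis .
  qed
  have L0: "real L > 0" and h0: "real h > 0" using L h by auto
  have "pi\<^sup>2 \<le> (10 / 3)\<^sup>2" using pi_le_10_div_3 by (intro power_mono) auto
  then have p2: "9 * pi\<^sup>2 \<le> 100" by (simp add: power2_eq_square)
  have "3 * ((2 * pi)\<^sup>2 * sum Q K) \<le> (2 * pi)\<^sup>2 * (4 * real h * (real r * (real r + 1)))"
    using mult_left_mono[OF QK, of "(2 * pi)\<^sup>2"] by simp
  also have "\<dots> = 16 * real h * (pi\<^sup>2 * (real r * (real r + 1)))" by (simp add: power_mult_distrib)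
  \<comment> \<open>The factor 9 makes the right-hand side 144 h^2 = 36 (2 h)^2, so that 2 h <= L
    gives 36 L^2, three times the desired 12 L^2.\<close>
  also have "\<dots> < 16 * real h * (9 * real h)"
  proof -
    have "9 * pi\<^sup>2 * (real r * (real r + 1)) \<le> 100 * (real r * (real r + 1))"
      using p2 by (intro mult_right_mono) auto
    then have "pi\<^sup>2 * (real r * (real r + 1)) < 9 * real h" using num by linarith
    then show ?thesis using h0 by (intro mult_strict_left_mono) auto
  qed
  also have "\<dots> = 36 * (2 * real h)\<^sup>2" by (simp add: power2_eq_square)
  also have "\<dots> \<le> 36 * (real L)\<^sup>2" using L by (intro mult_left_mono power_mono) auto
  finally have "(2 * pi)\<^sup>2 * sum Q K < 12 * (real L)\<^sup>2" by simp
  then have lt: "(2 * pi / real L)\<^sup>2 * sum Q K < 12" using L0 by (simp add: power_divide field_simps)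
  have "(\<Sum>n\<in>K. 6 - dispersion L n) \<le> (\<Sum>n\<in>K. (2 * pi / real L)\<^sup>2 * Q n)" by (intro sum_mono disp)
  also have "\<dots> < 12" using lt by (simp add: sum_distrib_left)
  finally show ?thesis using rL K by blast
qed

context bonds
begin

text \<open>All dispersions add up to zero, so filling the momenta outside \<open>K\<close> costs
  minus the dispersion of \<open>K\<close>: an energy -6 per hole plus the excitation energies of
  the holes.\<close>

lemma exists_plane_wave_state:
  fixes a :: int
  assumes K: "K \<subseteq> {a..<a + int L} \<times> {a..<a + int L}" and h: "card K < L * L"
  shows "\<exists>\<Psi>. nstate L B (L * L - card K) \<Psi> \<and> inner_st L B \<Psi> \<Psi> = 1 \<and> ker_b \<mu> \<Psi> \<and> no_double \<Psi> \<and>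
     Re (hop_form \<mu> \<Psi> \<Psi>) = (\<Sum>n\<in>K. 6 - dispersion L n) - 6 * real (card K)"
proof -
  define I where "I = {a..<a + int L} \<times> {a..<a + int L}"
  have fI: "finite I" and cI: "card I = L * L" by (simp_all add: I_def card_cartesian_product)
  have KI: "K \<subseteq> I" using K by (simp add: I_def)
  have fK: "finite K" using KI fI finite_subset by blast
  obtain ks where ks: "set ks = I - K" "distinct ks" using finite_distinct_list[of "I - K"] fI by auto
  have len: "length ks = L * L - card K" using ks distinct_card[of ks] KI fK cI by (simp add: card_Diff_subset)
  then have ne: "ks \<noteq> []" using h by auto
  have "sum_list (map (dispersion L) ks) = (\<Sum>n\<in>I - K. dispersion L n)"
    using ks sum_list_distinct_conv_sum_set[of ks "dispersion L"] by simp
  also have "\<dots> = (\<Sum>n\<in>I. dispersion L n) - (\<Sum>n\<in>K. dispersion L n)"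
    by (rule sum_diff[OF fI KI])
  also have "\<dots> = (\<Sum>n\<in>K. 6 - dispersion L n) - 6 * real (card K)"
    using sum_dispersion[OF L3, of a a] by (simp add: I_def sum_subtractf)
  finally have e: "sum_list (map (dispersion L) ks) = (\<Sum>n\<in>K. 6 - dispersion L n) - 6 * real (card K)" .
  have "\<exists>\<Psi>. nstate L B (length ks) \<Psi> \<and> inner_st L B \<Psi> \<Psi> = 1 \<and> ker_b \<mu> \<Psi> \<and> no_double \<Psi> \<and>
     Re (hop_form \<mu> \<Psi> \<Psi>) = sum_list (map (dispersion L) ks)"
  proof (rule exists_slater_state[OF ks(2) ne])
    show "(\<Sum>y\<in>{y. nn L x y}. plane_wave L k y) = complex_of_real (dispersion L k) * plane_wave L k x"
      if "x \<in> Msites L" for k x by (rule plane_wave_eigen[OF L3 that])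
    show "(\<Sum>x\<in>Msites L. cnj (plane_wave L k x) * plane_wave L k' x) = (if k = k' then of_nat (L * L) else 0)"
      if "k \<in> set ks" "k' \<in> set ks" for k k'
      using that L3 ks(1) by (intro plane_wave_orth[of L k a a]) (auto simp: I_def)
    show "complex_of_nat (L * L) \<noteq> 0" using L3 by simp
  qed
  then show ?thesis using e len by auto
qed

end

section \<open>Ground states\<close>

context bonds
begin

lemma nstate_outside: "nstate L B N \<Phi> \<Longrightarrow> \<not> A \<subseteq> LM \<Longrightarrow> \<Phi> A = 0"
  unfolding nstate_def by blast

lemma ker_b_b_energy:
  assumes "ker_b \<mu> \<Phi>"
  shows "b_energy \<mu> \<Phi> = 0"
proof -
  have "b_u \<mu> (fst p) (snd p) \<sigma> \<Phi> = (\<lambda>_. 0)" "b_ub \<mu> (fst p) (snd p) \<sigma> \<Phi> = (\<lambda>_. 0)" if "p \<in> B" for p \<sigma>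
    using assms that unfolding ker_b_iff by (metis prod.collapse)+
  then show ?thesis
    unfolding b_energy_def case_prod_beta by (intro sum.neutral ballI) (simp only: ip_lin, simp)
qed

lemma no_double_double_occ: "no_double \<Phi> \<Longrightarrow> double_occ \<Phi> = 0"
  unfolding double_occ_def using no_doubleD[of \<Phi> _ True] by (intro sum.neutral ballI) simp

lemma double_occ_no_double:
  assumes "nstate L B N \<Phi>" "double_occ \<Phi> = 0"
  shows "no_double \<Phi>"
proof (rule no_doubleI)
  fix z A assume z: "z \<in> Lambda L B" and A: "(z, True) \<in> A" "(z, False) \<in> A"
  show "\<Phi> A = 0"
  proof (cases "A \<subseteq> LM")
    case True
    have "(\<Sum>A\<in>Pow LM. if (z, True) \<in> A \<and> (z, False) \<in> A then (norm (\<Phi> A))\<^sup>2 else 0) = 0"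
      using assms(2) z unfolding double_occ_def
      by (subst (asm) sum_nonneg_eq_0_iff) (auto intro!: sum_nonneg simp del: split_paired_All split_paired_Ex)
    then have "(if (z, True) \<in> A \<and> (z, False) \<in> A then (norm (\<Phi> A))\<^sup>2 else 0) = 0"
      using True by (subst (asm) sum_nonneg_eq_0_iff) auto
    then show ?thesis using A by simp
  qed (rule nstate_outside[OF assms(1)])
qed

lemma b_energy_ker_b:
  assumes n: "nstate L B N \<Phi>" and "b_energy \<mu> \<Phi> = 0"
  shows "ker_b \<mu> \<Phi>"
  unfolding ker_b_iff
proof (intro allI impI)
  fix x y \<sigma> assume b: "(x, y) \<in> B"
  let ?u = "\<lambda>p \<sigma>. Re (ip LM (b_u \<mu> (fst p) (snd p) \<sigma> \<Phi>) (b_u \<mu> (fst p) (snd p) \<sigma> \<Phi>))"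
  let ?v = "\<lambda>p \<sigma>. Re (ip LM (b_ub \<mu> (fst p) (snd p) \<sigma> \<Phi>) (b_ub \<mu> (fst p) (snd p) \<sigma> \<Phi>))"
  have nonneg: "0 \<le> ?u p \<sigma> + ?v p \<sigma>" for p \<sigma> by (intro add_nonneg_nonneg Re_ip_self_nonneg)
  have "(\<Sum>p\<in>B. \<Sum>\<sigma>\<in>UNIV. ?u p \<sigma> + ?v p \<sigma>) = 0"
    using assms(2) unfolding b_energy_def case_prod_beta .
  then have "\<forall>p\<in>B. (\<Sum>\<sigma>\<in>UNIV. ?u p \<sigma> + ?v p \<sigma>) = 0"
    by (rule sum_nonneg_eq_0_iff[OF finite_B, THEN iffD1, rotated]) (intro sum_nonneg nonneg)
  then have "(\<Sum>\<sigma>\<in>UNIV. ?u (x, y) \<sigma> + ?v (x, y) \<sigma>) = 0" using b by blast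
  then have "\<forall>\<sigma>\<in>UNIV. ?u (x, y) \<sigma> + ?v (x, y) \<sigma> = 0"
    by (rule sum_nonneg_eq_0_iff[OF finite, THEN iffD1, rotated]) (rule nonneg)
  then have "?u (x, y) \<sigma> + ?v (x, y) \<sigma> = 0" by blast
  moreover have "?u (x, y) \<sigma> \<ge> 0" "?v (x, y) \<sigma> \<ge> 0" by (rule Re_ip_self_nonneg)+
  ultimately have "?u (x, y) \<sigma> = 0" "?v (x, y) \<sigma> = 0" by linarith+
  then have z: "\<forall>A\<subseteq>LM. b_u \<mu> x y \<sigma> \<Phi> A = 0" "\<forall>A\<subseteq>LM. b_ub \<mu> x y \<sigma> \<Phi> A = 0"
    using Re_ip_self_eq_0_iff[of LM] by simp_all
  \<comment> \<open>The squared norms only see configurations inside \<open>LM\<close>; outside,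
    both b-operators give zero because the state is supported on \<open>LM\<close>.\<close>
  have o: "ann j \<Phi> A = 0" if "\<not> A \<subseteq> LM" for j A
    using nstate_outside[OF n, of "insert j A"] that by (simp add: ann_def)
  have "b_u \<mu> x y \<sigma> \<Phi> A = 0 \<and> b_ub \<mu> x y \<sigma> \<Phi> A = 0" for A
  proof (cases "A \<subseteq> LM")
    case False
    then show ?thesis by (simp add: b_u_def b_ub_def o)
  qed (use z in simp)
  then show "b_u \<mu> x y \<sigma> \<Phi> = (\<lambda>_. 0) \<and> b_ub \<mu> x y \<sigma> \<Phi> = (\<lambda>_. 0)"
    by (simp add: fun_eq_iff)
qed

section \<open>The linear space of finite-energy states and its variational principle\<close>

definition low :: "real \<Rightarrow> nat \<Rightarrow> state \<Rightarrow> bool" where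
  "low \<mu> N \<Phi> \<longleftrightarrow> nstate L B N \<Phi> \<and> ker_b \<mu> \<Phi> \<and> no_double \<Phi>"

lemma lowD: "low \<mu> N \<Phi> \<Longrightarrow> nstate L B N \<Phi>" "low \<mu> N \<Phi> \<Longrightarrow> ker_b \<mu> \<Phi>" "low \<mu> N \<Phi> \<Longrightarrow> no_double \<Phi>"
  "low \<mu> N \<Phi> \<Longrightarrow> fin_supp \<Phi>"
  using nstate_fin_supp by (auto simp: low_def)

lemma low_lin:
  "low \<mu> N f \<Longrightarrow> low \<mu> N g \<Longrightarrow> low \<mu> N (\<lambda>A. f A + g A)"
  "low \<mu> N f \<Longrightarrow> low \<mu> N (\<lambda>A. c * f A)"
  by (simp_all add: low_def nstate_lin ker_b_lin no_double_lin)

lemma low_spin_op: "low \<mu> N \<Phi> \<Longrightarrow> low \<mu> N (spin_op m \<Phi>)"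
  using lowD[of \<mu> N \<Phi>] unfolding low_def
  by (intro conjI nstate_spin_op ker_b_spin_op no_double_spin_op)

lemma lim_energy_low: "low \<mu> N \<Phi> \<Longrightarrow> lim_energy L B t \<mu> \<Phi> = ereal (t * Re (hop_form \<mu> \<Phi> \<Phi>))"
  using lowD[of \<mu> N \<Phi>] by (intro lim_energy_finite ker_b_b_energy no_double_double_occ)

lemma low_if_lim_energy_finite:
  assumes "nstate L B N \<Phi>" "lim_energy L B t \<mu> \<Phi> \<noteq> \<infinity>"
  shows "low \<mu> N \<Phi>"
  using lim_energy_PInfty[of \<mu> \<Phi> t] b_energy_ker_b double_occ_no_double assms unfolding low_def by blast

lemma hop_form_lin:
  assumes "ker_b \<mu> \<Phi>" "ker_b \<mu> f" "ker_b \<mu> g"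
  shows "hop_form \<mu> \<Phi> (\<lambda>A. f A + g A) = hop_form \<mu> \<Phi> f + hop_form \<mu> \<Phi> g"
    "hop_form \<mu> \<Phi> (\<lambda>A. c * f A) = c * hop_form \<mu> \<Phi> f"
    "hop_form \<mu> (\<lambda>A. f A + g A) \<Phi> = hop_form \<mu> f \<Phi> + hop_form \<mu> g \<Phi>"
    "hop_form \<mu> (\<lambda>A. c * f A) \<Phi> = cnj c * hop_form \<mu> f \<Phi>"
proof -
  note k = ker_b_lin(1)[OF assms(2,3)] ker_b_lin(3)[OF assms(2), of c]
  show "hop_form \<mu> \<Phi> (\<lambda>A. f A + g A) = hop_form \<mu> \<Phi> f + hop_form \<mu> \<Phi> g"
    unfolding hop_form_ker_b[OF assms(1) k(1)] hop_form_ker_b[OF assms(1,2)] hop_form_ker_b[OF assms(1,3)]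
    unfolding case_prod_beta by (simp only: ann_lin ip_lin sum.distrib distrib_left)
  show "hop_form \<mu> (\<lambda>A. f A + g A) \<Phi> = hop_form \<mu> f \<Phi> + hop_form \<mu> g \<Phi>"
    unfolding hop_form_ker_b[OF k(1) assms(1)] hop_form_ker_b[OF assms(2,1)] hop_form_ker_b[OF assms(3,1)]
    unfolding case_prod_beta by (simp only: ann_lin ip_lin sum.distrib distrib_left)
  show "hop_form \<mu> \<Phi> (\<lambda>A. c * f A) = c * hop_form \<mu> \<Phi> f"
    unfolding hop_form_ker_b[OF assms(1) k(2)] hop_form_ker_b[OF assms(1,2)]
    unfolding case_prod_beta by (simp only: ann_lin ip_lin sum_distrib_left[symmetric] mult.left_commute)
  show "hop_form \<mu> (\<lambda>A. c * f A) \<Phi> = cnj c * hop_form \<mu> f \<Phi>"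
    unfolding hop_form_ker_b[OF k(2) assms(1)] hop_form_ker_b[OF assms(2,1)]
    unfolding case_prod_beta by (simp only: ann_lin ip_lin sum_distrib_left[symmetric] mult.left_commute)
qed

definition energy_form :: "real \<Rightarrow> real \<Rightarrow> state \<Rightarrow> state \<Rightarrow> complex" where
  "energy_form \<mu> e \<Phi> \<Psi> = hop_form \<mu> \<Phi> \<Psi> - complex_of_real e * ip LM \<Phi> \<Psi>"

lemma energy_form_add:
  assumes "low \<mu> N \<Phi>" "low \<mu> N f" "low \<mu> N g"
  shows "energy_form \<mu> e \<Phi> (\<lambda>A. f A + g A) = energy_form \<mu> e \<Phi> f + energy_form \<mu> e \<Phi> g"
    "energy_form \<mu> e (\<lambda>A. f A + g A) \<Phi> = energy_form \<mu> e f \<Phi> + energy_form \<mu> e g \<Phi>"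
  unfolding energy_form_def hop_form_lin[OF lowD(2)[OF assms(1)] lowD(2)[OF assms(2)] lowD(2)[OF assms(3)]] ip_lin
  by (simp_all add: algebra_simps)

lemma energy_form_scale:
  assumes "low \<mu> N \<Phi>" "low \<mu> N f"
  shows "energy_form \<mu> e \<Phi> (\<lambda>A. c * f A) = c * energy_form \<mu> e \<Phi> f"
    "energy_form \<mu> e (\<lambda>A. c * f A) \<Phi> = cnj c * energy_form \<mu> e f \<Phi>"
  unfolding energy_form_def hop_form_lin[OF lowD(2)[OF assms(1)] lowD(2)[OF assms(2)] lowD(2)[OF assms(2)]] ip_lin
  by (simp_all add: algebra_simps)

lemma energy_form_spin_op:
  assumes "\<And>s s'. cnj (m s s') = m s' s" "low \<mu> N \<Phi>" "low \<mu> N \<Psi>"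
  shows "energy_form \<mu> e \<Phi> (spin_op m \<Psi>) = energy_form \<mu> e (spin_op m \<Phi>) \<Psi>"
  unfolding energy_form_def using lowD[OF assms(2)] lowD[OF assms(3)]
  by (simp add: hop_form_spin_op[OF assms(1)] ip_spin_op[OF assms(1)])

text \<open>Half the first Pauli matrix, with \<open>True\<close> for up; the next two definitions
  are the halves of the other two.\<close>

definition spin_half1 :: "bool \<Rightarrow> bool \<Rightarrow> complex" where
  "spin_half1 s s' = (if s = s' then 0 else 1 / 2)"
definition spin_half2 :: "bool \<Rightarrow> bool \<Rightarrow> complex" where
  "spin_half2 s s' = (if s = s' then 0 else if s then 1 / (2 * \<i>) else - 1 / (2 * \<i>))"
definition spin_half3 :: "bool \<Rightarrow> bool \<Rightarrow> complex" where
  "spin_half3 s s' = (if s = s' then if s then 1 / 2 else - 1 / 2 else 0)"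

lemma spin_half_hermitian:
  "cnj (spin_half1 s s') = spin_half1 s' s" "cnj (spin_half2 s s') = spin_half2 s' s" "cnj (spin_half3 s s') = spin_half3 s' s"
  by (auto simp: spin_half1_def spin_half2_def spin_half3_def)

lemma Stot_spin_op:
  "Stot1 L B = spin_op spin_half1" "Stot2 L B = spin_op spin_half2" "Stot3 L B = spin_op spin_half3"
  by (auto simp: fun_eq_iff Stot1_def Stot2_def Stot3_def spin_op_def spin_half1_def spin_half2_def spin_half3_def
      UNIV_bool Splus_def Sminus_def numop_def field_simps intro!: sum.cong)

definition casimir :: "real \<Rightarrow> state \<Rightarrow> state" where
  "casimir c \<Phi> = (\<lambda>A. Stot_sq L B \<Phi> A + complex_of_real (- c) * \<Phi> A)"

lemma low_casimir: "low \<mu> N \<Phi> \<Longrightarrow> low \<mu> N (casimir c \<Phi>)"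
  unfolding casimir_def Stot_sq_def Stot_spin_op by (intro low_lin low_spin_op)

text \<open>Each spin component is symmetric for the form and preserves \<open>low\<close>, so its
  square is symmetric too; the subtracted constant is real.\<close>

lemma energy_form_casimir:
  assumes \<Phi>: "low \<mu> N \<Phi>" and \<Psi>: "low \<mu> N \<Psi>"
  shows "energy_form \<mu> e \<Phi> (casimir c \<Psi>) = energy_form \<mu> e (casimir c \<Phi>) \<Psi>"
proof -
  have s: "energy_form \<mu> e \<Phi> (spin_op m (spin_op m \<Psi>)) = energy_form \<mu> e (spin_op m (spin_op m \<Phi>)) \<Psi>"
    if "\<And>s s'. cnj (m s s') = m s' s" for m
    using energy_form_spin_op[OF that \<Phi> low_spin_op[OF \<Psi>]] energy_form_spin_op[OF that low_spin_op[OF \<Phi>] \<Psi>] by simp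
  note l = low_spin_op[OF low_spin_op[OF \<Phi>]] low_spin_op[OF low_spin_op[OF \<Psi>]] low_lin(1) low_lin(2) \<Phi> \<Psi>
  define d where "d = complex_of_real (- c)"
  have d: "cnj d = d" by (simp add: d_def)
  show ?thesis
    unfolding casimir_def Stot_sq_def Stot_spin_op d_def[symmetric]
    by (simp add: energy_form_add[where N = N] energy_form_scale[where N = N] d l s[OF spin_half_hermitian(1)] s[OF spin_half_hermitian(2)] s[OF spin_half_hermitian(3)])
qed

text \<open>First-order condition at a minimum: along the line from \<open>\<Phi>\<close> in the
  direction \<open>\<Psi>\<close> the form is x p + x^2 q, which is nonnegative for all real x only
  if p = 0.\<close>

lemma energy_form_min:
  assumes \<Phi>: "low \<mu> N \<Phi>" and \<Psi>: "low \<mu> N \<Psi>"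
    and nonneg: "\<And>\<Xi>. low \<mu> N \<Xi> \<Longrightarrow> 0 \<le> Re (energy_form \<mu> e \<Xi> \<Xi>)"
    and zero: "Re (energy_form \<mu> e \<Phi> \<Phi>) = 0"
  shows "Re (energy_form \<mu> e \<Phi> \<Psi> + energy_form \<mu> e \<Psi> \<Phi>) = 0"
proof -
  define p where "p = Re (energy_form \<mu> e \<Phi> \<Psi> + energy_form \<mu> e \<Psi> \<Phi>)"
  define q where "q = Re (energy_form \<mu> e \<Psi> \<Psi>)"
  have *: "0 \<le> x * p + x * x * q" for x :: real
  proof -
    have x: "low \<mu> N (\<lambda>A. complex_of_real x * \<Psi> A)" by (rule low_lin(2)[OF \<Psi>])
    have "0 \<le> Re (energy_form \<mu> e (\<lambda>A. \<Phi> A + complex_of_real x * \<Psi> A) (\<lambda>A. \<Phi> A + complex_of_real x * \<Psi> A))"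
      by (intro nonneg low_lin \<Phi> \<Psi>)
    also have "\<dots> = x * p + x * x * q"
      using zero by (simp add: energy_form_add[where N = N] energy_form_scale[where N = N] low_lin \<Phi> \<Psi> x p_def q_def algebra_simps)
    finally show ?thesis .
  qed
  have "p = 0"
  proof (rule ccontr)
    assume "p \<noteq> 0"
    have q: "q \<ge> 0" unfolding q_def by (rule nonneg[OF \<Psi>])
    \<comment> \<open>At x = -y the polynomial equals -y^2; the added 1 keeps the denominator
      positive when \<open>q\<close> is zero.\<close>
    define y where "y = p / (q + 1)"
    have p: "p = y * (q + 1)" using q by (simp add: y_def)
    have "0 \<le> - (y * y)" using *[of "- y"] by (simp add: p algebra_simps)
    moreover have "y \<noteq> 0" using \<open>p \<noteq> 0\<close> p by auto
    ultimately show False by (auto simp: mult_le_0_iff)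
  qed
  then show ?thesis by (simp add: p_def)
qed

lemma card_holes:
  assumes "single A"
  shows "card {x \<in> Msites L. msite x \<notin> fst ` A} = L * L - card A"
proof -
  have "inj_on fst A"
  proof (rule inj_onI)
    fix m m' assume m: "m \<in> A" "m' \<in> A" "fst m = fst m'"
    show "m = m'"
    proof (rule ccontr)
      assume "m \<noteq> m'"
      then have "snd m' = (\<not> snd m)" using m(3) by (auto simp: prod_eq_iff)
      then have "m' = (fst m, \<not> snd m)" using m(3) by (simp add: prod_eq_iff)
      then have "(fst m, \<not> snd m) \<in> A" using m(2) by simp
      then show False using singleD[OF assms, of "fst m" "snd m"] m(1) by simp
    qed
  qed
  then have cA: "card (fst ` A) = card A" by (rule card_image)
  have "X = f ` {x \<in> M. f x \<in> X}" if "X \<subseteq> f ` M" for X :: "site set" and f and M :: "pt set"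
    using that by blast
  from this[OF single_sites[OF assms]]
  have "fst ` A = msite ` {x \<in> Msites L. msite x \<in> fst ` A}" .
  then have "card (fst ` A) = card {x \<in> Msites L. msite x \<in> fst ` A}"
    using card_image[OF inj_msite, of "{x \<in> Msites L. msite x \<in> fst ` A}"] by (simp only:)
  moreover have "{x \<in> Msites L. msite x \<notin> fst ` A} = Msites L - {x \<in> Msites L. msite x \<in> fst ` A}" by blast
  ultimately show ?thesis using cA by (simp add: card_Diff_subset card_Msites)
qed

text \<open>If all exchanges left the coefficient of \<open>A\<close> invariant, the total spin
  would be maximal there and the Casimir difference would vanish. A surviving configuration thus
  violates an exchange, so its holes contain the adjacent pairs.\<close>

lemma casimir_moves:
  assumes \<Phi>: "low \<mu> N \<Phi>" and "\<mu> \<noteq> 0" and A: "A \<subseteq> MM"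
    and ne: "casimir (real N / 2 * (real N / 2 + 1)) \<Phi> A \<noteq> 0"
    and h: "L * L - N < L"
  shows "card (moves A) + 12 \<le> 6 * (L * L - N) \<and> 3 \<le> L * L - N"
proof -
  have s: "single A"
    using no_double_single[OF lowD(3)[OF low_casimir[OF \<Phi>]] A ne] .
  have cA: "card A = N"
    using lowD(1)[OF low_casimir[OF \<Phi>]] ne unfolding nstate_def by blast
  have "\<exists>z w. z \<in> fst ` A \<and> w \<in> fst ` A \<and> \<Phi> (swap_sites z w A) \<noteq> \<Phi> A"
  proof (rule ccontr)
    assume "\<not> ?thesis"
    then have "Stot_sq L B \<Phi> A = of_real (real (card A) / 2 * (real (card A) / 2 + 1)) * \<Phi> A"
      using Stot_sq_if_symmetric[OF s] by blast
    then show False using ne by (simp add: casimir_def cA)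
  qed
  then obtain z w where zw: "z \<in> fst ` A" "w \<in> fst ` A" "\<Phi> (swap_sites z w A) \<noteq> \<Phi> A" by blast
  define H where "H = {x \<in> Msites L. msite x \<notin> fst ` A}"
  have cH: "card H = L * L - N" unfolding H_def using card_holes[OF s] cA by simp
  have fH: "finite H" by (simp add: H_def)
  have "2 \<le> card {y \<in> H. shift L y d \<in> H}" if "d \<in> dirs" for d
    using hole_pairs_if_not_symmetric[OF lowD(2)[OF \<Phi>] lowD(4)[OF \<Phi>] lowD(3)[OF \<Phi>] \<open>\<mu> \<noteq> 0\<close> s zw H_def _ that] cH h by simp
  then show ?thesis using card_moves_le[OF H_def] card_holes_ge_3[OF fH] cH by simp
qed

lemma casimir_ground_state:
  assumes "t > 0" "\<mu> > 0" and N: "N \<le> L * L" "2 * (L * L - N) \<le> L" and gs: "ground_state L B t \<mu> N \<Phi>"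
  shows "casimir (real N / 2 * (real N / 2 + 1)) \<Phi> = (\<lambda>_. 0)"
proof -
  define h where "h = L * L - N"
  have hN: "N = L * L - h" using N by (simp add: h_def)
  have hL: "h < L" using N(2) L3 unfolding h_def by linarith
  also have LL: "L \<le> L * L" by (rule le_square)
  finally have hLL: "h < L * L" .
  have N0: "N > 0" using hLL by (simp add: hN)
  \<comment> \<open>The polarized determinant has \<open>K\<close> as its set of empty momenta, so
    any \<open>h\<close> momenta bound the ground state energy from above.\<close>
  have trial: "lim_energy L B t \<mu> \<Phi> \<le> ereal (t * ((\<Sum>n\<in>K. 6 - dispersion L n) - 6 * real h))"
    if K: "K \<subseteq> {a..<a + int L} \<times> {a..<a + int L}" "card K = h" for K a
  proof -
    obtain \<Psi> where "nstate L B N \<Psi>" "inner_st L B \<Psi> \<Psi> = 1" "ker_b \<mu> \<Psi>" "no_double \<Psi>"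
      "Re (hop_form \<mu> \<Psi> \<Psi>) = (\<Sum>n\<in>K. 6 - dispersion L n) - 6 * real h"
      using exists_plane_wave_state[OF K(1), of \<mu>] hLL unfolding K(2) hN by blast
    then show ?thesis
      using gs lim_energy_low[of \<mu> N \<Psi> t] unfolding ground_state_def low_def by metis
  qed
  have nPhi: "nstate L B N \<Phi>" and norm1: "ip LM \<Phi> \<Phi> = 1"
    using gs unfolding ground_state_def inner_st_ip by auto
  \<comment> \<open>At this point any \<open>h\<close> momenta do, since a finite upper bound
    already puts \<open>\<Phi>\<close> into \<open>low\<close>.\<close>
  obtain K where "K \<subseteq> {0..<0 + int L} \<times> {0..<0 + int L}" "card K = h"
    using obtain_subset_with_card_n[of h "{0..<0 + int L} \<times> {0..<0 + int L}"] hLL by (auto simp: card_cartesian_product)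
  from trial[OF this] have "lim_energy L B t \<mu> \<Phi> \<noteq> \<infinity>" by auto
  then have \<Phi>: "low \<mu> N \<Phi>" by (rule low_if_lim_energy_finite[OF nPhi])
  define e where "e = Re (hop_form \<mu> \<Phi> \<Phi>)"
  have le: "lim_energy L B t \<mu> \<Phi> = ereal (t * e)" using lim_energy_low[OF \<Phi>] by (simp add: e_def)
  \<comment> \<open>The ground state property speaks of normalized states; rescaling extends it to
    all of \<open>low\<close>.\<close>
  have nonneg: "0 \<le> Re (energy_form \<mu> e \<Xi> \<Xi>)" if \<Xi>: "low \<mu> N \<Xi>" for \<Xi>
  proof (cases "Re (ip LM \<Xi> \<Xi>) = 0")
    case True
    then have "\<forall>A\<subseteq>LM. \<Xi> A = 0" using Re_ip_self_eq_0_iff[of LM \<Xi>] by simp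
    then have "\<Xi> = (\<lambda>_. 0)" using nstate_outside[OF lowD(1)[OF \<Xi>]] by blast
    then show ?thesis using energy_form_scale(1)[OF \<Xi> \<Xi>, of e 0] by simp
  next
    case False
    define r where "r = Re (ip LM \<Xi> \<Xi>)"
    have r: "ip LM \<Xi> \<Xi> = complex_of_real r" "r > 0"
      using False Re_ip_self_nonneg[of LM \<Xi>] by (simp_all add: r_def ip_self)
    define c where "c = complex_of_real (1 / sqrt r)"
    have cc: "cnj c * c = complex_of_real (1 / r)"
      using r(2) by (simp add: c_def flip: of_real_mult)
    have low: "low \<mu> N (\<lambda>A. c * \<Xi> A)" by (rule low_lin(2)[OF \<Xi>])
    have "inner_st L B (\<lambda>A. c * \<Xi> A) (\<lambda>A. c * \<Xi> A) = (cnj c * c) * complex_of_real r"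
      unfolding inner_st_ip ip_lin r(1) by (simp only: mult_ac)
    also have "\<dots> = 1" unfolding cc using r(2) by (simp flip: of_real_mult)
    finally have "lim_energy L B t \<mu> \<Phi> \<le> lim_energy L B t \<mu> (\<lambda>A. c * \<Xi> A)"
      using gs lowD(1)[OF low] unfolding ground_state_def by blast
    then have "e \<le> Re (hop_form \<mu> (\<lambda>A. c * \<Xi> A) (\<lambda>A. c * \<Xi> A))"
      unfolding le lim_energy_low[OF low] using \<open>t > 0\<close> by simp
    also have "hop_form \<mu> (\<lambda>A. c * \<Xi> A) (\<lambda>A. c * \<Xi> A) = (cnj c * c) * hop_form \<mu> \<Xi> \<Xi>"
      using lowD(2)[OF \<Xi>] lowD(2)[OF low] by (simp add: hop_form_lin)
    also have "Re \<dots> = Re (hop_form \<mu> \<Xi> \<Xi>) / r" unfolding cc by simp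
    finally have "e * r \<le> Re (hop_form \<mu> \<Xi> \<Xi>)" using r(2) by (simp add: field_simps)
    then show ?thesis by (simp add: energy_form_def r(1))
  qed
  have zero: "Re (energy_form \<mu> e \<Phi> \<Phi>) = 0"
    by (simp add: energy_form_def norm1 e_def)
  define c where "c = real N / 2 * (real N / 2 + 1)"
  define \<Theta> where "\<Theta> = casimir c \<Phi>"
  have \<Theta>: "low \<mu> N \<Theta>" unfolding \<Theta>_def by (rule low_casimir[OF \<Phi>])
  \<comment> \<open>Vary in the direction of two Casimir operators applied to \<open>\<Phi>\<close>.
    Symmetry then moves one of them across, and both terms become the form at
    \<open>\<Theta>\<close>.\<close>
  have "Re (energy_form \<mu> e \<Phi> (casimir c \<Theta>) + energy_form \<mu> e (casimir c \<Theta>) \<Phi>) = 0"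
    by (rule energy_form_min[OF \<Phi> low_casimir[OF \<Theta>] nonneg zero])
  then have "Re (energy_form \<mu> e \<Theta> \<Theta>) = 0"
    unfolding energy_form_casimir[OF \<Phi> \<Theta>] energy_form_casimir[OF \<Theta> \<Phi>, symmetric] \<Theta>_def[symmetric] by simp
  then have eT: "Re (hop_form \<mu> \<Theta> \<Theta>) = e * Re (ip LM \<Theta> \<Theta>)" by (simp add: energy_form_def)
  have "Re (ip LM \<Theta> \<Theta>) = 0"
  proof (rule ccontr)
    assume ne: "Re (ip LM \<Theta> \<Theta>) \<noteq> 0"
    define k where "k = (1 + 12 * \<mu>\<^sup>2) ^ N"
    have k: "k > 0" unfolding k_def by (intro zero_less_power add_pos_nonneg) auto
    have iso: "Re (ip LM \<Theta> \<Theta>) = k * Re (ip MM \<Theta> \<Theta>)"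
      using ip_ker_b[OF lowD(1)[OF \<Theta>] lowD(1)[OF \<Theta>] lowD(2)[OF \<Theta>] lowD(2)[OF \<Theta>]] unfolding k_def by simp
    have hop: "Re (hop_form \<mu> \<Theta> \<Theta>) = k * Re (hop_M \<Theta> \<Theta>)"
      using hop_form_eq_hop_M[OF lowD(1)[OF \<Theta>] lowD(1)[OF \<Theta>] lowD(2)[OF \<Theta>] lowD(2)[OF \<Theta>] N0] unfolding k_def by simp
    have neM: "Re (ip MM \<Theta> \<Theta>) \<noteq> 0" using ne iso by auto
    then have pos: "Re (ip MM \<Theta> \<Theta>) > 0" using Re_ip_self_nonneg[of MM \<Theta>] by simp
    have mv: "card (moves A) + 12 \<le> 6 * h \<and> 3 \<le> h" if "A \<subseteq> MM" "\<Theta> A \<noteq> 0" for A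
      using casimir_moves[OF \<Phi> _ that(1)] that(2) \<open>\<mu> > 0\<close> hL unfolding \<Theta>_def c_def h_def by simp
    obtain A where "A \<subseteq> MM" "\<Theta> A \<noteq> 0" using neM Re_ip_self_eq_0_iff[of MM \<Theta>] by auto
    then have h3: "3 \<le> h" using mv by blast
    have "2 * h \<le> L" using N(2) by (simp add: h_def)
    then obtain r K where K: "2 * r + 1 \<le> L" "K \<subseteq> momentum_box r" "card K = h" "(\<Sum>n\<in>K. 6 - dispersion L n) < 12"
      using exists_momenta[OF h3] by blast
    have "K \<subseteq> {- int r..<- int r + int L} \<times> {- int r..<- int r + int L}"
      using K(1,2) by (auto simp: momentum_box_def)
    from trial[OF this K(3)] have "e \<le> (\<Sum>n\<in>K. 6 - dispersion L n) - 6 * real h"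
      unfolding le using \<open>t > 0\<close> by simp
    then have e12: "e < 12 - 6 * real h" using K(4) by simp
    \<comment> \<open>\<open>\<Theta>\<close> lives on configurations with at most 6 h - 12 moves,
      so its hopping energy is at least 12 - 6 h per unit norm on M, whereas it should equal
      \<open>e\<close> < 12 - 6 h.\<close>
    have "(12 - 6 * real h) * Re (ip MM \<Theta> \<Theta>) = - (\<Sum>A\<in>Pow MM. (6 * real h - 12) * (norm (\<Theta> A))\<^sup>2)"
      unfolding sum_distrib_left[symmetric] ip_self Re_complex_of_real by (simp only: algebra_simps)
    also have "\<dots> \<le> - (\<Sum>A\<in>Pow MM. real (card (moves A)) * (norm (\<Theta> A))\<^sup>2)"
    proof (subst neg_le_iff_le, rule sum_mono)
      fix A assume "A \<in> Pow MM"
      then have A: "A \<subseteq> MM" by simp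
      show "real (card (moves A)) * (norm (\<Theta> A))\<^sup>2 \<le> (6 * real h - 12) * (norm (\<Theta> A))\<^sup>2"
      proof (cases "\<Theta> A = 0")
        case False
        then have "card (moves A) + 12 \<le> 6 * h" using mv[OF A] by blast
        then have "real (card (moves A)) \<le> 6 * real h - 12" by linarith
        then show ?thesis by (rule mult_right_mono) simp
      qed simp
    qed
    also have "\<dots> \<le> Re (hop_M \<Theta> \<Theta>)" by (rule hop_M_ge[OF lowD(3)[OF \<Theta>]])
    finally have "k * ((12 - 6 * real h) * Re (ip MM \<Theta> \<Theta>)) \<le> k * Re (hop_M \<Theta> \<Theta>)"
      using k by (intro mult_left_mono) auto
    also have "\<dots> = k * (e * Re (ip MM \<Theta> \<Theta>))" using eT unfolding hop iso by simp
    finally have "(12 - 6 * real h) * Re (ip MM \<Theta> \<Theta>) \<le> e * Re (ip MM \<Theta> \<Theta>)" using k by simp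
    then show False using e12 pos by simp
  qed
  then have "\<forall>A\<subseteq>LM. \<Theta> A = 0" using Re_ip_self_eq_0_iff[of LM \<Theta>] by simp
  then have "\<Theta> = (\<lambda>_. 0)" using nstate_outside[OF lowD(1)[OF \<Theta>]] by blast
  then show ?thesis by (simp add: \<Theta>_def c_def)
qed

end

theorem theorem5:
  fixes L Ne :: nat and B :: "(pt \<times> pt) set" and t \<mu> :: real and \<Phi> :: state
  assumes "L \<ge> 3"
    and "valid_bonds L B"
    and "t > 0" and "\<mu> > 0"
    and "Ne \<le> card (Msites L)"
    and "real Ne \<ge> real (card (Msites L)) - sqrt (real (card (Msites L))) / 2"
    and "ground_state L B t \<mu> Ne \<Phi>"
  shows "Stot_sq L B \<Phi> = (\<lambda>A. complex_of_real (real Ne / 2 * (real Ne / 2 + 1)) * \<Phi> A)"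
proof -
  interpret bonds L B using assms(1,2) by unfold_locales
  have N: "Ne \<le> L * L" using assms(5) by (simp add: card_Msites)
  \<comment> \<open>The square root of the number of sites is \<open>L\<close>, so the hypothesis
    bounds the number of holes by half of \<open>L\<close>.\<close>
  have "real (L * L) - real Ne \<le> real L / 2" using assms(6) by (simp add: card_Msites)
  then have "2 * (L * L - Ne) \<le> L" using N by (simp add: of_nat_diff flip: of_nat_le_iff[where 'a = real])
  from casimir_ground_state[OF assms(3,4) N this assms(7)]
  have "Stot_sq L B \<Phi> A + complex_of_real (- (real Ne / 2 * (real Ne / 2 + 1))) * \<Phi> A = 0" for A
    unfolding casimir_def by (rule fun_cong)
  then show ?thesis by (auto simp: fun_eq_iff add_eq_0_iff)
qed

end
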